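(* Let $K$ be a compact convex subset of a locally convex vector space (not assumed metrizable). Let $\mu,\nu\in M^+(K)$ satisfy $\mu\prec_c\nu$. Then there is a family $\{\lambda_x\}_{x\in K}\subset P(K)$ of probability measures such that (1) for every $a\in A(K)$, $\lambda_x(a)=a(x)$ for $\mu$-a.e. $x\in K$; (2) for every $f\in\mathrm{C}(K)$, the function $x\mapsto\lambda_x(f)$ is $\mu$-measurable; and (3) $\int_K f\,d\nu=\int_K\lambda_x(f)\,d\mu(x)$ for all $f\in\mathrm{C}(K)$.
   Context: $\mathrm{C}(K)$ is the C*-algebra of continuous complex-valued functions on $K$, and $A(K)\subset \mathrm{C}(K)$ is the space of continuous affine functions on $K$. $M^+(K)$ is the set of (finite) positive regular Borel measures on $K$ and $P(K)$ the set of regular Borel probability measures on $K$; write $\lambda(f)=\int_K f\,d\lambda$. The Choquet order is defined by: $\mu\prec_c\nu$ if $\mu(f)\le\nu(f)$ for every continuous convex (real-valued) function $f\in\mathrm{C}(K)$. "$\mu$-measurable" means measurable with respect to the $\mu$-completion of the Borel $\sigma$-algebra. In (1), the exceptional null set may depend on $a$. *)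

theory Defs
  imports "HOL-Probability.Probability_Measure"
begin

text \<open>Real topological vector spaces and locally convex spaces. As usual in Choquet theory, locally
  convex spaces are Hausdorff. Complex locally convex spaces are covered through their underlying
  real structure.\<close>

class real_topological_vector = real_vector + topological_ab_group_add +
  assumes tendsto_scaleR_Pair:
    "LIM p (nhds t \<times>\<^sub>F nhds x). fst p *\<^sub>R snd p :> nhds (t *\<^sub>R x)"

class locally_convex_space = real_topological_vector + t2_space +
  assumes locally_convex_0:
    "open U \<Longrightarrow> 0 \<in> U \<Longrightarrow> \<exists>V. open V \<and> 0 \<in> V \<and>
      (\<forall>x\<in>V. \<forall>y\<in>V. \<forall>u\<ge>0. \<forall>v\<ge>0. u + v = 1 \<longrightarrow> u *\<^sub>R x + v *\<^sub>R y \<in> V) \<and> V \<subseteq> U"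

text \<open>The constant \<open>convex\<close> is not usable inside the class specification, hence the unfolded form
  above.\<close>

lemma locally_convex_nhd_0:
  fixes U :: "'a::locally_convex_space set"
  assumes "open U" "0 \<in> U"
  shows "\<exists>V. open V \<and> 0 \<in> V \<and> convex V \<and> V \<subseteq> U"
  using locally_convex_0[OF assms] by (simp only: convex_def)

instance real_normed_vector \<subseteq> locally_convex_space
proof
  fix t :: real and x :: 'a
  have "((\<lambda>p. fst p) \<longlongrightarrow> t) (nhds t \<times>\<^sub>F nhds x)" "((\<lambda>p. snd p) \<longlongrightarrow> x) (nhds t \<times>\<^sub>F nhds x)"
    by (rule filterlim_fst filterlim_snd)+
  then show "LIM p (nhds t \<times>\<^sub>F nhds x). fst p *\<^sub>R snd p :> nhds (t *\<^sub>R x)"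
    by (rule tendsto_scaleR)
next
  fix U :: "'a set"
  assume "open U" "0 \<in> U"
  then obtain e where "e > 0" "ball 0 e \<subseteq> U"
    by (meson openE)
  then show "\<exists>V. open V \<and> 0 \<in> V \<and>
      (\<forall>x\<in>V. \<forall>y\<in>V. \<forall>u\<ge>0. \<forall>v\<ge>0. u + v = 1 \<longrightarrow> u *\<^sub>R x + v *\<^sub>R y \<in> V) \<and> V \<subseteq> U"
    using convex_ball[of "0::'a" e] by (intro exI[of _ "ball 0 e"]) (auto simp: convex_def)
qed

text \<open>Finite positive regular Borel measures on a set, the set carrying the subspace topology. The
  measures have space \<open>K\<close>, so that integrals against them depend only on the values of the
  integrand on \<open>K\<close>; functions on \<open>K\<close> are therefore modelled by functions on the ambient type.\<close>

definition regular_borel_measures :: "'a::t2_space set \<Rightarrow> 'a measure set" where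
  "regular_borel_measures K = {M. sets M = sets (restrict_space borel K) \<and> finite_measure M \<and>
     (\<forall>A\<in>sets M.
        emeasure M A = (SUP C\<in>{C. compact C \<and> C \<subseteq> A}. emeasure M C) \<and>
        emeasure M A = (INF U\<in>{U. openin (top_of_set K) U \<and> A \<subseteq> U}. emeasure M U))}"

definition regular_borel_probs :: "'a::t2_space set \<Rightarrow> 'a measure set" where
  "regular_borel_probs K = {M \<in> regular_borel_measures K. prob_space M}"

definition affine_map_on :: "'a::real_vector set \<Rightarrow> ('a \<Rightarrow> 'b::real_vector) \<Rightarrow> bool" where
  "affine_map_on K a \<longleftrightarrow> (\<forall>x\<in>K. \<forall>y\<in>K. \<forall>u\<ge>0. \<forall>v\<ge>0. u + v = 1 \<longrightarrow>
     a (u *\<^sub>R x + v *\<^sub>R y) = u *\<^sub>R a x + v *\<^sub>R a y)"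

definition cont_affine :: "'a::locally_convex_space set \<Rightarrow> ('a \<Rightarrow> complex) set" where
  "cont_affine K = {a. continuous_on K a \<and> affine_map_on K a}"

definition choquet_le :: "'a::locally_convex_space set \<Rightarrow> 'a measure \<Rightarrow> 'a measure \<Rightarrow> bool" where
  "choquet_le K \<mu> \<nu> \<longleftrightarrow> (\<forall>f :: 'a \<Rightarrow> real. continuous_on K f \<and> convex_on K f \<longrightarrow>
     (\<integral>x. f x \<partial>\<mu>) \<le> (\<integral>x. f x \<partial>\<nu>))"

end

theory Submission
  imports Defs "HOL-Probability.Conditional_Expectation"
begin

text \<open>
  A family \<open>\<lambda>_x\<close> as required is the disintegration, over the first coordinate, of a measure on
  \<open>K \<times> K\<close> with marginals \<open>\<mu>\<close> and \<open>\<nu>\<close> under which the second coordinate has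
  conditional barycenter the first one. The proof finds such a coupling as a positive functional,
  differentiates it with respect to \<open>\<mu>\<close>, chooses versions of the derivatives that are linear at
  every single point, and represents the resulting functionals by measures.

  \<^emph>\<open>Coupling.\<close> The functional \<open>\<Lambda>\<close> on bounded functions on \<open>K \<times> K\<close> has to satisfy
  \<open>\<Lambda> (g(x)) = \<mu>(g)\<close>, \<open>\<Lambda> (f(y)) = \<nu>(f)\<close> and \<open>\<Lambda> (g(x) (a(y) - a(x))) = 0\<close> for
  affine \<open>a\<close>. By Hahn--Banach (\<open>sublinear_dominates_linear\<close>) it exists as soon as
  \<open>0 \<le> g(x) + f(y) + d(x, y)\<close> implies \<open>0 \<le> \<mu>(g) + \<nu>(f)\<close>, where \<open>d\<close> is a sum of
  functions of the third kind. Put \<open>c(y) = sup_x (- g(x) - d(x, y))\<close>. This function is continuous and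
  convex, it lies below \<open>f\<close>, and the choice \<open>x = y\<close> shows that it lies above \<open>- g\<close>. Hence
  \<open>\<nu>(f) \<ge> \<nu>(c) \<ge> \<mu>(c) \<ge> - \<mu>(g)\<close>, the middle inequality being the Choquet order
  (\<open>integral_nonneg_of_majorant\<close>, \<open>coupling_functional\<close>). As \<open>c\<close> is continuous for every
  bounded \<open>g\<close>, one may let \<open>g\<close> range over all bounded Borel functions, indicators included.

  \<^emph>\<open>Differentiation.\<close> For fixed \<open>f\<close> the set function \<open>E \<mapsto> \<Lambda> (1_E(x) f(y))\<close> is bounded by a
  multiple of \<open>\<mu>\<close>; let \<open>T f\<close> be its density. Up to null sets, \<open>T\<close> is linear and positive, it fixes
  affine functions, and \<open>\<mu>(T f) = \<nu>(f)\<close> (\<open>cond_operator_exists\<close>).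

  \<^emph>\<open>Versions.\<close> Without metrizability there are too many functions \<open>f\<close> to discard all the null sets
  at once, and a lifting of \<open>\<mu>\<close> takes over. It is used in the following form
  (\<open>lifting_filters\<close>): every point \<open>x\<close> carries a proper filter \<open>F x\<close> containing all sets of full
  measure, and every measurable \<open>E\<close> belongs to \<open>F x\<close> for almost all \<open>x \<in> E\<close>. The upper limit of
  \<open>T f\<close> along \<open>F x\<close> is a sublinear functional of \<open>f\<close> at every point \<open>x\<close>, and for each \<open>f\<close> it is at most
  \<open>T f x\<close> for almost every \<open>x\<close>. A linear functional \<open>l x\<close> below it is positive and normalized for
  every \<open>x\<close>, and applying the upper bound to \<open>f\<close> and \<open>- f\<close> gives \<open>l x f = T f x\<close> almost everywhere
  (\<open>pointwise_states\<close>). The Riesz representation theorem (\<open>riesz_representation\<close>) turns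
  \<open>l x\<close> into \<open>\<lambda>_x\<close>.

  \<^emph>\<open>Existence of the lifting.\<close> Zorn's lemma is applied to pairs of a sub-\<open>\<sigma>\<close>-algebra and a family of
  filters generated by its sets. A single set can always be adjoined (\<open>filter_lifting_adjoin\<close>).
  A chain whose union is a \<open>\<sigma>\<close>-algebra is bounded by that union; any other chain has a cofinal
  sequence, and for sequences the almost everywhere convergence of the conditional probabilities of a
  set decides which sets belong to the limit filters (\<open>filter_lifting_sequence\<close>).
\<close>

section \<open>Linear functionals dominated by sublinear ones\<close>

text \<open>Functions are added and scaled pointwise on an explicit carrier, since the spaces in question
  consist of functions on the whole ambient type that are controlled only on a subset.\<close>
definition function_space :: "('a \<Rightarrow> real) set \<Rightarrow> bool" where
  "function_space V \<longleftrightarrow> (\<lambda>_. 0) \<in> V \<and> (\<forall>f\<in>V. \<forall>g\<in>V. (\<lambda>x. f x + g x) \<in> V) \<and> (\<forall>f\<in>V. \<forall>c. (\<lambda>x. c * f x) \<in> V)"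

definition sublinear_on :: "('a \<Rightarrow> real) set \<Rightarrow> (('a \<Rightarrow> real) \<Rightarrow> real) \<Rightarrow> bool" where
  "sublinear_on V p \<longleftrightarrow> (\<forall>f\<in>V. \<forall>g\<in>V. p (\<lambda>x. f x + g x) \<le> p f + p g) \<and>
     (\<forall>f\<in>V. \<forall>c\<ge>0. p (\<lambda>x. c * f x) = c * p f)"

definition linear_functional_on :: "('a \<Rightarrow> real) set \<Rightarrow> (('a \<Rightarrow> real) \<Rightarrow> real) \<Rightarrow> bool" where
  "linear_functional_on V L \<longleftrightarrow> (\<forall>f\<in>V. \<forall>g\<in>V. L (\<lambda>x. f x + g x) = L f + L g) \<and>
     (\<forall>f\<in>V. \<forall>c. L (\<lambda>x. c * f x) = c * L f)"

lemma function_spaceD: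
  assumes "function_space V"
  shows "(\<lambda>_. 0) \<in> V" "f \<in> V \<Longrightarrow> g \<in> V \<Longrightarrow> (\<lambda>x. f x + g x) \<in> V" "f \<in> V \<Longrightarrow> (\<lambda>x. c * f x) \<in> V"
    "f \<in> V \<Longrightarrow> (\<lambda>x. - f x) \<in> V" "f \<in> V \<Longrightarrow> g \<in> V \<Longrightarrow> (\<lambda>x. f x - g x) \<in> V"
proof -
  show 1: "(\<lambda>_. 0) \<in> V" "f \<in> V \<Longrightarrow> g \<in> V \<Longrightarrow> (\<lambda>x. f x + g x) \<in> V" "f \<in> V \<Longrightarrow> (\<lambda>x. c * f x) \<in> V" for f g c
    using assms unfolding function_space_def by blast+
  show 2: "f \<in> V \<Longrightarrow> (\<lambda>x. - f x) \<in> V" for f using 1(3)[of f "-1"] by simp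
  show "f \<in> V \<Longrightarrow> g \<in> V \<Longrightarrow> (\<lambda>x. f x - g x) \<in> V" using 1(2)[of f "\<lambda>x. - g x"] 2[of g] by simp
qed

lemma sublinear_onD:
  assumes "sublinear_on V p"
  shows "f \<in> V \<Longrightarrow> g \<in> V \<Longrightarrow> p (\<lambda>x. f x + g x) \<le> p f + p g" "f \<in> V \<Longrightarrow> 0 \<le> c \<Longrightarrow> p (\<lambda>x. c * f x) = c * p f"
  using assms unfolding sublinear_on_def by blast+

lemma sublinear_on_zero:
  assumes "function_space V" "sublinear_on V p" shows "p (\<lambda>_. 0) = 0"
  using sublinear_onD(2)[OF assms(2) function_spaceD(1)[OF assms(1)], of 0] by simp

lemma sublinear_on_lower:
  assumes "function_space V" "sublinear_on V p" "f \<in> V" shows "- p (\<lambda>x. - f x) \<le> p f"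
  using sublinear_onD(1)[OF assms(2,3) function_spaceD(4)[OF assms(1,3)]] sublinear_on_zero[OF assms(1,2)] by simp

text \<open>For positive scalars the inequality suffices: applying it to the inverse scalar gives the
  converse.\<close>
lemma sublinear_onI:
  assumes V: "function_space V"
    and add: "\<And>f g. f \<in> V \<Longrightarrow> g \<in> V \<Longrightarrow> p (\<lambda>x. f x + g x) \<le> p f + p g"
    and scale: "\<And>f c. f \<in> V \<Longrightarrow> 0 < c \<Longrightarrow> p (\<lambda>x. c * f x) \<le> c * p f"
    and zero: "p (\<lambda>_. 0) = 0"
  shows "sublinear_on V p"
  unfolding sublinear_on_def
proof (intro conjI ballI allI impI add)
  fix f and c :: real assume f: "f \<in> V" and "0 \<le> c"
  then consider "c = 0" | "0 < c" by linarith
  then show "p (\<lambda>x. c * f x) = c * p f"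
  proof cases
    case 2
    have "c * p f = c * p (\<lambda>x. inverse c * (c * f x))" using 2 by (simp flip: mult.assoc)
    also have "\<dots> \<le> c * (inverse c * p (\<lambda>x. c * f x))"
      using 2 function_spaceD(3)[OF V f] by (intro mult_left_mono scale) auto
    also have "\<dots> = p (\<lambda>x. c * f x)" using 2 by simp
    finally show ?thesis using scale[OF f 2] by simp
  qed (simp add: zero)
qed

text \<open>The functional \<open>q\<close> lies below \<open>p\<close> (take \<open>t = 0\<close>), and \<open>t = 1\<close> shows that equality of the two
  would make \<open>p\<close> additive in the direction \<open>g\<close>. A minimal sublinear functional is therefore linear,
  which is how the lemma is used.\<close>
lemma sublinear_on_shift:
  assumes V: "function_space V" and p: "sublinear_on V p" and g: "g \<in> V"
  defines "q \<equiv> \<lambda>f. if f \<in> V then INF t\<in>{0..}. p (\<lambda>x. f x + t * g x) - t * p g else 0"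
  shows "sublinear_on V q" and "\<And>f t. f \<in> V \<Longrightarrow> 0 \<le> t \<Longrightarrow> q f \<le> p (\<lambda>x. f x + t * g x) - t * p g"
proof -
  note VD = function_spaceD[OF V] and pD = sublinear_onD[OF p]
  have bd: "- p (\<lambda>x. - f x) \<le> p (\<lambda>x. f x + t * g x) - t * p g" if "f \<in> V" "0 \<le> t" for f t
  proof -
    have "t * p g = p (\<lambda>x. t * g x)" using pD(2)[OF g that(2)] by simp
    also have "\<dots> = p (\<lambda>x. (f x + t * g x) + - f x)" by simp
    also have "\<dots> \<le> p (\<lambda>x. f x + t * g x) + p (\<lambda>x. - f x)" using VD that g by (intro pD) auto
    finally show ?thesis by simp
  qed
  then have bdd: "bdd_below ((\<lambda>t. p (\<lambda>x. f x + t * g x) - t * p g) ` {0..})" if "f \<in> V" for f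
    using that by (intro bdd_belowI2[where m="- p (\<lambda>x. - f x)"]) auto
  show ub: "q f \<le> p (\<lambda>x. f x + t * g x) - t * p g" if "f \<in> V" "0 \<le> t" for f t
    using bdd that unfolding q_def by (auto intro: cINF_lower)
  have approx: "\<exists>t\<ge>0. p (\<lambda>x. f x + t * g x) - t * p g < q f + e" if "f \<in> V" "0 < e" for f e
  proof -
    have "q f = (INF t\<in>{0..}. p (\<lambda>x. f x + t * g x) - t * p g)" using that by (simp add: q_def)
    then have "(INF t\<in>{0..}. p (\<lambda>x. f x + t * g x) - t * p g) < q f + e" using that by simp
    then show ?thesis using bdd[OF that(1)] by (subst (asm) cINF_less_iff) auto
  qed
  show "sublinear_on V q"
  proof (rule sublinear_onI[OF V])
    fix f h assume f: "f \<in> V" and h: "h \<in> V"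
    show "q (\<lambda>x. f x + h x) \<le> q f + q h"
    proof (rule field_le_epsilon)
      fix e :: real assume "0 < e"
      then have "0 < e / 2" by simp
      then obtain s t where s: "0 \<le> s" "p (\<lambda>x. f x + s * g x) - s * p g < q f + e / 2"
        and t: "0 \<le> t" "p (\<lambda>x. h x + t * g x) - t * p g < q h + e / 2"
        using approx f h by meson
      have "q (\<lambda>x. f x + h x) \<le> p (\<lambda>x. (f x + h x) + (s + t) * g x) - (s + t) * p g"
        using VD f h s t by (intro ub) auto
      also have "(\<lambda>x. (f x + h x) + (s + t) * g x) = (\<lambda>x. (f x + s * g x) + (h x + t * g x))"
        by (auto simp: algebra_simps)
      also have "p \<dots> \<le> p (\<lambda>x. f x + s * g x) + p (\<lambda>x. h x + t * g x)"
        using VD f h g by (intro pD) auto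
      finally show "q (\<lambda>x. f x + h x) \<le> q f + q h + e"
        using s t by (simp add: algebra_simps)
    qed
  next
    fix f and c :: real assume f: "f \<in> V" and c: "0 < c"
    show "q (\<lambda>x. c * f x) \<le> c * q f"
    proof (rule field_le_epsilon)
      fix e :: real assume "0 < e"
      then obtain t where t: "0 \<le> t" "p (\<lambda>x. f x + t * g x) - t * p g < q f + e / c"
        using approx[OF f, of "e / c"] c by auto
      have "q (\<lambda>x. c * f x) \<le> p (\<lambda>x. c * f x + (c * t) * g x) - (c * t) * p g"
        using VD f c t by (intro ub) auto
      also have "(\<lambda>x. c * f x + (c * t) * g x) = (\<lambda>x. c * (f x + t * g x))"
        by (auto simp: algebra_simps)
      also have "p \<dots> = c * p (\<lambda>x. f x + t * g x)" using VD f g c by (intro pD) auto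
      also have "\<dots> - c * t * p g = c * (p (\<lambda>x. f x + t * g x) - t * p g)" by (simp add: algebra_simps)
      also have "\<dots> \<le> c * (q f + e / c)" using t c by (intro mult_left_mono) auto
      also have "\<dots> = c * q f + e" using c by (simp add: algebra_simps)
      finally show "q (\<lambda>x. c * f x) \<le> c * q f + e" .
    qed
  next
    have "(\<lambda>t. p (\<lambda>x. t * g x) - t * p g) ` {0..} = {0}"
      using pD(2)[OF g] by (auto intro!: image_eqI[of _ _ 0] simp: sublinear_on_zero[OF V p])
    then show "q (\<lambda>_. 0) = 0" using VD by (simp add: q_def)
  qed
qed

text \<open>The theorem of Hahn and Banach. Zorn's lemma yields a minimal sublinear functional below \<open>p\<close>,
  and \<open>sublinear_on_shift\<close> shows that minimal ones are linear. Setting the functionals to \<open>0\<close> outside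
  \<open>V\<close> makes the pointwise order antisymmetric.\<close>
theorem sublinear_dominates_linear:
  assumes V: "function_space V" and p: "sublinear_on V p"
  obtains L where "linear_functional_on V L" "\<And>f. f \<in> V \<Longrightarrow> L f \<le> p f"
proof -
  note VD = function_spaceD[OF V]
  define X where "X = {q. sublinear_on V q \<and> (\<forall>f\<in>V. q f \<le> p f) \<and> (\<forall>f. f \<notin> V \<longrightarrow> q f = 0)}"
  have lower: "- p (\<lambda>x. - f x) \<le> q f" if "q \<in> X" "f \<in> V" for q f
    using sublinear_on_lower[OF V, of q f] that VD(4)[OF that(2)] by (fastforce simp: X_def)
  have restr: "sublinear_on V (\<lambda>f. if f \<in> V then q f else 0)" if "sublinear_on V q" for q
    using that VD unfolding sublinear_on_def by auto
  have "\<exists>m\<in>X. \<forall>q\<in>X. (\<forall>f. q f \<le> m f) \<longrightarrow> q = m"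
  proof (rule predicate_Zorn)
    show "partial_order_on X (relation_of (\<lambda>a b. \<forall>f. b f \<le> a f) X)"
      by (rule partial_order_on_relation_ofI) (blast intro: order_trans ext order_antisym)+
    fix C assume "C \<in> Chains (relation_of (\<lambda>a b. \<forall>f. b f \<le> a f) X)"
    then have C: "C \<subseteq> X" and tot: "\<And>a b. a \<in> C \<Longrightarrow> b \<in> C \<Longrightarrow> (\<forall>f. b f \<le> a f) \<or> (\<forall>f. a f \<le> b f)"
      by (auto simp: Chains_def relation_of_def)
    show "\<exists>u\<in>X. \<forall>a\<in>C. \<forall>f. u f \<le> a f"
    proof (cases "C = {}")
      case True
      have "(\<lambda>f. if f \<in> V then p f else 0) \<in> X" using restr[OF p] by (auto simp: X_def)
      with True show ?thesis by auto
    next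
      case False
      define u where "u f = (INF q\<in>C. q f)" for f
      have bdd: "bdd_below ((\<lambda>q. q f) ` C)" for f
      proof (cases "f \<in> V")
        case True then show ?thesis using C lower by (intro bdd_belowI2[where m="- p (\<lambda>x. - f x)"]) auto
      next
        case False then show ?thesis using C by (intro bdd_belowI2[where m="0"]) (auto simp: X_def)
      qed
      have u_le: "u f \<le> q f" if "q \<in> C" for q f unfolding u_def by (rule cINF_lower[OF bdd that])
      have approx: "\<exists>q\<in>C. q f < u f + e" if "0 < e" for f e
        using cINF_less_iff[OF False bdd, of f "u f + e"] that by (simp add: u_def)
      have "u \<in> X"
        unfolding X_def mem_Collect_eq
      proof (intro conjI ballI allI impI)
        show "u f \<le> p f" if "f \<in> V" for f
        proof -
          obtain q where q: "q \<in> C" using False by blast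
          have "u f \<le> q f" by (rule u_le[OF q])
          also have "q f \<le> p f" using q C that by (auto simp: X_def)
          finally show ?thesis .
        qed
        show "u f = 0" if "f \<notin> V" for f
        proof -
          have "q f = 0" if "q \<in> C" for q using that C \<open>f \<notin> V\<close> by (auto simp: X_def)
          then have "u f = (INF q\<in>C. 0)" unfolding u_def by (intro INF_cong) auto
          then show ?thesis using False by simp
        qed
        show "sublinear_on V u"
          unfolding sublinear_on_def
        proof (intro conjI ballI allI impI)
          fix f g assume f: "f \<in> V" and g: "g \<in> V"
          show "u (\<lambda>x. f x + g x) \<le> u f + u g"
          proof (rule field_le_epsilon)
            fix e :: real assume "0 < e"
            then have "0 < e / 2" by simp
            then obtain a b where ab: "a \<in> C" "a f < u f + e / 2" "b \<in> C" "b g < u g + e / 2"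
              using approx by meson
            obtain c where c: "c \<in> C" "c f \<le> a f" "c g \<le> b g"
              using tot[OF ab(1,3)] ab by (metis order_refl)
            have "u (\<lambda>x. f x + g x) \<le> c (\<lambda>x. f x + g x)" by (rule u_le) fact
            also have "\<dots> \<le> c f + c g" using c(1) C f g by (intro sublinear_onD) (auto simp: X_def)
            finally show "u (\<lambda>x. f x + g x) \<le> u f + u g + e" using ab c by simp
          qed
        next
          fix f and c :: real assume f: "f \<in> V" and c: "0 \<le> c"
          have eq: "q (\<lambda>x. c * f x) = c * q f" if "q \<in> C" for q
            using that C f c by (intro sublinear_onD) (auto simp: X_def)
          have "u (\<lambda>x. c * f x) = (INF q\<in>C. c * q f)" unfolding u_def by (intro INF_cong eq) auto
          also have "\<dots> = c * u f"
          proof (cases "c = 0")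
            case False
            then have "mono (\<lambda>r. c * r)" using c by (auto simp: mono_def mult_left_mono)
            moreover have "continuous (at_right (u f)) (\<lambda>r. c * r)" by (intro continuous_intros)
            ultimately show ?thesis
              unfolding u_def using continuous_at_Inf_mono[of "\<lambda>r. c * r" "(\<lambda>q. q f) ` C"] False \<open>C \<noteq> {}\<close> bdd
              by (auto simp: image_image)
          qed (use \<open>C \<noteq> {}\<close> in simp)
          finally show "u (\<lambda>x. c * f x) = c * u f" .
        qed
      qed
      then show ?thesis using u_le by blast
    qed
  qed
  then obtain m where m: "m \<in> X" and min: "\<And>q. q \<in> X \<Longrightarrow> (\<And>f. q f \<le> m f) \<Longrightarrow> q = m" by blast
  have sm: "sublinear_on V m" using m by (simp add: X_def)
  note mD = sublinear_onD[OF sm]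
  have add: "m (\<lambda>x. f x + g x) = m f + m g" if f: "f \<in> V" and g: "g \<in> V" for f g
  proof -
    define q where "q = (\<lambda>f. if f \<in> V then INF t\<in>{0..}. m (\<lambda>x. f x + t * g x) - t * m g else 0)"
    have q: "sublinear_on V q" "\<And>f t. f \<in> V \<Longrightarrow> 0 \<le> t \<Longrightarrow> q f \<le> m (\<lambda>x. f x + t * g x) - t * m g"
      unfolding q_def using sublinear_on_shift[OF V sm g] by blast+
    have qm: "q f \<le> m f" for f
      using q(2)[of f 0] m by (cases "f \<in> V") (auto simp: q_def X_def)
    moreover have "q \<in> X"
      unfolding X_def mem_Collect_eq
    proof (intro conjI ballI allI impI)
      show "q f \<le> p f" if "f \<in> V" for f
        using qm[of f] m that by (force simp: X_def)
    qed (use q(1) in \<open>simp_all add: q_def\<close>)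
    ultimately have "q = m" by (rule min[rotated])
    then have "m f \<le> m (\<lambda>x. f x + 1 * g x) - 1 * m g" using q(2)[OF f zero_le_one] by (simp only: \<open>q = m\<close>)
    then have "m f \<le> m (\<lambda>x. f x + g x) - m g" by simp
    with mD(1)[OF f g] show ?thesis by simp
  qed
  have "linear_functional_on V m"
    unfolding linear_functional_on_def
  proof (intro conjI ballI allI)
    fix f and c :: real assume f: "f \<in> V"
    show "m (\<lambda>x. c * f x) = c * m f"
    proof (cases "0 \<le> c")
      case True then show ?thesis using mD(2)[OF f] by simp
    next
      case False
      have "m (\<lambda>x. c * f x) + m (\<lambda>x. (- c) * f x) = m (\<lambda>x. c * f x + (- c) * f x)"
        using VD(3)[OF f] by (intro add[symmetric])
      also have "\<dots> = 0" using sublinear_on_zero[OF V sm] by simp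
      finally show ?thesis using mD(2)[OF f, of "- c"] False by simp
    qed
  qed (rule add)
  moreover have "m f \<le> p f" if "f \<in> V" for f using m that by (simp add: X_def)
  ultimately show ?thesis by (rule that)
qed

section \<open>The Riesz representation on compact Hausdorff subspaces\<close>

lemma integrable_continuous_on:
  fixes f :: "'a::t2_space \<Rightarrow> 'b::{banach, second_countable_topology}"
  assumes K: "compact K" and M: "finite_measure M" "sets M = sets (restrict_space borel K)"
    and f: "continuous_on K f"
  shows "f \<in> borel_measurable M" "integrable M f"
proof -
  interpret finite_measure M by fact
  show *: "f \<in> borel_measurable M"
    using borel_measurable_continuous_on_restrict[OF f] M(2) by (simp cong: measurable_cong_sets)
  obtain B where "\<And>x. x \<in> K \<Longrightarrow> norm (f x) \<le> B"
    using compact_imp_bounded[OF compact_continuous_image[OF f K]] by (auto simp: bounded_iff)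
  moreover have "space M = K" using sets_eq_imp_space_eq[OF M(2)] by (simp add: space_restrict_space)
  ultimately show "integrable M f"
    using * by (intro integrable_const_bound[where B=B]) auto
qed

locale positive_functional =
  fixes K :: "'a::t2_space set" and \<Lambda> :: "('a \<Rightarrow> real) \<Rightarrow> real"
  assumes compact_K: "compact K"
    and linear: "linear_functional_on {f. continuous_on K f} \<Lambda>"
    and pos: "\<And>f. continuous_on K f \<Longrightarrow> (\<And>x. x \<in> K \<Longrightarrow> 0 \<le> f x) \<Longrightarrow> 0 \<le> \<Lambda> f"
begin

abbreviation "X \<equiv> top_of_set K"

lemma add: "continuous_on K f \<Longrightarrow> continuous_on K g \<Longrightarrow> \<Lambda> (\<lambda>x. f x + g x) = \<Lambda> f + \<Lambda> g"
  and scale: "continuous_on K f \<Longrightarrow> \<Lambda> (\<lambda>x. c * f x) = c * \<Lambda> f"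
  using linear by (auto simp: linear_functional_on_def)

lemma mono: 
  assumes f: "continuous_on K f" and g: "continuous_on K g" and le: "\<And>x. x \<in> K \<Longrightarrow> f x \<le> g x"
  shows "\<Lambda> f \<le> \<Lambda> g"
proof -
  have c: "continuous_on K (\<lambda>x. g x - f x)" by (intro continuous_intros f g)
  have "0 \<le> \<Lambda> (\<lambda>x. g x - f x)" using le by (intro pos c) auto
  moreover have "\<Lambda> (\<lambda>x. f x + (g x - f x)) = \<Lambda> f + \<Lambda> (\<lambda>x. g x - f x)" by (rule add[OF f c])
  ultimately show ?thesis by simp
qed

lemma const: "\<Lambda> (\<lambda>_. c) = c * \<Lambda> (\<lambda>_. 1)"
  using scale[of "\<lambda>_. 1" c] by simp

lemma one_nonneg: "0 \<le> \<Lambda> (\<lambda>_. 1)"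
  by (rule pos) auto

text \<open>The functions \<open>below\<close> an open set vanish outside of it, but their supports may touch its
  boundary. The truncations \<open>max 0 (f - e)\<close> restore the separation that the classical construction
  obtains from compact supports, at a cost that vanishes with \<open>e\<close>.\<close>
definition below :: "'a set \<Rightarrow> ('a \<Rightarrow> real) \<Rightarrow> bool" where
  "below U f \<longleftrightarrow> continuous_on K f \<and> (\<forall>x\<in>K. 0 \<le> f x \<and> f x \<le> 1) \<and> (\<forall>x\<in>K - U. f x = 0)"

definition weight :: "'a set \<Rightarrow> ennreal" where
  "weight U = (SUP f\<in>{f. below U f}. ennreal (\<Lambda> f))"

lemma below_zero: "below U (\<lambda>_. 0)" by (simp add: below_def)

lemma below_mono: "below U f \<Longrightarrow> U \<inter> K \<subseteq> V \<Longrightarrow> below V f" by (auto simp: below_def)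

lemma belowD: "below U f \<Longrightarrow> continuous_on K f" "below U f \<Longrightarrow> x \<in> K \<Longrightarrow> 0 \<le> f x"
  "below U f \<Longrightarrow> x \<in> K \<Longrightarrow> f x \<le> 1" "below U f \<Longrightarrow> x \<in> K \<Longrightarrow> x \<notin> U \<Longrightarrow> f x = 0"
  by (auto simp: below_def)

lemma weight_upper: "below U f \<Longrightarrow> ennreal (\<Lambda> f) \<le> weight U"
  unfolding weight_def by (rule SUP_upper) simp

lemma weight_least: "(\<And>f. below U f \<Longrightarrow> ennreal (\<Lambda> f) \<le> c) \<Longrightarrow> weight U \<le> c"
  unfolding weight_def by (rule SUP_least) simp

lemma weight_mono: "U \<inter> K \<subseteq> V \<Longrightarrow> weight U \<le> weight V"
  by (rule weight_least, rule weight_upper, rule below_mono)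

lemma weight_K: "weight K = ennreal (\<Lambda> (\<lambda>_. 1))"
proof (rule order_antisym)
  show "weight K \<le> ennreal (\<Lambda> (\<lambda>_. 1))"
    by (intro weight_least ennreal_leI mono) (auto dest: belowD)
  show "ennreal (\<Lambda> (\<lambda>_. 1)) \<le> weight K" by (rule weight_upper) (simp add: below_def)
qed

lemma weight_finite: "weight U < top"
  using weight_mono[of U K] by (auto simp: weight_K intro: le_less_trans)

lemma weight_empty: "weight {} = 0"
proof -
  have "\<Lambda> f \<le> 0" if "below {} f" for f
    using mono[of f "\<lambda>_. 0"] that const[of 0] by (auto simp: below_def)
  then have "weight {} \<le> 0" by (intro weight_least) (simp add: ennreal_neg)
  then show ?thesis by simp
qed

lemma below_truncate:
  assumes f: "below U f" and e: "0 < e"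
  shows "below U (\<lambda>x. max 0 (f x - e))" "\<Lambda> f \<le> \<Lambda> (\<lambda>x. max 0 (f x - e)) + e * \<Lambda> (\<lambda>_. 1)"
proof -
  have c: "continuous_on K (\<lambda>x. max 0 (f x - e))" by (intro continuous_intros belowD[OF f])
  show "below U (\<lambda>x. max 0 (f x - e))"
    using f e c by (auto simp: below_def)
  have "\<Lambda> f \<le> \<Lambda> (\<lambda>x. max 0 (f x - e) + e)"
    by (intro mono c belowD[OF f] continuous_intros) auto
  also have "\<dots> = \<Lambda> (\<lambda>x. max 0 (f x - e)) + \<Lambda> (\<lambda>_. e)" by (intro add c continuous_intros)
  finally show "\<Lambda> f \<le> \<Lambda> (\<lambda>x. max 0 (f x - e)) + e * \<Lambda> (\<lambda>_. 1)" using const[of e] by simp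
qed

lemma le_by_truncation:
  assumes f: "below U f" and le: "\<And>e. 0 < e \<Longrightarrow> ennreal (\<Lambda> (\<lambda>x. max 0 (f x - e))) + a \<le> c"
  shows "ennreal (\<Lambda> f) + a \<le> c"
proof (rule ennreal_le_epsilon)
  fix e :: real assume e: "0 < e"
  \<comment> \<open>the summand \<open>1\<close> admits the case \<open>\<Lambda> = 0\<close>\<close>
  define d where "d = e / (\<Lambda> (\<lambda>_. 1) + 1)"
  have d: "0 < d" "d * \<Lambda> (\<lambda>_. 1) \<le> e"
    using one_nonneg e by (auto simp: d_def field_simps)
  have "0 \<le> \<Lambda> (\<lambda>x. max 0 (f x - d))"
    using below_truncate[OF f d(1)] by (intro pos) (auto dest: belowD)
  moreover have "\<Lambda> f \<le> \<Lambda> (\<lambda>x. max 0 (f x - d)) + e"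
    using below_truncate(2)[OF f d(1)] d(2) by linarith
  ultimately have "ennreal (\<Lambda> f) + a \<le> (ennreal (\<Lambda> (\<lambda>x. max 0 (f x - d))) + ennreal e) + a"
    using e by (intro add_right_mono) (simp flip: ennreal_plus add: ennreal_leI)
  also have "\<dots> = (ennreal (\<Lambda> (\<lambda>x. max 0 (f x - d))) + a) + ennreal e" by (simp add: ac_simps)
  also have "\<dots> \<le> c + ennreal e" by (intro add_right_mono le d)
  finally show "ennreal (\<Lambda> f) + a \<le> c + ennreal e" .
qed

lemma Urysohn_K:
  assumes "closedin X C" "closedin X D" "C \<inter> D = {}"
  obtains h where "continuous_on K h" "\<And>x. x \<in> K \<Longrightarrow> 0 \<le> h x \<and> h x \<le> (1::real)"
    "\<And>x. x \<in> C \<Longrightarrow> h x = 1" "\<And>x. x \<in> D \<Longrightarrow> h x = 0"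
proof -
  have "Hausdorff_space (euclidean :: 'a topology)"
    unfolding Hausdorff_space_def disjnt_def open_openin[symmetric] by (meson hausdorff)
  then have "normal_space X"
    using compact_K by (intro compact_Hausdorff_or_regular_imp_normal_space disjI1 Hausdorff_space_subtopology)
      (auto simp: compact_space_subtopology)
  moreover have "disjnt D C" using assms(3) by (auto simp: disjnt_def)
  ultimately obtain h where h: "continuous_map X (top_of_set {0..1::real}) h" "h ` D \<subseteq> {0}" "h ` C \<subseteq> {1}"
    by (rule Urysohn_lemma[OF _ assms(2,1), of 0 1]) auto
  show ?thesis
  proof (rule that[of h])
    show "continuous_on K h" using h(1) by (simp add: continuous_map_in_subtopology)
    show "0 \<le> h x \<and> h x \<le> 1" if "x \<in> K" for x
      using h(1) that by (auto simp: continuous_map_in_subtopology)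
  qed (use h in auto)
qed

lemma closedin_level:
  assumes "continuous_on K f" shows "closedin X {x\<in>K. e \<le> (f x :: real)}"
  using continuous_closedin_preimage[OF assms, of "{e..}"] by (simp add: vimage_def Int_def conj_commute)

text \<open>Where \<open>e \<le> f\<close>, the truncation of \<open>f\<close> is divided between \<open>U\<close> and \<open>V\<close> by a Urysohn function that
  is \<open>1\<close> on the part outside \<open>V\<close> and \<open>0\<close> outside \<open>U\<close>; elsewhere the truncation is \<open>0\<close>.\<close>
lemma weight_Un:
  assumes U: "openin X U" and V: "openin X V"
  shows "weight (U \<union> V) \<le> weight U + weight V"
proof (rule weight_least)
  fix f assume f: "below (U \<union> V) f"
  have "ennreal (\<Lambda> f) + 0 \<le> weight U + weight V"
  proof (rule le_by_truncation[OF f])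
    fix e :: real assume e: "0 < e"
    let ?g = "\<lambda>x. max 0 (f x - e)"
    note g = below_truncate(1)[OF f e]
    have "closedin X ({x\<in>K. e \<le> f x} - V)"
      using closedin_level[OF belowD(1)[OF f]] V by (rule closedin_diff)
    moreover have "closedin X (K - U)" using closedin_diff[OF closedin_topspace U] by simp
    moreover have "({x\<in>K. e \<le> f x} - V) \<inter> (K - U) = {}"
      using belowD(4)[OF f] e by force
    ultimately obtain h where h: "continuous_on K h" "\<And>x. x \<in> K \<Longrightarrow> 0 \<le> h x \<and> h x \<le> (1::real)"
      "\<And>x. x \<in> {x\<in>K. e \<le> f x} - V \<Longrightarrow> h x = 1" "\<And>x. x \<in> K - U \<Longrightarrow> h x = 0"
      by (rule Urysohn_K) (rule that)
    have c: "continuous_on K (\<lambda>x. ?g x * h x)" "continuous_on K (\<lambda>x. ?g x * (1 - h x))"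
      by (intro continuous_intros h belowD[OF f])+
    have "below U (\<lambda>x. ?g x * h x)"
      unfolding below_def using c h(2,4) g by (auto simp: below_def intro!: mult_nonneg_nonneg mult_le_one)
    moreover have "below V (\<lambda>x. ?g x * (1 - h x))"
      unfolding below_def
    proof (intro conjI ballI c)
      fix x assume x: "x \<in> K - V"
      show "?g x * (1 - h x) = 0" using h(3)[of x] x by (cases "e \<le> f x") auto
    qed (use h(2) g in \<open>auto simp: below_def intro!: mult_nonneg_nonneg mult_le_one\<close>)
    moreover have "\<Lambda> ?g = \<Lambda> (\<lambda>x. ?g x * h x) + \<Lambda> (\<lambda>x. ?g x * (1 - h x))"
      using add[OF c] by (simp add: algebra_simps)
    moreover have "0 \<le> \<Lambda> (\<lambda>x. ?g x * h x)" "0 \<le> \<Lambda> (\<lambda>x. ?g x * (1 - h x))"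
      using calculation(1,2) by (intro pos; auto dest: belowD)+
    ultimately show "ennreal (\<Lambda> ?g) + 0 \<le> weight U + weight V"
      by (simp add: add_mono weight_upper)
  qed
  then show "ennreal (\<Lambda> f) \<le> weight U + weight V" by simp
qed

lemma weight_finite_UN:
  assumes "\<And>i. openin X (U i)"
  shows "weight (\<Union>i<n. U i) \<le> (\<Sum>i<(n::nat). weight (U i))"
proof (induction n)
  case 0 then show ?case by (simp add: weight_empty)
next
  case (Suc n)
  have "weight (\<Union>i<Suc n. U i) = weight ((\<Union>i<n. U i) \<union> U n)" by (simp add: lessThan_Suc Un_commute)
  also have "\<dots> \<le> weight (\<Union>i<n. U i) + weight (U n)" by (intro weight_Un openin_Union assms) (auto intro: assms)
  also have "\<dots> \<le> (\<Sum>i<Suc n. weight (U i))" using Suc by (simp add: add_right_mono)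
  finally show ?case .
qed

text \<open>The truncation of \<open>f\<close> lives on the compact set \<open>e \<le> f\<close>, which finitely many of the open sets
  cover.\<close>
lemma weight_UN:
  fixes U :: "nat \<Rightarrow> 'a set"
  assumes U: "\<And>i. openin X (U i)"
  shows "weight (\<Union>i. U i) \<le> (\<Sum>i. weight (U i))"
proof (rule weight_least)
  fix f assume f: "below (\<Union>i. U i) f"
  have "ennreal (\<Lambda> f) + 0 \<le> (\<Sum>i. weight (U i))"
  proof (rule le_by_truncation[OF f])
    fix e :: real assume e: "0 < e"
    let ?C = "{x\<in>K. e \<le> f x}"
    have C: "compact ?C" by (rule closedin_compact[OF compact_K closedin_level[OF belowD(1)[OF f]]])
    obtain T where T: "\<And>i. open (T i)" "\<And>i. U i = K \<inter> T i" using U unfolding openin_open by metis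
    have "?C \<subseteq> (\<Union>i. T i)"
    proof
      fix x assume x: "x \<in> ?C"
      then have "x \<in> K" "f x \<noteq> 0" using e by auto
      then have "x \<in> (\<Union>i. U i)" using belowD(4)[OF f] by blast
      then show "x \<in> (\<Union>i. T i)" using T(2) by blast
    qed
    then obtain I where I: "finite I" "?C \<subseteq> (\<Union>i\<in>I. T i)"
      by (rule compactE_image[OF C T(1)])
    obtain n where n: "I \<subseteq> {..<n}" using I(1) by (meson finite_nat_bounded)
    have "below (\<Union>i<n. U i) (\<lambda>x. max 0 (f x - e))"
      unfolding below_def
    proof (intro conjI ballI)
      fix x assume x: "x \<in> K - (\<Union>i<n. U i)"
      have "x \<notin> ?C"
      proof
        assume "x \<in> ?C"
        then obtain i where i: "i \<in> I" "x \<in> T i" using I(2) by blast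
        then have "i < n" "x \<in> U i" using n T(2)[of i] x by auto
        with x show False by blast
      qed
      then show "max 0 (f x - e) = 0" using x by auto
    qed (use below_truncate(1)[OF f e] in \<open>auto simp: below_def\<close>)
    then have "ennreal (\<Lambda> (\<lambda>x. max 0 (f x - e))) \<le> weight (\<Union>i<n. U i)" by (rule weight_upper)
    also have "\<dots> \<le> (\<Sum>i<n. weight (U i))" by (rule weight_finite_UN[OF U])
    also have "\<dots> \<le> (\<Sum>i. weight (U i))" by (intro sum_le_suminf) auto
    finally show "ennreal (\<Lambda> (\<lambda>x. max 0 (f x - e))) + 0 \<le> (\<Sum>i. weight (U i))" by simp
  qed
  then show "ennreal (\<Lambda> f) \<le> (\<Sum>i. weight (U i))" by simp
qed

definition outer :: "'a set \<Rightarrow> ennreal" where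
  "outer A = (INF U\<in>{U. openin X U \<and> A \<subseteq> U}. weight U)"

lemma outer_lower: "openin X U \<Longrightarrow> A \<subseteq> U \<Longrightarrow> outer A \<le> weight U"
  unfolding outer_def by (rule INF_lower) simp

lemma outer_mono: "A \<subseteq> B \<Longrightarrow> outer A \<le> outer B"
  unfolding outer_def by (rule INF_superset_mono) auto

lemma outer_open: "openin X U \<Longrightarrow> outer U = weight U"
  by (intro order_antisym outer_lower order_refl) 
     (auto simp: outer_def intro!: INF_greatest weight_mono)

lemma outer_approx:
  assumes "A \<subseteq> K" "0 < (e::real)"
  obtains U where "openin X U" "A \<subseteq> U" "weight U \<le> outer A + ennreal e"
proof -
  have "outer A \<le> weight K" using assms by (intro outer_lower) auto
  then have "outer A < top" using weight_finite[of K] by (rule le_less_trans)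
  then obtain r where r: "0 \<le> r" "outer A = ennreal r" unfolding less_top_ennreal by blast
  then have "outer A < outer A + ennreal e" using assms by (simp add: ennreal_less_iff flip: ennreal_plus)
  then obtain U where "openin X U" "A \<subseteq> U" "weight U < outer A + ennreal e"
    unfolding outer_def INF_less_iff by auto
  then show ?thesis by (intro that) auto
qed

lemma outer_measure_space_outer: "outer_measure_space (Pow K) outer"
  unfolding outer_measure_space_def
proof (intro conjI)
  show "positive (Pow K) outer"
    using outer_open[of "{}"] by (simp add: positive_def weight_empty)
  show "increasing (Pow K) outer" by (auto simp: increasing_def intro: outer_mono)
  show "countably_subadditive (Pow K) outer"
    unfolding countably_subadditive_def
  proof (intro allI impI)
    fix A :: "nat \<Rightarrow> 'a set" assume "range A \<subseteq> Pow K"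
    then have A: "A i \<subseteq> K" for i by auto
    show "outer (\<Union>i. A i) \<le> (\<Sum>i. outer (A i))"
    proof (rule ennreal_le_epsilon)
      fix e :: real assume e: "0 < e"
      have "\<exists>U. openin X U \<and> A i \<subseteq> U \<and> weight U \<le> outer (A i) + ennreal (e * (1/2) ^ Suc i)" for i
      proof -
        have "0 < e * (1/2) ^ Suc i" using e by simp
        from outer_approx[OF A[of i] this] show ?thesis by metis
      qed
      then obtain U where U: "\<And>i. openin X (U i)" "\<And>i. A i \<subseteq> U i"
        "\<And>i. weight (U i) \<le> outer (A i) + ennreal (e * (1/2) ^ Suc i)" by metis
      have "outer (\<Union>i. A i) \<le> weight (\<Union>i. U i)"
      proof (rule outer_lower)
        show "openin X (\<Union>i. U i)" using U(1) by blast
        show "(\<Union>i. A i) \<subseteq> (\<Union>i. U i)" using U(2) by blast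
      qed
      also have "\<dots> \<le> (\<Sum>i. weight (U i))" by (rule weight_UN[OF U(1)])
      also have "\<dots> \<le> (\<Sum>i. outer (A i) + ennreal (e * (1/2) ^ Suc i))" by (intro suminf_le U(3)) auto
      also have "\<dots> = (\<Sum>i. outer (A i)) + (\<Sum>i. ennreal (e * (1/2) ^ Suc i))" by (intro suminf_add[symmetric]) auto
      also have "(\<Sum>i. ennreal (e * (1/2) ^ Suc i)) = ennreal e"
        using sums_mult[OF power_half_series, of e] e
        by (subst suminf_ennreal2) (auto simp: sums_iff)
      finally show "outer (\<Union>i. A i) \<le> (\<Sum>i. outer (A i)) + ennreal e" .
    qed
  qed
qed

lemma outer_subadditive: "A \<subseteq> K \<Longrightarrow> B \<subseteq> K \<Longrightarrow> A \<inter> B = {} \<Longrightarrow> outer (A \<union> B) \<le> outer A + outer B"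
  using outer_measure_space_outer ring_of_sets.countably_subadditive_subadditive[OF ring_of_sets_Pow, of K outer]
  by (auto simp: outer_measure_space_def subadditive_def)

text \<open>A function below \<open>V \<inter> U\<close>, truncated at \<open>e\<close>, can be added to any function below the open set of
  points of \<open>V\<close> where it is less than \<open>e\<close>: the sum stays bounded by \<open>1\<close>. That open set contains
  \<open>V - U\<close>. This is the Caratheodory criterion for \<open>U\<close>, tested on open sets.\<close>
lemma weight_split:
  assumes U: "openin X U" and V: "openin X V"
  shows "weight (V \<inter> U) + outer (V - U) \<le> weight V"
proof -
  have "ennreal (\<Lambda> f) + outer (V - U) \<le> weight V" if f: "below (V \<inter> U) f" for f
  proof (rule le_by_truncation[OF f])
    fix e :: real assume e: "0 < e"
    let ?f = "\<lambda>x. max 0 (f x - e)"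
    note f' = below_truncate(1)[OF f e]
    define W where "W = V - {x\<in>K. e \<le> f x}"
    have W: "openin X W" unfolding W_def by (intro openin_diff V closedin_level belowD[OF f])
    have "V - U \<subseteq> W" using f e openin_imp_subset[OF V] by (auto simp: W_def below_def)
    with W have "outer (V - U) \<le> weight W" by (intro outer_lower)
    then have "ennreal (\<Lambda> ?f) + outer (V - U) \<le> ennreal (\<Lambda> ?f) + weight W" by (intro add_left_mono)
    also have "\<dots> = (SUP g\<in>{g. below W g}. ennreal (\<Lambda> ?f) + ennreal (\<Lambda> g))"
      unfolding weight_def using below_zero by (intro ennreal_SUP_add_right) auto
    also have "\<dots> \<le> weight V"
    proof (rule SUP_least, clarify)
      fix g assume g: "below W g"
      have "0 \<le> \<Lambda> ?f" "0 \<le> \<Lambda> g" using f' g by (intro pos; auto dest: belowD)+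
      then have "ennreal (\<Lambda> ?f) + ennreal (\<Lambda> g) = ennreal (\<Lambda> (\<lambda>x. ?f x + g x))"
        using add[OF belowD(1)[OF f'] belowD(1)[OF g]] by simp
      also have "\<dots> \<le> weight V"
      proof (rule weight_upper)
        show "below V (\<lambda>x. ?f x + g x)"
          unfolding below_def
        proof (intro conjI ballI)
          show "continuous_on K (\<lambda>x. ?f x + g x)" by (intro continuous_intros belowD[OF f] belowD[OF g])
          fix x assume x: "x \<in> K"
          show "0 \<le> ?f x + g x" using belowD(2)[OF g x] by simp
          show "?f x + g x \<le> 1"
          proof (cases "e \<le> f x")
            case True
            then have "g x = 0" using g x by (auto simp: below_def W_def)
            then show ?thesis using belowD(3)[OF f' x] by simp
          next
            case False
            then show ?thesis using belowD(3)[OF g x] by simp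
          qed
        next
          fix x assume "x \<in> K - V"
          then show "?f x + g x = 0" using f' g by (auto simp: below_def W_def)
        qed
      qed
      finally show "ennreal (\<Lambda> ?f) + ennreal (\<Lambda> g) \<le> weight V" .
    qed
    finally show "ennreal (\<Lambda> ?f) + outer (V - U) \<le> weight V" .
  qed
  then have "(SUP f\<in>{f. below (V \<inter> U) f}. ennreal (\<Lambda> f) + outer (V - U)) \<le> weight V"
    by (intro SUP_least) auto
  also have "(SUP f\<in>{f. below (V \<inter> U) f}. ennreal (\<Lambda> f) + outer (V - U)) = weight (V \<inter> U) + outer (V - U)"
    unfolding weight_def using below_zero by (intro ennreal_SUP_add_left) auto
  finally show ?thesis .
qed

lemma open_in_lambda_system:
  assumes U: "openin X U"
  shows "U \<in> lambda_system K (Pow K) outer"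
  unfolding lambda_system_def
proof (intro CollectI conjI ballI)
  show UK: "U \<in> Pow K" using openin_imp_subset[OF U] by auto
  fix A assume A: "A \<in> Pow K"
  show "outer (U \<inter> A) + outer ((K - U) \<inter> A) = outer A"
  proof (rule order_antisym)
    have "outer (U \<inter> A) + outer ((K - U) \<inter> A) \<le> weight V" if V: "openin X V" "A \<subseteq> V" for V
    proof -
      have "outer (U \<inter> A) \<le> weight (V \<inter> U)" using U V by (intro outer_lower) auto
      moreover have "outer ((K - U) \<inter> A) \<le> outer (V - U)" using V by (intro outer_mono) auto
      ultimately show ?thesis using weight_split[OF U V(1)] by (meson add_mono order_trans)
    qed
    then show "outer (U \<inter> A) + outer ((K - U) \<inter> A) \<le> outer A"
      unfolding outer_def[of A] by (intro INF_greatest) auto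
    have "(U \<inter> A) \<union> ((K - U) \<inter> A) = A" using A by auto
    moreover have "outer ((U \<inter> A) \<union> ((K - U) \<inter> A)) \<le> outer (U \<inter> A) + outer ((K - U) \<inter> A)"
      using A by (intro outer_subadditive) auto
    ultimately show "outer A \<le> outer (U \<inter> A) + outer ((K - U) \<inter> A)" by (simp only:)
  qed
qed

abbreviation "borel_K \<equiv> restrict_space borel K"

lemma measure_space_lambda: "measure_space K (lambda_system K (Pow K) outer) outer"
  by (rule sigma_algebra.caratheodory_lemma[OF sigma_algebra_Pow outer_measure_space_outer])

lemma borel_in_lambda_system: "sets borel_K \<subseteq> lambda_system K (Pow K) outer"
proof
  let ?L = "lambda_system K (Pow K) outer"
  interpret L: sigma_algebra K ?L using measure_space_lambda by (simp add: measure_space_def)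
  fix A assume "A \<in> sets borel_K"
  then obtain B where A: "A = K \<inter> B" and B: "B \<in> sigma_sets UNIV {S. open S}"
    by (auto simp: sets_restrict_space borel_def)
  from B have "K \<inter> B \<in> ?L"
  proof induction
    case (Basic S)
    then show ?case by (intro open_in_lambda_system) (auto simp: openin_open)
  next
    case Empty
    show ?case using L.empty_sets by simp
  next
    case (Compl S)
    have "K \<inter> (UNIV - S) = K - K \<inter> S" by auto
    then show ?case using L.compl_sets[OF Compl.IH] by simp
  next
    case (Union S)
    have "K \<inter> (\<Union>i. S i) = (\<Union>i. K \<inter> S i)" by auto
    moreover have "(\<Union>i. K \<inter> S i) \<in> ?L" using Union.IH by (intro L.countable_UN) auto
    ultimately show ?case by simp
  qed
  then show "A \<in> ?L" by (simp add: A)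
qed

definition rep :: "'a measure" where
  "rep = measure_of K (sets borel_K) outer"

lemma sets_rep: "sets rep = sets borel_K"
  using sets.sets_measure_of_eq[of borel_K outer] by (simp add: rep_def space_restrict_space)

lemma space_rep: "space rep = K"
  using sets_eq_imp_space_eq[OF sets_rep] by (simp add: space_restrict_space)

lemma emeasure_rep: "A \<in> sets borel_K \<Longrightarrow> emeasure rep A = outer A"
  unfolding rep_def
proof (rule emeasure_measure_of_sigma)
  show "sigma_algebra K (sets borel_K)"
    using sets.sigma_algebra_axioms[of borel_K] by (simp add: space_restrict_space)
  show "positive (sets borel_K) outer" using outer_measure_space_outer by (simp add: outer_measure_space_def positive_def)
  show "countably_additive (sets borel_K) outer"
    unfolding countably_additive_def
  proof (intro allI impI)
    fix A :: "nat \<Rightarrow> 'a set"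
    assume A: "range A \<subseteq> sets borel_K" "disjoint_family A"
    from A(1) borel_in_lambda_system have "range A \<subseteq> lambda_system K (Pow K) outer" by (rule order_trans)
    moreover have ca: "countably_additive (lambda_system K (Pow K) outer) outer"
      and sa: "sigma_algebra K (lambda_system K (Pow K) outer)"
      using measure_space_lambda by (simp_all add: measure_space_def)
    moreover have "(\<Union>i. A i) \<in> lambda_system K (Pow K) outer"
      using sigma_algebra.countable_nat_UN[OF sa] calculation(1) by blast
    ultimately show "(\<Sum>i. outer (A i)) = outer (\<Union>i. A i)"
      using A(2) unfolding countably_additive_def by blast
  qed
qed

lemma openin_sets: "openin X U \<Longrightarrow> U \<in> sets borel_K"
  unfolding openin_open sets_restrict_space by (auto intro: imageI)

lemma emeasure_rep_open: "openin X U \<Longrightarrow> emeasure rep U = weight U"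
  by (simp add: emeasure_rep openin_sets outer_open)

lemma emeasure_rep_K: "emeasure rep K = ennreal (\<Lambda> (\<lambda>_. 1))"
  by (simp add: emeasure_rep_open weight_K)

lemma finite_measure_rep: "finite_measure rep"
  by (rule finite_measureI) (simp add: space_rep emeasure_rep_K)

text \<open>Outer regularity is the definition of \<open>outer\<close>. Inner regularity follows by taking complements,
  because complements of open sets in \<open>K\<close> are compact.\<close>
lemma rep_regular: "rep \<in> regular_borel_measures K"
  unfolding regular_borel_measures_def mem_Collect_eq
proof (intro conjI ballI)
  interpret finite_measure rep by (rule finite_measure_rep)
  show "sets rep = sets borel_K" by (rule sets_rep)
  show "finite_measure rep" by (rule finite_measure_rep)
  fix A assume A: "A \<in> sets rep"
  then have AK: "A \<subseteq> K" using sets.sets_into_space space_rep by blast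
  have "emeasure rep A = outer A" using A by (simp add: emeasure_rep sets_rep)
  also have "\<dots> = (INF U\<in>{U. openin X U \<and> A \<subseteq> U}. emeasure rep U)"
    unfolding outer_def by (intro INF_cong) (simp_all add: emeasure_rep_open)
  finally show "emeasure rep A = (INF U\<in>{U. openin X U \<and> A \<subseteq> U}. emeasure rep U)" .
  have compact_sets: "C \<in> sets rep" if "compact C" "C \<subseteq> K" for C
    using that compact_imp_closed[OF that(1)] by (auto simp: sets_rep sets_restrict_space Int_absorb1 intro!: image_eqI[of _ _ C])
  show "emeasure rep A = (SUP C\<in>{C. compact C \<and> C \<subseteq> A}. emeasure rep C)"
  proof (rule order_antisym)
    show "(SUP C\<in>{C. compact C \<and> C \<subseteq> A}. emeasure rep C) \<le> emeasure rep A"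
      using A by (intro SUP_least emeasure_mono) auto
    show "emeasure rep A \<le> (SUP C\<in>{C. compact C \<and> C \<subseteq> A}. emeasure rep C)"
    proof (rule ennreal_le_epsilon)
      fix e :: real assume e: "0 < e"
      have KA: "K - A \<in> sets rep" using A space_rep by (metis sets.compl_sets)
      obtain U where U: "openin X U" "K - A \<subseteq> U" "weight U \<le> outer (K - A) + ennreal e"
        by (rule outer_approx[OF Diff_subset e])
      have UM: "U \<in> sets rep" using openin_sets[OF U(1)] by (simp add: sets_rep)
      have "closedin X (K - U)" using closedin_diff[OF closedin_topspace U(1)] by simp
      then have C: "compact (K - U)" using closedin_compact[OF compact_K] by blast
      have CM: "K - U \<in> sets rep" by (intro compact_sets C) auto
      have "emeasure rep U \<le> emeasure rep (K - A) + ennreal e"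
        using U KA by (simp add: emeasure_rep_open emeasure_rep sets_rep)
      then have le: "measure rep U \<le> measure rep (K - A) + e"
        using e by (simp add: emeasure_eq_measure flip: ennreal_plus)
      have "measure rep (K - A) = measure rep K - measure rep A" "measure rep (K - U) = measure rep K - measure rep U"
        using finite_measure_compl[OF A] finite_measure_compl[OF UM] by (simp_all add: space_rep)
      with le have "measure rep A \<le> measure rep (K - U) + e" by linarith
      then have "emeasure rep A \<le> emeasure rep (K - U) + ennreal e"
        using e by (simp add: emeasure_eq_measure flip: ennreal_plus)
      also have "\<dots> \<le> (SUP C\<in>{C. compact C \<and> C \<subseteq> A}. emeasure rep C) + ennreal e"
        using C U(2) by (intro add_right_mono SUP_upper) auto
      finally show "emeasure rep A \<le> (SUP C\<in>{C. compact C \<and> C \<subseteq> A}. emeasure rep C) + ennreal e" .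
    qed
  qed
qed

lemma integrable_rep: "continuous_on K f \<Longrightarrow> integrable rep (f :: 'a \<Rightarrow> real)"
  by (rule integrable_continuous_on[OF compact_K finite_measure_rep sets_rep])

lemma measure_rep_K: "measure rep K = \<Lambda> (\<lambda>_. 1)"
  by (simp add: measure_def emeasure_rep_K one_nonneg)

lemma layer_sum:
  fixes t d :: real
  assumes "0 \<le> t" "0 \<le> d"
  shows "(\<Sum>i<n. max 0 (min d (t - real i * d))) = min t (real n * d)"
  by (induction n) (use assms in \<open>auto simp: algebra_simps max_def min_def\<close>)

lemma linear_sum:
  assumes "\<And>i. i < n \<Longrightarrow> continuous_on K (f i)"
  shows "\<Lambda> (\<lambda>x. \<Sum>i<n. f i x) = (\<Sum>i<(n::nat). \<Lambda> (f i))"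
  using assms
proof (induction n)
  case 0 then show ?case using const[of 0] by simp
next
  case (Suc n)
  have "continuous_on K (\<lambda>x. \<Sum>i<n. f i x)" "continuous_on K (f n)"
    using Suc.prems by (auto intro!: continuous_on_sum)
  from add[OF this] Suc show ?case by simp
qed

text \<open>Cut \<open>f\<close> into \<open>N\<close> horizontal layers of height \<open>d = 1 / N\<close>. The layer above height \<open>i * d\<close>, rescaled
  by \<open>N\<close>, is a function below \<open>U i = {i * d < f}\<close>, so that the functional is at most
  \<open>d * (\<Sum>i<N. rep (U i))\<close>; this sum exceeds the integral of \<open>f\<close> by at most \<open>d * rep K\<close>.\<close>
lemma functional_le_integral_unit:
  assumes f: "continuous_on K f" and bounds: "\<And>x. x \<in> K \<Longrightarrow> 0 \<le> f x \<and> f x \<le> 1"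
  shows "\<Lambda> f \<le> (\<integral>x. f x \<partial>rep)"
proof -
  interpret finite_measure rep by (rule finite_measure_rep)
  have "\<Lambda> f \<le> (\<integral>x. f x \<partial>rep) + measure rep K / real N" if N: "0 < N" for N :: nat
  proof -
    define d where "d = 1 / real N"
    have d: "0 < d" "real N * d = 1" using N by (auto simp: d_def)
    define layer where "layer i x = max 0 (min d (f x - real i * d))" for i :: nat and x
    define U where "U i = {x\<in>K. real i * d < f x}" for i :: nat
    have cl: "continuous_on K (layer i)" for i unfolding layer_def by (intro continuous_intros f)
    have U: "openin X (U i)" for i
      using continuous_openin_preimage_gen[OF f, of "{real i * d<..}"] 
      by (simp add: U_def vimage_def Int_def)
    have UM: "U i \<in> sets rep" for i using openin_sets[OF U] by (simp add: sets_rep)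
    have sum_layer: "(\<Sum>i<N. layer i x) = f x" if "x \<in> K" for x
      unfolding layer_def using layer_sum[of "f x" d N] bounds[OF that] d by simp
    have layer_le: "\<Lambda> (layer i) \<le> d * measure rep (U i)" for i
    proof -
      have b: "below (U i) (\<lambda>x. real N * layer i x)"
        unfolding below_def
      proof (intro conjI ballI)
        show "continuous_on K (\<lambda>x. real N * layer i x)" by (intro continuous_intros cl)
        show "0 \<le> real N * layer i x" for x by (simp add: layer_def)
        have "real N * layer i x \<le> real N * d" for x using d by (intro mult_left_mono) (auto simp: layer_def)
        then show "real N * layer i x \<le> 1" for x by (simp add: d)
        show "real N * layer i x = 0" if "x \<in> K - U i" for x
          using that d by (auto simp: layer_def U_def not_less max_def min_def)
      qed
      have "ennreal (real N * \<Lambda> (layer i)) \<le> ennreal (measure rep (U i))"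
        using weight_upper[OF b] emeasure_rep_open[OF U] scale[OF cl] by (simp add: emeasure_eq_measure)
      then have "real N * \<Lambda> (layer i) \<le> measure rep (U i)"
        by (simp add: ennreal_le_iff)
      then show ?thesis using N by (simp add: d_def field_simps)
    qed
    have "\<Lambda> f = \<Lambda> (\<lambda>x. \<Sum>i<N. layer i x)"
      using sum_layer by (intro order_antisym mono f continuous_on_sum cl) simp_all
    also have "\<dots> = (\<Sum>i<N. \<Lambda> (layer i))" by (rule linear_sum[OF cl])
    also have "\<dots> \<le> (\<Sum>i<N. d * measure rep (U i))" by (intro sum_mono layer_le)
    also have "\<dots> = (\<integral>x. (\<Sum>i<N. d * indicator (U i) x) \<partial>rep)"
      using UM by (subst Bochner_Integration.integral_sum) (auto intro!: integrable_real_indicator simp: less_top[symmetric])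
    also have "\<dots> \<le> (\<integral>x. f x + d \<partial>rep)"
    proof (rule integral_mono)
      show "integrable rep (\<lambda>x. \<Sum>i<N. d * indicator (U i) x)"
        using UM by (intro Bochner_Integration.integrable_sum integrable_mult_right integrable_real_indicator) (auto simp: less_top[symmetric])
      show "integrable rep (\<lambda>x. f x + d)" using integrable_rep[OF f] by simp
      fix x assume "x \<in> space rep"
      then have x: "x \<in> K" by (simp add: space_rep)
      \<comment> \<open>where \<open>f\<close> exceeds \<open>(i + 1) * d\<close>, layer \<open>i\<close> has its full height \<open>d\<close>\<close>
      have "(\<Sum>i<N. d * indicator (U i) x) \<le> (\<Sum>i<Suc N. d * indicator (U i) x)" using d by simp
      also have "\<dots> = d * indicator (U 0) x + (\<Sum>i<N. d * indicator (U (Suc i)) x)"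
        by (rule sum.lessThan_Suc_shift)
      also have "\<dots> \<le> d + (\<Sum>i<N. layer i x)"
      proof (intro add_mono sum_mono)
        show "d * indicator (U 0) x \<le> d" using d by (simp add: indicator_def)
        show "d * indicator (U (Suc i)) x \<le> layer i x" for i
          using d by (simp add: layer_def U_def indicator_def algebra_simps)
      qed
      finally show "(\<Sum>i<N. d * indicator (U i) x) \<le> f x + d" by (simp add: sum_layer[OF x])
    qed
    also have "\<dots> = (\<integral>x. f x \<partial>rep) + d * measure rep K"
      using integrable_rep[OF f] by (simp add: space_rep)
    finally show ?thesis by (simp add: d_def)
  qed
  moreover have "(\<lambda>N. (\<integral>x. f x \<partial>rep) + measure rep K / real N) \<longlonglongrightarrow> (\<integral>x. f x \<partial>rep) + 0"
    by (intro tendsto_intros lim_const_over_n)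
  ultimately show ?thesis
    by (intro LIMSEQ_le_const[where X="\<lambda>N. (\<integral>x. f x \<partial>rep) + measure rep K / real N"]) (auto intro!: exI[of _ 1])
qed

text \<open>An affine change of \<open>f\<close> reduces the bound to values in the unit interval; constants do no harm as
  \<open>rep K = \<Lambda> 1\<close>.\<close>
lemma functional_le_integral:
  assumes f: "continuous_on K f" shows "\<Lambda> f \<le> (\<integral>x. f x \<partial>rep)"
proof -
  interpret finite_measure rep by (rule finite_measure_rep)
  obtain B where B: "0 < B" "\<And>x. x \<in> K \<Longrightarrow> \<bar>f x\<bar> \<le> B"
    using compact_imp_bounded[OF compact_continuous_image[OF f compact_K]] by (auto simp: bounded_pos)
  let ?c = "1 / (2 * B)"
  have "\<Lambda> (\<lambda>x. ?c * (f x + B)) \<le> (\<integral>x. ?c * (f x + B) \<partial>rep)"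
  proof (rule functional_le_integral_unit)
    show "continuous_on K (\<lambda>x. ?c * (f x + B))" by (intro continuous_intros f)
    show "0 \<le> ?c * (f x + B) \<and> ?c * (f x + B) \<le> 1" if "x \<in> K" for x
      using B(1) B(2)[OF that] by (auto simp: field_simps abs_le_iff)
  qed
  moreover have "\<Lambda> (\<lambda>x. ?c * (f x + B)) = ?c * (\<Lambda> f + B * \<Lambda> (\<lambda>_. 1))"
    using scale[of "\<lambda>x. f x + B" ?c] add[OF f, of "\<lambda>_. B"] const[of B] f by (simp add: continuous_on_add)
  moreover have "(\<integral>x. ?c * (f x + B) \<partial>rep) = ?c * ((\<integral>x. f x \<partial>rep) + B * \<Lambda> (\<lambda>_. 1))"
    using integrable_rep[OF f] by (simp add: space_rep measure_rep_K)
  ultimately show ?thesis using B(1) by (simp add: divide_le_cancel)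
qed

lemma integral_rep:
  assumes f: "continuous_on K f" shows "(\<integral>x. f x \<partial>rep) = \<Lambda> f"
proof (rule order_antisym)
  show "\<Lambda> f \<le> (\<integral>x. f x \<partial>rep)" by (rule functional_le_integral[OF f])
  have "\<Lambda> (\<lambda>x. -1 * f x) \<le> (\<integral>x. -1 * f x \<partial>rep)"
    by (intro functional_le_integral continuous_intros f)
  then show "(\<integral>x. f x \<partial>rep) \<le> \<Lambda> f" using scale[OF f, of "-1"] by simp
qed

end

text \<open>Applying \<open>functional_le_integral\<close> to \<open>f\<close> and to \<open>- f\<close> gives equality.\<close>
theorem riesz_representation:
  fixes K :: "'a::t2_space set"
  assumes "compact K" "linear_functional_on {f. continuous_on K f} \<Lambda>"
    and "\<And>f. continuous_on K f \<Longrightarrow> (\<And>x. x \<in> K \<Longrightarrow> 0 \<le> f x) \<Longrightarrow> 0 \<le> \<Lambda> f"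
  obtains M where "M \<in> regular_borel_measures K" "\<And>f. continuous_on K f \<Longrightarrow> (\<integral>x. f x \<partial>M) = \<Lambda> f"
proof -
  interpret positive_functional K \<Lambda> by unfold_locales (use assms in auto)
  show ?thesis by (rule that[OF rep_regular integral_rep])
qed

section \<open>Conditional probabilities and martingale convergence for sets\<close>

text \<open>A sub-\<open>\<sigma>\<close>-algebra is represented by its collection of sets, so that inclusion can serve as the
  order of extension. For a finite measure that is not a probability, \<open>prob_given\<close> is still the
  conditional expectation of the indicator.\<close>
definition prob_given :: "'a measure \<Rightarrow> 'a set set \<Rightarrow> 'a set \<Rightarrow> 'a \<Rightarrow> real" where
  "prob_given M \<A> E = real_cond_exp M (sigma (space M) \<A>) (indicator E)"

definition sub_sigma :: "'a measure \<Rightarrow> 'a set set \<Rightarrow> bool" where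
  "sub_sigma M \<A> \<longleftrightarrow> sigma_algebra (space M) \<A> \<and> \<A> \<subseteq> sets M"

context finite_measure
begin

lemma integrable_ind [simp]: "E \<in> sets M \<Longrightarrow> integrable M (indicator E :: _ \<Rightarrow> real)"
  by (rule integrable_real_indicator) (auto simp: less_top[symmetric])

lemma sub_sigma_sets: "sub_sigma M \<A> \<Longrightarrow> sets (sigma (space M) \<A>) = \<A>"
  unfolding sub_sigma_def by (simp add: sigma_algebra.sets_measure_of_eq)

lemma sub_sigma_subalgebra:
  assumes "sub_sigma M \<A>" shows "finite_measure_subalgebra M (sigma (space M) \<A>)"
proof
  show "subalgebra M (sigma (space M) \<A>)"
    unfolding subalgebra_def sub_sigma_sets[OF assms] using assms by (simp add: space_measure_of_conv sub_sigma_def)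
qed

lemma prob_given_integrable:
  assumes "sub_sigma M \<A>" "E \<in> sets M" shows "integrable M (prob_given M \<A> E)"
proof -
  interpret finite_measure_subalgebra M "sigma (space M) \<A>" by (rule sub_sigma_subalgebra) fact
  show ?thesis unfolding prob_given_def using assms(2) by (intro real_cond_exp_int) simp
qed

lemma prob_given_measurable [measurable]: "prob_given M \<A> E \<in> borel_measurable M"
  unfolding prob_given_def by (rule borel_measurable_cond_exp2)

lemma prob_given_level:
  assumes "sub_sigma M \<A>" shows "{x\<in>space M. c < prob_given M \<A> E x} \<in> \<A>"
proof -
  have "prob_given M \<A> E \<in> borel_measurable (sigma (space M) \<A>)"
    unfolding prob_given_def by (rule borel_measurable_cond_exp)
  then have "{x\<in>space (sigma (space M) \<A>). c < prob_given M \<A> E x} \<in> sets (sigma (space M) \<A>)"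
    by measurable
  then show ?thesis by (simp only: sub_sigma_sets[OF assms] space_measure_of_conv)
qed

lemma prob_given_integral:
  assumes "sub_sigma M \<A>" "E \<in> sets M" "B \<in> \<A>"
  shows "(\<integral>x\<in>B. prob_given M \<A> E x \<partial>M) = measure M (B \<inter> E)"
proof -
  interpret finite_measure_subalgebra M "sigma (space M) \<A>" by (rule sub_sigma_subalgebra) fact
  have B: "B \<in> sets M" "B \<in> sets (sigma (space M) \<A>)"
    using assms by (auto simp: sub_sigma_sets sub_sigma_def)
  have "(\<integral>x\<in>B. prob_given M \<A> E x \<partial>M) = (\<integral>x\<in>B. indicator E x \<partial>M)"
    unfolding prob_given_def using assms(2) B
    by (intro real_cond_exp_intA[symmetric]) simp_all
  also have "\<dots> = (\<integral>x. indicator (B \<inter> E) x \<partial>M)"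
    unfolding set_lebesgue_integral_def by (intro Bochner_Integration.integral_cong) (auto simp: indicator_def)
  also have "\<dots> = measure M (B \<inter> E)"
    using sets.sets_into_space[OF B(1)] by (simp add: Int_absorb2 le_infI1)
  finally show ?thesis .
qed

lemma prob_given_of_mem:
  assumes "sub_sigma M \<A>" "E \<in> \<A>"
  shows "AE x in M. prob_given M \<A> E x = indicator E x"
proof -
  interpret finite_measure_subalgebra M "sigma (space M) \<A>" by (rule sub_sigma_subalgebra) fact
  have "E \<in> sets M" "E \<in> sets (sigma (space M) \<A>)"
    using assms by (auto simp: sub_sigma_sets sub_sigma_def)
  then show ?thesis unfolding prob_given_def
    by (intro real_cond_exp_F_meas) simp_all
qed

lemma prob_given_le:
  assumes "sub_sigma M \<A>" "E \<in> sets M" "E' \<in> sets M" "AE x in M. x \<in> E \<longrightarrow> x \<in> E'"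
  shows "AE x in M. prob_given M \<A> E x \<le> prob_given M \<A> E' x"
proof -
  interpret finite_measure_subalgebra M "sigma (space M) \<A>" by (rule sub_sigma_subalgebra) fact
  show ?thesis unfolding prob_given_def
    by (rule real_cond_exp_mono; (simp add: assms)?) (use assms(4) in eventually_elim, simp add: indicator_def)
qed

lemma prob_given_Un:
  assumes "sub_sigma M \<A>" "E \<in> sets M" "E' \<in> sets M" "E \<inter> E' = {}"
  shows "AE x in M. prob_given M \<A> (E \<union> E') x = prob_given M \<A> E x + prob_given M \<A> E' x"
proof -
  interpret finite_measure_subalgebra M "sigma (space M) \<A>" by (rule sub_sigma_subalgebra) fact
  have "indicator (E \<union> E') = (\<lambda>x. indicator E x + indicator E' x :: real)"
    using assms(4) by (auto simp: indicator_def fun_eq_iff)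
  then show ?thesis unfolding prob_given_def
    using assms(2-3) real_cond_exp_add[of "indicator E" "indicator E'"]
    by simp
qed

lemma prob_given_bounds:
  assumes "sub_sigma M \<A>" "E \<in> sets M"
  shows "AE x in M. 0 \<le> prob_given M \<A> E x \<and> prob_given M \<A> E x \<le> 1"
proof -
  have sA: "{} \<in> \<A>" "space M \<in> \<A>"
    using assms(1) by (auto simp: sub_sigma_def sigma_algebra_iff2)
  have "AE x in M. prob_given M \<A> {} x \<le> prob_given M \<A> E x" "AE x in M. prob_given M \<A> {} x = 0"
    "AE x in M. prob_given M \<A> E x \<le> prob_given M \<A> (space M) x" 
    "AE x in M. prob_given M \<A> (space M) x = indicator (space M) x"
    using prob_given_le[OF assms(1), of "{}" E] prob_given_le[OF assms(1), of E "space M"]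
      prob_given_of_mem[OF assms(1) sA(1)] prob_given_of_mem[OF assms(1) sA(2)] assms(2) by auto
  then show ?thesis using AE_space
    by eventually_elim (auto simp: indicator_def split: if_splits)
qed

lemma prob_given_Compl:
  assumes "sub_sigma M \<A>" "E \<in> sets M"
  shows "AE x in M. prob_given M \<A> (space M - E) x = 1 - prob_given M \<A> E x"
proof -
  have sA: "space M \<in> \<A>"
    using assms(1) by (auto simp: sub_sigma_def sigma_algebra_def algebra.top)
  have "E \<union> (space M - E) = space M" using assms(2) sets.sets_into_space by auto
  then have "AE x in M. prob_given M \<A> (space M) x = prob_given M \<A> E x + prob_given M \<A> (space M - E) x"
    using prob_given_Un[OF assms, of "space M - E"] assms(2) by auto
  with prob_given_of_mem[OF assms(1) sA] AE_space show ?thesis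
    by eventually_elim simp
qed

lemma prob_given_Int:
  assumes "sub_sigma M \<A>" "E \<in> sets M" "E' \<in> sets M"
  shows "AE x in M. prob_given M \<A> E x + prob_given M \<A> E' x - 1 \<le> prob_given M \<A> (E \<inter> E') x"
proof -
  have "E = (E \<inter> E') \<union> (E - E')" by auto
  then have "AE x in M. prob_given M \<A> E x = prob_given M \<A> (E \<inter> E') x + prob_given M \<A> (E - E') x"
    using prob_given_Un[OF assms(1), of "E \<inter> E'" "E - E'"] assms(2-) by auto
  moreover have "AE x in M. prob_given M \<A> (E - E') x \<le> prob_given M \<A> (space M - E') x"
    using assms sets.sets_into_space[OF assms(2)] by (intro prob_given_le) auto
  ultimately show ?thesis using prob_given_Compl[OF assms(1,3)]
    by eventually_elim auto
qed

text \<open>Doob's maximal inequality. Decompose the set according to the first \<open>n\<close> at which the level is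
  exceeded. The piece belonging to \<open>n\<close> is in \<open>\<A> n\<close>, so that the conditional probability may be
  replaced there by the indicator of \<open>D\<close>.\<close>
lemma prob_given_maximal:
  fixes \<A> :: "nat \<Rightarrow> 'a set set"
  assumes A: "\<And>n. sub_sigma M (\<A> n)" "mono \<A>" and D: "D \<in> sets M" and \<delta>: "0 < \<delta>"
  shows "measure M {x\<in>space M. \<exists>n. \<delta> < prob_given M (\<A> n) D x} \<le> measure M D / \<delta>"
proof -
  define S where "S n = {x\<in>space M. \<delta> < prob_given M (\<A> n) D x}" for n
  have SA: "S n \<in> \<A> n" for n unfolding S_def by (rule prob_given_level) fact
  have B: "disjointed S n \<in> \<A> n" for n
  proof -
    interpret sigma_algebra "space M" "\<A> n" using A(1) by (simp add: sub_sigma_def)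
    have "S i \<in> \<A> n" if "i \<le> n" for i using SA[of i] monoD[OF A(2) that] by auto
    then show ?thesis unfolding disjointed_def by (intro Diff finite_UN) auto
  qed
  have BM: "disjointed S n \<in> sets M" for n using B[of n] A(1)[of n] by (auto simp: sub_sigma_def)
  have le: "\<delta> * measure M (disjointed S n) \<le> measure M (disjointed S n \<inter> D)" for n
  proof -
    have "\<delta> * measure M (disjointed S n) = (\<integral>x\<in>disjointed S n. \<delta> \<partial>M)"
      using BM by (simp add: set_lebesgue_integral_def Int_absorb2 sets.sets_into_space)
    also have "\<dots> \<le> (\<integral>x\<in>disjointed S n. prob_given M (\<A> n) D x \<partial>M)"
      using BM disjointed_subset[of S n] integrable_mult_indicator[OF BM prob_given_integrable[OF A(1) D]]
      by (intro set_integral_mono) (auto simp: set_integrable_def S_def mult.commute)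
    also have "\<dots> = measure M (disjointed S n \<inter> D)" by (rule prob_given_integral) (use A D B in auto)
    finally show ?thesis .
  qed
  have s1: "(\<lambda>n. measure M (disjointed S n)) sums measure M (\<Union>n. disjointed S n)"
    using BM by (intro finite_measure_UNION) (auto simp: disjoint_family_disjointed)
  have s2: "(\<lambda>n. measure M (disjointed S n \<inter> D)) sums measure M (\<Union>n. disjointed S n \<inter> D)"
    using BM D disjoint_family_disjointed[of S]
    by (intro finite_measure_UNION) (auto simp: disjoint_family_on_def)
  have "\<delta> * measure M (\<Union>n. disjointed S n) \<le> measure M (\<Union>n. disjointed S n \<inter> D)"
    using le by (intro sums_le[OF _ sums_mult[OF s1] s2]) auto
  also have "\<dots> \<le> measure M D" using D by (intro finite_measure_mono) auto
  finally have "measure M (\<Union>n. disjointed S n) \<le> measure M D / \<delta>" using \<delta> by (simp add: field_simps)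
  moreover have "(\<Union>n. disjointed S n) = {x\<in>space M. \<exists>n. \<delta> < prob_given M (\<A> n) D x}"
    unfolding UN_disjointed_eq by (auto simp: S_def)
  ultimately show ?thesis by simp
qed

end

context finite_measure
begin

text \<open>These sets play the part of the \<open>\<sigma>\<close>-algebra generated by the \<open>\<A> n\<close>, which they contain. With
  convergence as their definition, the martingale theorem becomes the assertion that they are closed
  under the set operations.\<close>
definition martingale_sets :: "(nat \<Rightarrow> 'a set set) \<Rightarrow> 'a set set" where
  "martingale_sets \<A> = {E\<in>sets M. AE x in M. (\<lambda>n. prob_given M (\<A> n) E x) \<longlonglongrightarrow> indicator E x}"

lemma mem_martingale_sets:
  assumes A: "\<And>n. sub_sigma M (\<A> n)" "mono \<A>" and E: "E \<in> \<A> n"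
  shows "E \<in> martingale_sets \<A>"
proof -
  have "AE x in M. \<forall>m. n \<le> m \<longrightarrow> prob_given M (\<A> m) E x = indicator E x"
    unfolding AE_all_countable
  proof
    fix m show "AE x in M. n \<le> m \<longrightarrow> prob_given M (\<A> m) E x = indicator E x"
    proof (cases "n \<le> m")
      case True
      have "E \<in> \<A> m" using monoD[OF A(2) True] E by (rule subsetD)
      from prob_given_of_mem[OF A(1) this] show ?thesis by eventually_elim simp
    next
      case False
      then show ?thesis by (intro AE_I2) simp
    qed
  qed
  then have "AE x in M. (\<lambda>n. prob_given M (\<A> n) E x) \<longlonglongrightarrow> indicator E x"
  proof eventually_elim
    case (elim x)
    then have "\<forall>\<^sub>F m in sequentially. prob_given M (\<A> m) E x = indicator E x"
      by (auto simp: eventually_sequentially)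
    then show ?case by (rule tendsto_eventually)
  qed
  moreover have "E \<in> sets M" using A(1)[of n] E unfolding sub_sigma_def by blast
  ultimately show ?thesis by (simp add: martingale_sets_def)
qed

text \<open>Complements and finite intersections are elementary. For a countable union and a point inside
  it, monotonicity gives the convergence to \<open>1\<close>. At a point outside, the conditional probability of
  the union differs from that of a finite part by the conditional probability of the remainder
  \<open>D k\<close>, which the maximal inequality makes uniformly small in \<open>n\<close>, because \<open>D k\<close> decreases to the
  empty set.\<close>
lemma sub_sigma_martingale_sets:
  assumes A: "\<And>n. sub_sigma M (\<A> n)" "mono \<A>"
  shows "sub_sigma M (martingale_sets \<A>)"
proof -
  let ?P = "\<lambda>n. prob_given M (\<A> n)"
  let ?S = "martingale_sets \<A>"
  have S: "E \<in> sets M" "AE x in M. (\<lambda>n. ?P n E x) \<longlonglongrightarrow> indicator E x" if "E \<in> ?S" for E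
    using that by (auto simp: martingale_sets_def)
  have bounds: "AE x in M. \<forall>n. 0 \<le> ?P n E x \<and> ?P n E x \<le> 1" if "E \<in> sets M" for E
    unfolding AE_all_countable using prob_given_bounds[OF A(1) that] by blast
  have compl: "space M - E \<in> ?S" if "E \<in> ?S" for E
  proof -
    have "AE x in M. \<forall>n. ?P n (space M - E) x = 1 - ?P n E x"
      unfolding AE_all_countable using prob_given_Compl[OF A(1) S(1)[OF that]] by blast
    with S(2)[OF that] AE_space have "AE x in M. (\<lambda>n. ?P n (space M - E) x) \<longlonglongrightarrow> indicator (space M - E) x"
    proof eventually_elim
      case (elim x)
      then have "(\<lambda>n. 1 - ?P n E x) \<longlonglongrightarrow> 1 - indicator E x" by (intro tendsto_intros)
      with elim show ?case by (auto simp: indicator_def split: if_splits)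
    qed
    then show ?thesis using S(1)[OF that] by (auto simp: martingale_sets_def)
  qed
  have int: "E \<inter> E' \<in> ?S" if "E \<in> ?S" "E' \<in> ?S" for E E'
  proof -
    have "AE x in M. \<forall>n. ?P n E x + ?P n E' x - 1 \<le> ?P n (E \<inter> E') x"
      "AE x in M. \<forall>n. ?P n (E \<inter> E') x \<le> ?P n E x"
      "AE x in M. \<forall>n. ?P n (E \<inter> E') x \<le> ?P n E' x"
      unfolding AE_all_countable
      using prob_given_Int[OF A(1) S(1)[OF that(1)] S(1)[OF that(2)]] S(1)[OF that(1)] S(1)[OF that(2)]
      by (auto intro!: prob_given_le[OF A(1)])
    with S(2)[OF that(1)] S(2)[OF that(2)] bounds[OF sets.Int[OF S(1)[OF that(1)] S(1)[OF that(2)]]]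
    have "AE x in M. (\<lambda>n. ?P n (E \<inter> E') x) \<longlonglongrightarrow> indicator (E \<inter> E') x"
    proof eventually_elim
      case (elim x)
      show ?case
      proof (cases "x \<in> E \<and> x \<in> E'")
        case True
        then have "(\<lambda>n. ?P n E x + ?P n E' x - 1) \<longlonglongrightarrow> 1 + 1 - 1"
          using elim by (intro tendsto_intros) auto
        then have "(\<lambda>n. ?P n E x + ?P n E' x - 1) \<longlonglongrightarrow> 1" by simp
        then have "(\<lambda>n. ?P n (E \<inter> E') x) \<longlonglongrightarrow> 1"
          by (rule tendsto_sandwich[rotated 2, of _ _ _ "\<lambda>_. 1"]) (use elim in simp_all)
        then show ?thesis using True by simp
      next
        case False
        then obtain D where D: "x \<notin> D" "(\<lambda>n. ?P n D x) \<longlonglongrightarrow> indicator D x"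
            "\<forall>n. ?P n (E \<inter> E') x \<le> ?P n D x"
          using elim by blast
        then have "(\<lambda>n. ?P n D x) \<longlonglongrightarrow> 0" by simp
        then have "(\<lambda>n. ?P n (E \<inter> E') x) \<longlonglongrightarrow> 0"
          by (rule tendsto_sandwich[rotated 3, of _ _ _ "\<lambda>_. 0"]) (use elim D(3) in simp_all)
        moreover have "indicator (E \<inter> E') x = (0::real)" using False by simp
        ultimately show ?thesis by simp
      qed
    qed
    then show ?thesis using S(1)[OF that(1)] S(1)[OF that(2)] by (auto simp: martingale_sets_def)
  qed
  have "space M \<in> \<A> 0"
    using A(1)[of 0] by (simp add: sub_sigma_def sigma_algebra_def algebra.top)
  then have sp: "space M \<in> ?S" by (rule mem_martingale_sets[OF A])
  have "algebra (space M) ?S"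
    unfolding algebra_iff_Int
  proof (intro conjI ballI)
    show "?S \<subseteq> Pow (space M)" using S(1) sets.sets_into_space by blast
    show "{} \<in> ?S" using compl[OF sp] by simp
  qed (fact compl int)+
  then interpret S: algebra "space M" ?S .
  have UN: "(\<Union>i. E i) \<in> ?S" if E: "range E \<subseteq> ?S" for E :: "nat \<Rightarrow> 'a set"
  proof -
    define D where "D k = (\<Union>i. E i) - (\<Union>i<k. E i)" for k
    have EM: "E i \<in> sets M" for i using E S(1) by auto
    have part: "(\<Union>i<k. E i) \<in> ?S" for k using E by (intro S.finite_UN) auto
    have pM: "(\<Union>i<k. E i) \<in> sets M" for k using EM by auto
    have UM: "(\<Union>i. E i) \<in> sets M" using EM by auto
    have DM: "D k \<in> sets M" for k using EM by (auto simp: D_def)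
    have decomp: "AE x in M. \<forall>n k. ?P n (\<Union>i. E i) x = ?P n (\<Union>i<k. E i) x + ?P n (D k) x"
      unfolding AE_all_countable
    proof (intro allI)
      fix n k
      have *: "(\<Union>i<k. E i) \<union> D k = (\<Union>i. E i)" "(\<Union>i<k. E i) \<inter> D k = {}" by (auto simp: D_def)
      show "AE x in M. ?P n (\<Union>i. E i) x = ?P n (\<Union>i<k. E i) x + ?P n (D k) x"
        using prob_given_Un[OF A(1) pM DM *(2)] unfolding *(1) .
    qed
    have mono_part: "AE x in M. \<forall>n k. ?P n (\<Union>i<k. E i) x \<le> ?P n (\<Union>i. E i) x"
      unfolding AE_all_countable by (intro allI prob_given_le[OF A(1) pM UM] AE_I2) blast
    have part_lim: "AE x in M. \<forall>k. (\<lambda>n. ?P n (\<Union>i<k. E i) x) \<longlonglongrightarrow> indicator (\<Union>i<k. E i) x"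
      unfolding AE_all_countable using S(2)[OF part] by blast
    have measD: "(\<lambda>k. measure M (D k)) \<longlonglongrightarrow> 0"
    proof -
      have "(\<lambda>k. measure M (D k)) \<longlonglongrightarrow> measure M (\<Inter>k. D k)"
        using DM by (intro finite_Lim_measure_decseq) (auto simp: decseq_def D_def)
      also have "x \<notin> (\<Inter>k. D k)" for x
      proof
        assume x: "x \<in> (\<Inter>k. D k)"
        then have "x \<in> (\<Union>i. E i)" by (auto simp: D_def)
        then obtain i where "x \<in> E i" by blast
        moreover have "x \<in> D (Suc i)" using x by blast
        ultimately show False by (auto simp: D_def)
      qed
      then have "(\<Inter>k. D k) = {}" by blast
      finally show ?thesis by simp
    qed
    have "AE x in M. \<exists>k. \<forall>n. ?P n (D k) x \<le> \<delta>" if "0 < \<delta>" for \<delta>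
    proof -
      define Z where "Z = {x\<in>space M. \<forall>k. \<exists>n. \<delta> < ?P n (D k) x}"
      have ZM: "Z \<in> sets M" unfolding Z_def by (intro sets.sets_Collect borel_measurable_less prob_given_measurable borel_measurable_const)
      have "measure M Z \<le> measure M (D k) / \<delta>" for k
      proof -
        have "measure M Z \<le> measure M {x\<in>space M. \<exists>n. \<delta> < ?P n (D k) x}"
          by (intro finite_measure_mono) (auto simp: Z_def)
        also have "\<dots> \<le> measure M (D k) / \<delta>" by (rule prob_given_maximal[OF A DM that])
        finally show ?thesis .
      qed
      moreover have "(\<lambda>k. measure M (D k) / \<delta>) \<longlonglongrightarrow> 0" using tendsto_divide[OF measD tendsto_const, of \<delta>] that by simp
      ultimately have "measure M Z \<le> 0" by (intro LIMSEQ_le_const) auto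
      then have "Z \<in> null_sets M" using ZM by (auto simp: null_sets_def emeasure_eq_measure measure_le_0_iff)
      from AE_not_in[OF this] AE_space show ?thesis
        by eventually_elim (auto simp: Z_def not_less)
    qed
    then have small: "AE x in M. \<forall>j. \<exists>k. \<forall>n. ?P n (D k) x \<le> 1 / Suc j"
      unfolding AE_all_countable by simp
    have "AE x in M. (\<lambda>n. ?P n (\<Union>i. E i) x) \<longlonglongrightarrow> indicator (\<Union>i. E i) x"
      using decomp mono_part part_lim small bounds[OF UM]
    proof eventually_elim
      case (elim x)
      show ?case
      proof (cases "x \<in> (\<Union>i. E i)")
        case True
        then obtain i where "x \<in> E i" by auto
        then have "indicator (\<Union>i<Suc i. E i) x = (1::real)" by (intro indicator_simps(1)) blast
        then have "(\<lambda>n. ?P n (\<Union>i<Suc i. E i) x) \<longlonglongrightarrow> 1"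
          using elim(3)[rule_format, of "Suc i"] by (simp only:)
        then have "(\<lambda>n. ?P n (\<Union>i. E i) x) \<longlonglongrightarrow> 1"
          by (rule tendsto_sandwich[rotated 2, of _ _ _ "\<lambda>_. 1"]) (use elim in simp_all)
        with True show ?thesis by simp
      next
        case False
        have "(\<lambda>n. ?P n (\<Union>i. E i) x) \<longlonglongrightarrow> 0"
        proof (rule LIMSEQ_I)
          fix r :: real assume r: "0 < r"
          then obtain j where j: "1 / Suc j < r / 2" using nat_approx_posE[of "r/2"] by auto
          obtain k where k: "\<And>n. ?P n (D k) x \<le> 1 / Suc j" using elim(4) by blast
          have "(\<lambda>n. ?P n (\<Union>i<k. E i) x) \<longlonglongrightarrow> 0"
            using elim(3)[rule_format, of k] False by (auto simp: indicator_def split: if_splits)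
          from LIMSEQ_D[OF this, of "r/2"] r obtain N where N: "\<And>n. n \<ge> N \<Longrightarrow> \<bar>?P n (\<Union>i<k. E i) x\<bar> < r / 2"
            by auto
          show "\<exists>N. \<forall>n\<ge>N. norm (?P n (\<Union>i. E i) x - 0) < r"
          proof (intro exI[of _ N] allI impI)
            fix n assume "N \<le> n"
            have "?P n (\<Union>i. E i) x < r"
              using N[OF \<open>N \<le> n\<close>] k[of n] j elim(1)[rule_format, of n k] by linarith
            then show "norm (?P n (\<Union>i. E i) x - 0) < r"
              using elim(5)[rule_format, of n] by simp
          qed
        qed
        with False show ?thesis by simp
      qed
    qed
    then show ?thesis using UM by (simp add: martingale_sets_def)
  qed
  have "sigma_algebra (space M) ?S"
    by unfold_locales (rule UN)
  then show ?thesis using S(1) by (auto simp: sub_sigma_def)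
qed

end

section \<open>Liftings as families of filters\<close>

text \<open>A lower density on \<open>\<A>\<close>, written pointwise: \<open>F x\<close> collects the sets that are dense at \<open>x\<close>. The
  condition that \<open>F x\<close> is generated, modulo null sets, by members of \<open>\<A>\<close> keeps the filters from
  deciding about sets outside \<open>\<A>\<close> prematurely, and so makes extensions possible.\<close>
definition filter_lifting :: "'a measure \<Rightarrow> 'a set set \<Rightarrow> ('a \<Rightarrow> 'a filter) \<Rightarrow> bool" where
  "filter_lifting M \<A> F \<longleftrightarrow> sub_sigma M \<A> \<and>
     (\<forall>x. F x \<noteq> bot \<and> F x \<le> ae_filter M \<and>
       (\<forall>P. eventually P (F x) \<longrightarrow>
          (\<exists>B\<in>\<A>. (\<forall>\<^sub>F y in F x. y \<in> B) \<and> (AE y in M. y \<in> B \<longrightarrow> P y)))) \<and>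
     (\<forall>E\<in>\<A>. AE x in M. x \<in> E \<longrightarrow> (\<forall>\<^sub>F y in F x. y \<in> E))"

lemma filter_liftingD:
  assumes "filter_lifting M \<A> F"
  shows "sub_sigma M \<A>" "F x \<noteq> bot" "F x \<le> ae_filter M"
    and "eventually P (F x) \<Longrightarrow> \<exists>B\<in>\<A>. (\<forall>\<^sub>F y in F x. y \<in> B) \<and> (AE y in M. y \<in> B \<longrightarrow> P y)"
    and "E \<in> \<A> \<Longrightarrow> AE x in M. x \<in> E \<longrightarrow> (\<forall>\<^sub>F y in F x. y \<in> E)"
  using assms unfolding filter_lifting_def by blast+

lemma filter_lifting_AE:
  assumes "filter_lifting M \<A> F" "AE y in M. P y" shows "eventually P (F x)"
  using filter_liftingD(3)[OF assms(1), of x] assms(2) by (rule filter_leD)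

context finite_measure
begin

lemma filter_lifting_trivial:
  assumes "emeasure M (space M) \<noteq> 0"
  shows "filter_lifting M {{}, space M} (\<lambda>_. ae_filter M)"
proof -
  have "sub_sigma M {{}, space M}"
    unfolding sub_sigma_def using sigma_algebra_trivial by auto
  moreover have "ae_filter M \<noteq> bot"
    using assms by (simp add: ae_filter_eq_bot_iff)
  ultimately show ?thesis
    unfolding filter_lifting_def by (auto intro!: bexI[of _ "space M"] elim: eventually_mono)
qed

text \<open>If \<open>E\<close> misses a set of \<open>F x\<close>, then it misses, up to a null set, some \<open>B \<in> \<A>\<close> of \<open>F x\<close>. The set
  \<open>H\<close> where the conditional probability of \<open>E\<close> is positive is the smallest member of \<open>\<A>\<close> that covers
  \<open>E\<close> up to a null set; thus \<open>B\<close> misses \<open>H\<close> as well. But \<open>H \<in> F x\<close> for almost all \<open>x \<in> E\<close>.\<close>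
lemma filter_lifting_meets:
  assumes F: "filter_lifting M \<A> F" and E: "E \<in> sets M"
  shows "AE x in M. x \<in> E \<longrightarrow> inf (F x) (principal E) \<noteq> bot"
proof -
  note A = filter_liftingD(1)[OF F]
  define H where "H = {x\<in>space M. 0 < prob_given M \<A> E x}"
  have H: "H \<in> \<A>" unfolding H_def by (rule prob_given_level[OF A])
  then have H': "H \<in> sets M" "space M - H \<in> \<A>"
    using A by (auto simp: sub_sigma_def sigma_algebra_iff2)
  \<comment> \<open>\<open>H\<close> contains \<open>E\<close> up to a null set\<close>
  have "measure M ((space M - H) \<inter> E) = (\<integral>x\<in>space M - H. prob_given M \<A> E x \<partial>M)"
    by (rule prob_given_integral[OF A E H'(2), symmetric])
  also have "\<dots> \<le> (\<integral>x. 0 \<partial>M)"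
    unfolding set_lebesgue_integral_def using H' A
    by (intro integral_mono' integrable_zero) (auto simp: H_def indicator_def not_less)
  finally have "measure M ((space M - H) \<inter> E) = 0" by (simp add: measure_le_0_iff)
  then have "(space M - H) \<inter> E \<in> null_sets M"
    using H' E by (auto simp: null_sets_def emeasure_eq_measure)
  from AE_not_in[OF this] have EH: "AE x in M. x \<in> E \<longrightarrow> x \<in> H"
    using AE_space by eventually_elim auto
  show ?thesis
    using EH filter_liftingD(5)[OF F H]
  proof eventually_elim
    case (elim x)
    show ?case
    proof (intro impI notI)
      assume x: "x \<in> E" and "inf (F x) (principal E) = bot"
      then have "\<forall>\<^sub>F y in F x. y \<notin> E"
        by (simp add: trivial_limit_def eventually_inf_principal)
      from filter_liftingD(4)[OF F this] obtain B where B: "B \<in> \<A>" "\<forall>\<^sub>F y in F x. y \<in> B"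
          "AE y in M. y \<in> B \<longrightarrow> y \<notin> E" by auto
      have BM: "B \<in> sets M" using B(1) A by (auto simp: sub_sigma_def)
      have "(\<integral>y\<in>B. prob_given M \<A> E y \<partial>M) = measure M (B \<inter> E)"
        by (rule prob_given_integral[OF A E B(1)])
      also have "\<dots> = measure M {}"
        using B(3) BM E by (intro finite_measure_eq_AE) auto
      finally have "(\<integral>y. indicator B y *\<^sub>R prob_given M \<A> E y \<partial>M) = 0"
        by (simp add: set_lebesgue_integral_def)
      moreover have "AE y in M. 0 \<le> indicator B y *\<^sub>R prob_given M \<A> E y"
        using prob_given_bounds[OF A E] by eventually_elim (auto simp: indicator_def)
      ultimately have "AE y in M. indicator B y *\<^sub>R prob_given M \<A> E y = 0"
        using integrable_mult_indicator[OF BM prob_given_integrable[OF A E]]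
        by (subst (asm) integral_nonneg_eq_0_iff_AE) auto
      then have "AE y in M. y \<in> B \<longrightarrow> y \<notin> H"
        by eventually_elim (auto simp: H_def indicator_def)
      then have "\<forall>\<^sub>F y in F x. y \<in> B \<longrightarrow> y \<notin> H" by (rule filter_lifting_AE[OF F])
      moreover have "\<forall>\<^sub>F y in F x. y \<in> H" using elim x by blast
      ultimately have "\<forall>\<^sub>F y in F x. False" using B(2) by eventually_elim blast
      with filter_liftingD(2)[OF F, of x] show False by (simp add: trivial_limit_def)
    qed
  qed
qed

lemma sub_sigma_adjoin:
  assumes A: "sub_sigma M \<A>" and E: "E \<in> sets M"
  shows "sub_sigma M {(B \<inter> E) \<union> (C - E) | B C. B \<in> \<A> \<and> C \<in> \<A>}" (is "sub_sigma M ?A")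
proof -
  interpret A: sigma_algebra "space M" \<A> using A by (simp add: sub_sigma_def)
  have sub: "?A \<subseteq> sets M" using A E by (auto simp: sub_sigma_def)
  have "sigma_algebra (space M) ?A"
    unfolding sigma_algebra_iff2
  proof (intro conjI ballI allI impI)
    show "?A \<subseteq> Pow (space M)" using sub sets.sets_into_space by blast
    show "{} \<in> ?A" by (auto intro!: exI[of _ "{}"])
    fix D assume "D \<in> ?A"
    then obtain B C where D: "D = (B \<inter> E) \<union> (C - E)" "B \<in> \<A>" "C \<in> \<A>" by auto
    have "space M - D = ((space M - B) \<inter> E) \<union> ((space M - C) - E)"
      unfolding D(1) using sets.sets_into_space[OF E] by auto
    then show "space M - D \<in> ?A" using D by blast
  next
    fix D :: "nat \<Rightarrow> 'a set" assume "range D \<subseteq> ?A"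
    then have "\<forall>i. \<exists>B C. D i = (B \<inter> E) \<union> (C - E) \<and> B \<in> \<A> \<and> C \<in> \<A>" by blast
    then obtain B C where "\<And>i. D i = (B i \<inter> E) \<union> (C i - E)" "\<And>i. B i \<in> \<A>" "\<And>i. C i \<in> \<A>" by metis
    then have "(\<Union>i. D i) = ((\<Union>i. B i) \<inter> E) \<union> ((\<Union>i. C i) - E)" "(\<Union>i. B i) \<in> \<A>" "(\<Union>i. C i) \<in> \<A>" by auto
    then show "(\<Union>i. D i) \<in> ?A" by blast
  qed
  with sub show ?thesis by (simp add: sub_sigma_def)
qed

text \<open>At almost every point the filter is compatible with the one of \<open>E\<close> and its complement that
  contains the point, and can be refined by it. At the remaining points it is left unchanged.\<close>
lemma filter_lifting_adjoin:
  assumes F: "filter_lifting M \<A> F" and E: "E \<in> sets M"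
  obtains \<A>' F' where "filter_lifting M \<A>' F'" "\<A> \<subseteq> \<A>'" "E \<in> \<A>'" "\<And>x. F' x \<le> F x"
proof -
  note A = filter_liftingD(1)[OF F]
  interpret A: sigma_algebra "space M" \<A> using A by (simp add: sub_sigma_def)
  define \<A>' where "\<A>' = {(B \<inter> E) \<union> (C - E) | B C. B \<in> \<A> \<and> C \<in> \<A>}"
  define S where "S x = (if x \<in> E then E else space M - E)" for x
  define F' where "F' x = (if inf (F x) (principal (S x)) = bot then F x else inf (F x) (principal (S x)))" for x
  have le: "F' x \<le> F x" for x by (simp add: F'_def)
  have adj: "(B \<inter> E) \<union> (C - E) \<in> \<A>'" if "B \<in> \<A>" "C \<in> \<A>" for B C
    using that by (auto simp: \<A>'_def)
  have AA': "\<A> \<subseteq> \<A>'"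
  proof
    fix B assume "B \<in> \<A>"
    then show "B \<in> \<A>'" unfolding \<A>'_def by (auto intro!: exI[of _ B])
  qed
  have piece: "B \<inter> S x \<in> \<A>'" if "B \<in> \<A>" for B x
  proof (cases "x \<in> E")
    case True then show ?thesis using adj[OF that A.empty_sets] by (simp add: S_def)
  next
    case False
    have "B \<inter> (space M - E) = B - E" using A.sets_into_space[OF that] by auto
    then show ?thesis using False adj[OF A.empty_sets that] by (simp add: S_def)
  qed
  have SM: "AE x in M. x \<in> S x" using AE_space by eventually_elim (auto simp: S_def)
  have meets: "AE x in M. inf (F x) (principal (S x)) \<noteq> bot"
    using filter_lifting_meets[OF F E] filter_lifting_meets[OF F sets.compl_sets[OF E]] AE_space
    by eventually_elim (auto simp: S_def)
  have "filter_lifting M \<A>' F'"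
    unfolding filter_lifting_def
  proof (intro conjI allI impI ballI)
    show "sub_sigma M \<A>'" unfolding \<A>'_def by (rule sub_sigma_adjoin[OF A E])
    fix x
    show "F' x \<noteq> bot" using filter_liftingD(2)[OF F] by (simp add: F'_def)
    show "F' x \<le> ae_filter M" using le filter_liftingD(3)[OF F] by (rule order_trans)
    fix P assume P: "eventually P (F' x)"
    show "\<exists>B\<in>\<A>'. (\<forall>\<^sub>F y in F' x. y \<in> B) \<and> (AE y in M. y \<in> B \<longrightarrow> P y)"
    proof (cases "inf (F x) (principal (S x)) = bot")
      case True
      with P filter_liftingD(4)[OF F, of P x] AA' show ?thesis by (auto simp: F'_def)
    next
      case False
      with P have "\<forall>\<^sub>F y in F x. y \<in> S x \<longrightarrow> P y"
        by (simp add: F'_def eventually_inf_principal)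
      from filter_liftingD(4)[OF F this] obtain B where B: "B \<in> \<A>" "\<forall>\<^sub>F y in F x. y \<in> B"
        "AE y in M. y \<in> B \<longrightarrow> y \<in> S x \<longrightarrow> P y" by blast
      have "\<forall>\<^sub>F y in F' x. y \<in> B \<inter> S x"
        using False B(2) by (auto simp: F'_def eventually_inf_principal elim: eventually_mono)
      with B piece[OF B(1), of x] show ?thesis by (intro bexI[of _ "B \<inter> S x"]) auto
    qed
  next
    fix D assume "D \<in> \<A>'"
    then obtain B C where D: "D = (B \<inter> E) \<union> (C - E)" "B \<in> \<A>" "C \<in> \<A>" by (auto simp: \<A>'_def)
    show "AE x in M. x \<in> D \<longrightarrow> (\<forall>\<^sub>F y in F' x. y \<in> D)"
      using filter_liftingD(5)[OF F D(2)] filter_liftingD(5)[OF F D(3)] meets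
    proof eventually_elim
      case (elim x)
      show ?case
      proof
        assume x: "x \<in> D"
        show "\<forall>\<^sub>F y in F' x. y \<in> D"
        proof (cases "x \<in> E")
          case True
          with elim x D(1) have "\<forall>\<^sub>F y in F x. y \<in> B" by auto
          then show ?thesis using elim(3) True D(1)
            by (auto simp: F'_def S_def eventually_inf_principal elim: eventually_mono)
        next
          case False
          with elim x D(1) have "\<forall>\<^sub>F y in F x. y \<in> C" by auto
          then show ?thesis using elim(3) False D(1)
            by (auto simp: F'_def S_def eventually_inf_principal elim: eventually_mono)
        qed
      qed
    qed
  qed
  moreover have "E \<in> \<A>'" using adj[OF A.top A.empty_sets] sets.sets_into_space[OF E]
    by (simp add: Int_absorb1)
  ultimately show ?thesis using that le AA' by blast
qed

end

context finite_measure
begin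

text \<open>A set \<open>E\<close> is admitted to \<open>G x\<close> if its conditional probabilities with respect to \<open>\<A> n\<close> tend to
  \<open>1\<close> along the filter \<open>H x\<close> generated by all \<open>F n x\<close>. Martingale convergence together with the
  density property of the \<open>F n\<close>, applied to the sets \<open>1 - 1 / Suc k < prob_given M (\<A> n) E\<close>, gives
  the density property of \<open>G\<close>.\<close>
lemma filter_lifting_sequence:
  fixes \<A> :: "nat \<Rightarrow> 'a set set"
  assumes F: "\<And>n. filter_lifting M (\<A> n) (F n)" and mono: "mono \<A>"
    and dec: "\<And>m n x. m \<le> n \<Longrightarrow> F n x \<le> F m x"
  obtains \<B> G where "filter_lifting M \<B> G" "\<And>n. \<A> n \<subseteq> \<B>" "\<And>n x. G x \<le> F n x"
proof -
  let ?P = "\<lambda>n. prob_given M (\<A> n)"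
  note A = filter_liftingD(1)[OF F]
  define \<B> where "\<B> = martingale_sets \<A>"
  have B: "sub_sigma M \<B>" unfolding \<B>_def by (rule sub_sigma_martingale_sets[OF A mono])
  have AB: "\<A> n \<subseteq> \<B>" for n unfolding \<B>_def using mem_martingale_sets[OF A mono] by blast
  have BM: "E \<in> sets M" if "E \<in> \<B>" for E using that B by (auto simp: sub_sigma_def)
  define H where "H x = (INF n. F n x)" for x
  have ev_H: "eventually P (H x) \<longleftrightarrow> (\<exists>n. eventually P (F n x))" for P x
    unfolding H_def
  proof (subst eventually_INF_base)
    show "\<exists>k\<in>UNIV. F k x \<le> inf (F m x) (F n x)" for m n
      by (intro bexI[of _ "max m n"] le_infI dec) auto
  qed auto
  have H_bot: "H x \<noteq> bot" for x
    using filter_liftingD(2)[OF F] ev_H[of "\<lambda>_. False" x] by (auto simp: trivial_limit_def)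
  have H_ae: "eventually P (H x)" if "AE y in M. P y" for P x
    using filter_lifting_AE[OF F that] ev_H by blast
  define dense where "dense x E \<longleftrightarrow> (\<forall>\<epsilon>>0. \<exists>N. \<forall>n\<ge>N. \<forall>\<^sub>F y in H x. 1 - \<epsilon> < ?P n E y)" for x E
  have dense_space: "dense x (space M)" for x
    unfolding dense_def
  proof (intro allI impI exI[of _ 0])
    fix \<epsilon> :: real and n :: nat assume "0 < \<epsilon>" "0 \<le> n"
    have "space M \<in> \<A> n" using A[of n] by (simp add: sub_sigma_def sigma_algebra_def algebra.top)
    from prob_given_of_mem[OF A this] AE_space
    have "AE y in M. 1 - \<epsilon> < ?P n (space M) y"
      by eventually_elim (use \<open>0 < \<epsilon>\<close> in simp)
    then show "\<forall>\<^sub>F y in H x. 1 - \<epsilon> < ?P n (space M) y" by (rule H_ae)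
  qed
  have dense_Int: "dense x (D \<inter> E)" if D: "D \<in> \<B>" "dense x D" and E: "E \<in> \<B>" "dense x E" for x D E
    unfolding dense_def
  proof (intro allI impI)
    fix \<epsilon> :: real assume e: "0 < \<epsilon>"
    then have "0 < \<epsilon> / 2" by simp
    then obtain N1 N2 where N1: "\<And>n. n \<ge> N1 \<Longrightarrow> \<forall>\<^sub>F y in H x. 1 - \<epsilon>/2 < ?P n D y"
      and N2: "\<And>n. n \<ge> N2 \<Longrightarrow> \<forall>\<^sub>F y in H x. 1 - \<epsilon>/2 < ?P n E y"
      using D(2) E(2) unfolding dense_def by meson
    show "\<exists>N. \<forall>n\<ge>N. \<forall>\<^sub>F y in H x. 1 - \<epsilon> < ?P n (D \<inter> E) y"
    proof (intro exI[of _ "max N1 N2"] allI impI)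
      fix n assume n: "max N1 N2 \<le> n"
      have "\<forall>\<^sub>F y in H x. ?P n D y + ?P n E y - 1 \<le> ?P n (D \<inter> E) y"
        by (intro H_ae prob_given_Int A BM D E)
      moreover have "\<forall>\<^sub>F y in H x. 1 - \<epsilon>/2 < ?P n D y" using N1 n by simp
      moreover have "\<forall>\<^sub>F y in H x. 1 - \<epsilon>/2 < ?P n E y" using N2 n by simp
      ultimately show "\<forall>\<^sub>F y in H x. 1 - \<epsilon> < ?P n (D \<inter> E) y"
        by eventually_elim (simp add: field_simps)
    qed
  qed
  define Q where "Q x P \<longleftrightarrow> (\<exists>E\<in>\<B>. dense x E \<and> (AE y in M. y \<in> E \<longrightarrow> P y))" for x P
  define G where "G x = Abs_filter (Q x)" for x
  have spB: "space M \<in> \<B>" using B by (simp add: sub_sigma_def sigma_algebra_def algebra.top)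
  have filt: "is_filter (Q x)" for x
  proof
    show "Q x (\<lambda>_. True)" unfolding Q_def using spB dense_space by auto
    show "Q x (\<lambda>y. P y \<and> P' y)" if P: "Q x P" "Q x P'" for P P'
    proof -
      obtain D E where D: "D \<in> \<B>" "dense x D" "AE y in M. y \<in> D \<longrightarrow> P y"
        and E: "E \<in> \<B>" "dense x E" "AE y in M. y \<in> E \<longrightarrow> P' y"
        using P unfolding Q_def by blast
      have "D \<inter> E \<in> \<B>" using B D E by (simp add: sub_sigma_def sigma_algebra_def algebra_def ring_of_sets_def semiring_of_sets_def semiring_of_sets_axioms_def)
      moreover have "AE y in M. y \<in> D \<inter> E \<longrightarrow> P y \<and> P' y" using D(3) E(3) by eventually_elim auto
      ultimately show ?thesis using dense_Int[OF D(1,2) E(1,2)] unfolding Q_def by blast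
    qed
    show "Q x P'" if P: "\<forall>y. P y \<longrightarrow> P' y" "Q x P" for P P'
    proof -
      obtain D where D: "D \<in> \<B>" "dense x D" "AE y in M. y \<in> D \<longrightarrow> P y"
        using P unfolding Q_def by blast
      from D(3) have "AE y in M. y \<in> D \<longrightarrow> P' y" by eventually_elim (use P in blast)
      with D show ?thesis unfolding Q_def by blast
    qed
  qed
  have ev_G: "eventually P (G x) \<longleftrightarrow> Q x P" for P x
    unfolding G_def by (rule eventually_Abs_filter[OF filt])
  have "filter_lifting M \<B> G"
    unfolding filter_lifting_def
  proof (intro conjI allI impI ballI)
    show "sub_sigma M \<B>" by fact
    fix x
    show "G x \<noteq> bot"
    proof
      assume "G x = bot"
      then have "eventually (\<lambda>_. False) (G x)" by simp
      then obtain E where E: "E \<in> \<B>" "dense x E" "AE y in M. y \<in> E \<longrightarrow> False"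
        unfolding ev_G Q_def by blast
      have "{} \<in> \<A> n" for n using A[of n] by (simp add: sub_sigma_def sigma_algebra_iff2)
      from prob_given_of_mem[OF A this] have AE0: "AE y in M. ?P n {} y = 0" for n by simp
      obtain n where n: "\<forall>\<^sub>F y in H x. 1 - 1 / 2 < ?P n E y"
        using E(2)[unfolded dense_def, rule_format, of "1/2"] by auto
      have "AE y in M. ?P n E y \<le> ?P n {} y"
        using E(3) BM[OF E(1)] by (intro prob_given_le A) auto
      with AE0[of n] have "AE y in M. \<not> 1 - 1 / 2 < ?P n E y" by eventually_elim simp
      from H_ae[OF this] n have "\<forall>\<^sub>F y in H x. False" by eventually_elim blast
      with H_bot[of x] show False by (simp add: trivial_limit_def)
    qed
    show "G x \<le> ae_filter M"
    proof (rule filter_leI)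
      fix P assume "eventually P (ae_filter M)"
      then have "AE y in M. y \<in> space M \<longrightarrow> P y" by eventually_elim simp
      then show "eventually P (G x)" unfolding ev_G Q_def using spB dense_space by blast
    qed
    fix P assume "eventually P (G x)"
    then obtain E where E: "E \<in> \<B>" "dense x E" "AE y in M. y \<in> E \<longrightarrow> P y"
      unfolding ev_G Q_def by blast
    then have "eventually (\<lambda>y. y \<in> E) (G x)" unfolding ev_G Q_def by (intro bexI[of _ E]) auto
    with E show "\<exists>B\<in>\<B>. (\<forall>\<^sub>F y in G x. y \<in> B) \<and> (AE y in M. y \<in> B \<longrightarrow> P y)" by blast
  next
    fix E assume E: "E \<in> \<B>"
    have lim: "AE x in M. (\<lambda>n. ?P n E x) \<longlonglongrightarrow> indicator E x"
      using E by (simp add: \<B>_def martingale_sets_def)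
    have "AE x in M. \<forall>n k. x \<in> {y\<in>space M. 1 - 1 / Suc k < ?P n E y} \<longrightarrow>
        (\<forall>\<^sub>F y in F n x. y \<in> {y\<in>space M. 1 - 1 / Suc k < ?P n E y})"
      unfolding AE_all_countable
      by (intro allI filter_liftingD(5)[OF F] prob_given_level[OF A])
    with lim AE_space show "AE x in M. x \<in> E \<longrightarrow> (\<forall>\<^sub>F y in G x. y \<in> E)"
    proof eventually_elim
      case (elim x)
      show ?case
      proof
        assume "x \<in> E"
        then have lim1: "(\<lambda>n. ?P n E x) \<longlonglongrightarrow> 1" using elim(1) by simp
        have "dense x E"
          unfolding dense_def
        proof (intro allI impI)
          fix \<epsilon> :: real assume "0 < \<epsilon>"
          then obtain k where k: "1 / Suc k < \<epsilon>" using nat_approx_posE by blast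
          have "1 - 1 / Suc k < (1::real)" by simp
          from order_tendstoD(1)[OF lim1 this] obtain N where N: "\<And>n. n \<ge> N \<Longrightarrow> 1 - 1 / Suc k < ?P n E x"
            unfolding eventually_sequentially by blast
          show "\<exists>N. \<forall>n\<ge>N. \<forall>\<^sub>F y in H x. 1 - \<epsilon> < ?P n E y"
          proof (intro exI[of _ N] allI impI)
            fix n assume "N \<le> n"
            with N elim have "\<forall>\<^sub>F y in F n x. y \<in> {y\<in>space M. 1 - 1 / Suc k < ?P n E y}"
              by blast
            then have "\<forall>\<^sub>F y in F n x. 1 - \<epsilon> < ?P n E y"
              by eventually_elim (use k in auto)
            then show "\<forall>\<^sub>F y in H x. 1 - \<epsilon> < ?P n E y" unfolding ev_H by blast
          qed
        qed
        then show "\<forall>\<^sub>F y in G x. y \<in> E" unfolding ev_G Q_def using E by (intro bexI[of _ E]) auto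
      qed
    qed
  qed
  moreover have "G x \<le> F m x" for m x
  proof (rule filter_leI)
    fix P assume "eventually P (F m x)"
    from filter_liftingD(4)[OF F this] obtain E where E: "E \<in> \<A> m" "\<forall>\<^sub>F y in F m x. y \<in> E"
      "AE y in M. y \<in> E \<longrightarrow> P y" by blast
    have "dense x E"
      unfolding dense_def
    proof (intro allI impI exI[of _ m])
      fix \<epsilon> :: real and n assume e: "0 < \<epsilon>" and n: "m \<le> n"
      have "E \<in> \<A> n" using monoD[OF mono n] E(1) by (rule subsetD)
      from H_ae[OF prob_given_of_mem[OF A this]] 
      have "\<forall>\<^sub>F y in H x. ?P n E y = indicator E y" .
      moreover have "\<forall>\<^sub>F y in H x. y \<in> E" using E(2) ev_H by blast
      ultimately show "\<forall>\<^sub>F y in H x. 1 - \<epsilon> < ?P n E y"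
        by eventually_elim (use e in simp)
    qed
    then show "eventually P (G x)" unfolding ev_G Q_def using E AB[of m] by blast
  qed
  ultimately show ?thesis using AB that by blast
qed

end

text \<open>Finer filters are smaller in the order on filters, whence the reversed inequality in the second
  component.\<close>
definition lifting_le :: "'a set set \<times> ('a \<Rightarrow> 'a filter) \<Rightarrow> 'a set set \<times> ('a \<Rightarrow> 'a filter) \<Rightarrow> bool" where
  "lifting_le p q \<longleftrightarrow> fst p \<subseteq> fst q \<and> (\<forall>x. snd q x \<le> snd p x)"

lemma lifting_le_refl: "lifting_le p p"
  by (simp add: lifting_le_def)

lemma lifting_le_trans: "lifting_le p q \<Longrightarrow> lifting_le q r \<Longrightarrow> lifting_le p r"
  unfolding lifting_le_def by (meson order_trans)

lemma lifting_le_antisym: "lifting_le p q \<Longrightarrow> lifting_le q p \<Longrightarrow> p = q"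
  unfolding lifting_le_def by (intro prod_eqI ext order_antisym) auto

context finite_measure
begin

text \<open>If the union of the \<open>\<sigma>\<close>-algebras is closed under countable unions, it is the bound, with the
  infima of the filters. Otherwise some sequence \<open>E\<close> in the union has its union outside. Members of
  the chain containing the single \<open>E n\<close> are then cofinal, since a \<open>\<sigma>\<close>-algebra beyond all of them would
  contain the union of \<open>E\<close>, and \<open>filter_lifting_sequence\<close> applies.\<close>
lemma filter_lifting_chain:
  assumes C: "\<And>p. p \<in> C \<Longrightarrow> filter_lifting M (fst p) (snd p)" "C \<noteq> {}"
    and total: "\<And>p q. p \<in> C \<Longrightarrow> q \<in> C \<Longrightarrow> lifting_le p q \<or> lifting_le q p"
  obtains \<B> G where "filter_lifting M \<B> G" "\<And>p. p \<in> C \<Longrightarrow> lifting_le p (\<B>, G)"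
proof -
  define U where "U = (\<Union>p\<in>C. fst p)"
  have sub: "sub_sigma M (fst p)" if "p \<in> C" for p by (rule filter_liftingD(1)[OF C(1)[OF that]])
  have sa: "sigma_algebra (space M) (fst p)" if "p \<in> C" for p using sub[OF that] by (simp add: sub_sigma_def)
  show ?thesis
  proof (cases "\<forall>E :: nat \<Rightarrow> 'a set. range E \<subseteq> U \<longrightarrow> (\<Union>n. E n) \<in> U")
    case True
    define G where "G x = (INF p\<in>C. snd p x)" for x
    have ev_G: "eventually P (G x) \<longleftrightarrow> (\<exists>p\<in>C. eventually P (snd p x))" for P x
      unfolding G_def
    proof (rule eventually_INF_base)
      fix p q assume "p \<in> C" "q \<in> C"
      with total[of p q] show "\<exists>r\<in>C. snd r x \<le> inf (snd p x) (snd q x)"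
        unfolding lifting_le_def by (meson le_infI order_refl)
    qed fact
    have UM: "E \<in> sets M" if "E \<in> U" for E using that sub by (auto simp: U_def sub_sigma_def)
    have "sigma_algebra (space M) U"
      unfolding sigma_algebra_iff2
    proof (intro conjI ballI allI impI)
      show "U \<subseteq> Pow (space M)" using UM sets.sets_into_space by blast
      show "{} \<in> U" using C(2) sa by (auto simp: U_def sigma_algebra_iff2)
      show "space M - E \<in> U" if "E \<in> U" for E using that sa by (auto simp: U_def sigma_algebra_iff2)
    qed (use True in blast)
    then have subU: "sub_sigma M U" using UM by (auto simp: sub_sigma_def)
    have "filter_lifting M U G"
      unfolding filter_lifting_def
    proof (intro conjI allI impI ballI)
      fix x
      show "G x \<noteq> bot"
        using ev_G[of "\<lambda>_. False" x] filter_liftingD(2)[OF C(1)] unfolding trivial_limit_def by blast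
      obtain p where p: "p \<in> C" using C(2) by blast
      show "G x \<le> ae_filter M"
        unfolding G_def by (rule INF_lower2[OF p]) (rule filter_liftingD(3)[OF C(1)[OF p]])
      fix P assume "eventually P (G x)"
      then obtain p where p: "p \<in> C" "eventually P (snd p x)" unfolding ev_G by blast
      from filter_liftingD(4)[OF C(1)[OF p(1)] p(2)] p(1)
      show "\<exists>B\<in>U. (\<forall>\<^sub>F y in G x. y \<in> B) \<and> (AE y in M. y \<in> B \<longrightarrow> P y)"
        unfolding ev_G U_def by blast
    next
      fix E assume "E \<in> U"
      then obtain p where p: "p \<in> C" "E \<in> fst p" by (auto simp: U_def)
      from filter_liftingD(5)[OF C(1)[OF p(1)] p(2)]
      show "AE x in M. x \<in> E \<longrightarrow> (\<forall>\<^sub>F y in G x. y \<in> E)"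
        by eventually_elim (use p in \<open>auto simp: ev_G\<close>)
    qed fact
    moreover have "lifting_le p (U, G)" if "p \<in> C" for p
      using that by (auto simp: lifting_le_def U_def G_def intro: INF_lower)
    ultimately show ?thesis by (rule that)
  next
    case False
    then obtain E :: "nat \<Rightarrow> 'a set" where E: "range E \<subseteq> U" "(\<Union>n. E n) \<notin> U" by blast
    then have "\<forall>n. \<exists>p\<in>C. E n \<in> fst p" by (auto simp: U_def)
    then obtain c where c: "\<And>n. c n \<in> C" "\<And>n. E n \<in> fst (c n)" by metis
    have cofinal: "\<exists>n. lifting_le p (c n)" if "p \<in> C" for p
    proof (rule ccontr)
      assume "\<not> ?thesis"
      then have "E n \<in> fst p" for n
        using total[OF that c(1)[of n]] c(2)[of n] by (auto simp: lifting_le_def)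
      then have "(\<Union>n. E n) \<in> fst p"
        using sigma_algebra.countable_nat_UN[OF sa[OF that], of E] by blast
      with E(2) that show False by (auto simp: U_def)
    qed
    \<comment> \<open>the running maximum of \<open>c\<close>\<close>
    define d where "d = rec_nat (c 0) (\<lambda>n p. if lifting_le p (c (Suc n)) then c (Suc n) else p)"
    have d_Suc: "d (Suc n) = (if lifting_le (d n) (c (Suc n)) then c (Suc n) else d n)" for n
      by (simp add: d_def)
    have dC: "d n \<in> C" for n by (induction n) (auto simp: d_Suc c(1), simp add: d_def c(1))
    have step: "lifting_le (d n) (d (Suc n))" for n by (simp add: d_Suc lifting_le_refl)
    have d_mono: "lifting_le (d m) (d n)" if "m \<le> n" for m n
      using that by (induction rule: dec_induct) (auto intro: lifting_le_refl lifting_le_trans step)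
    have cd: "lifting_le (c n) (d n)" for n
    proof (cases n)
      case 0 then show ?thesis by (simp add: d_def lifting_le_refl)
    next
      case (Suc k)
      then show ?thesis using total[OF dC[of k] c(1)[of n]] by (auto simp: d_Suc lifting_le_refl)
    qed
    obtain \<B> G where BG: "filter_lifting M \<B> G" "\<And>n. fst (d n) \<subseteq> \<B>" "\<And>n x. G x \<le> snd (d n) x"
    proof (rule filter_lifting_sequence[of "\<lambda>n. fst (d n)" "\<lambda>n. snd (d n)"])
      show "filter_lifting M (fst (d n)) (snd (d n))" for n by (rule C(1)[OF dC])
      show "mono (\<lambda>n. fst (d n))" using d_mono by (auto simp: mono_def lifting_le_def)
      show "snd (d n) x \<le> snd (d m) x" if "m \<le> n" for m n x
        using d_mono[OF that] by (simp add: lifting_le_def)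
    qed blast
    have "lifting_le p (\<B>, G)" if "p \<in> C" for p
    proof -
      obtain n where "lifting_le p (c n)" using cofinal[OF \<open>p \<in> C\<close>] by blast
      moreover have "lifting_le (d n) (\<B>, G)" using BG by (simp add: lifting_le_def)
      ultimately show ?thesis using cd[of n] lifting_le_trans by blast
    qed
    with BG(1) show ?thesis by (rule that)
  qed
qed

text \<open>A maximal element of Zorn's lemma has all measurable sets in its \<open>\<sigma>\<close>-algebra, as otherwise one
  more could be adjoined.\<close>
theorem lifting_filters:
  assumes "emeasure M (space M) \<noteq> 0"
  obtains F :: "'a \<Rightarrow> 'a filter"
  where "\<And>x. F x \<noteq> bot"
    and "\<And>P x. AE y in M. P y \<Longrightarrow> eventually P (F x)"
    and "\<And>E. E \<in> sets M \<Longrightarrow> AE x in M. x \<in> E \<longrightarrow> (\<forall>\<^sub>F y in F x. y \<in> E)"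
proof -
  define X where "X = {p. filter_lifting M (fst p) (snd p)}"
  have "\<exists>m\<in>X. \<forall>p\<in>X. lifting_le m p \<longrightarrow> p = m"
  proof (rule predicate_Zorn)
    show "partial_order_on X (relation_of lifting_le X)"
      by (rule partial_order_on_relation_ofI) (blast intro: lifting_le_refl lifting_le_trans lifting_le_antisym)+
    fix C assume "C \<in> Chains (relation_of lifting_le X)"
    then have C: "C \<subseteq> X" "\<And>p q. p \<in> C \<Longrightarrow> q \<in> C \<Longrightarrow> lifting_le p q \<or> lifting_le q p"
      by (auto simp: Chains_def relation_of_def)
    show "\<exists>u\<in>X. \<forall>p\<in>C. lifting_le p u"
    proof (cases "C = {}")
      case True
      then show ?thesis using filter_lifting_trivial[OF assms] by (auto simp: X_def)
    next
      case False
      obtain \<B> G where "filter_lifting M \<B> G" "\<And>p. p \<in> C \<Longrightarrow> lifting_le p (\<B>, G)"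
        by (rule filter_lifting_chain[of C]) (use C False in \<open>auto simp: X_def\<close>)
      then show ?thesis by (intro bexI[of _ "(\<B>, G)"]) (auto simp: X_def)
    qed
  qed
  then obtain \<A> F where F: "filter_lifting M \<A> F"
    and max: "\<And>p. filter_lifting M (fst p) (snd p) \<Longrightarrow> lifting_le (\<A>, F) p \<Longrightarrow> p = (\<A>, F)"
    by (auto simp: X_def)
  have "E \<in> \<A>" if E: "E \<in> sets M" for E
  proof -
    from filter_lifting_adjoin[OF F E] obtain \<A>' F' where
      *: "filter_lifting M \<A>' F'" "\<A> \<subseteq> \<A>'" "E \<in> \<A>'" "\<And>x. F' x \<le> F x" by blast
    with max[of "(\<A>', F')"] show ?thesis by (simp add: lifting_le_def)
  qed
  then show ?thesis
    using filter_liftingD(2)[OF F] filter_lifting_AE[OF F] filter_liftingD(5)[OF F] by (intro that[of F]) blast+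
qed

end

section \<open>The coupling functional\<close>

definition bounded_on :: "'b set \<Rightarrow> ('b \<Rightarrow> real) set" where
  "bounded_on S = {f. \<exists>b. \<forall>x\<in>S. \<bar>f x\<bar> \<le> b}"

lemma bounded_onI: "(\<And>x. x \<in> S \<Longrightarrow> \<bar>f x\<bar> \<le> b) \<Longrightarrow> f \<in> bounded_on S"
  by (auto simp: bounded_on_def)

lemma bounded_onE:
  assumes "f \<in> bounded_on S"
  obtains b where "0 \<le> b" "\<And>x. x \<in> S \<Longrightarrow> \<bar>f x\<bar> \<le> b"
proof -
  from assms obtain b where b: "\<And>x. x \<in> S \<Longrightarrow> \<bar>f x\<bar> \<le> b" by (auto simp: bounded_on_def)
  show ?thesis by (rule that[of "\<bar>b\<bar>"]) (use b in force)+
qed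

lemma bounded_on_add:
  assumes "f \<in> bounded_on S" "g \<in> bounded_on S"
  shows "(\<lambda>x. f x + g x) \<in> bounded_on S"
proof -
  obtain b c where b: "\<And>x. x \<in> S \<Longrightarrow> \<bar>f x\<bar> \<le> b" and c: "\<And>x. x \<in> S \<Longrightarrow> \<bar>g x\<bar> \<le> c"
    using assms by (auto simp: bounded_on_def)
  show ?thesis by (rule bounded_onI[of S _ "b + c"]) (use b c in \<open>force intro: order_trans[OF abs_triangle_ineq] add_mono\<close>)
qed

lemma bounded_on_mult:
  assumes "f \<in> bounded_on S" "g \<in> bounded_on S"
  shows "(\<lambda>x. f x * g x) \<in> bounded_on S"
proof -
  obtain b where b: "0 \<le> b" "\<And>x. x \<in> S \<Longrightarrow> \<bar>f x\<bar> \<le> b" using assms(1) by (rule bounded_onE) blast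
  obtain c where c: "0 \<le> c" "\<And>x. x \<in> S \<Longrightarrow> \<bar>g x\<bar> \<le> c" using assms(2) by (rule bounded_onE) blast
  show ?thesis
    by (rule bounded_onI[of S _ "b * c"]) (use b c in \<open>auto simp: abs_mult intro!: mult_mono\<close>)
qed

lemma bounded_on_const: "(\<lambda>_. c) \<in> bounded_on S"
  by (rule bounded_onI[of _ _ "\<bar>c\<bar>"]) simp

lemma function_space_bounded: "function_space (bounded_on S)"
  unfolding function_space_def
  using bounded_on_const bounded_on_add bounded_on_mult[OF bounded_on_const] by blast

lemma bounded_continuous:
  assumes "compact K" "continuous_on K f" shows "f \<in> bounded_on K"
proof -
  obtain b where "\<And>x. x \<in> K \<Longrightarrow> \<bar>f x\<bar> \<le> b"
    using compact_imp_bounded[OF compact_continuous_image[OF assms(2,1)]] by (auto simp: bounded_iff)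
  then show ?thesis by (rule bounded_onI)
qed

text \<open>The properties of finite sums of functions \<open>g(x) (a(y) - a(x))\<close>, with \<open>g\<close> bounded and \<open>a\<close>
  continuous and affine, on which the coupling argument rests. Equicontinuity in the second variable makes
  suprema over the first one continuous.\<close>
definition affine_kernels :: "'a::locally_convex_space set \<Rightarrow> ('a \<times> 'a \<Rightarrow> real) set" where
  "affine_kernels K = {d. d \<in> bounded_on (K \<times> K) \<and>
     (\<forall>x\<in>K. d (x, x) = 0 \<and> affine_map_on K (\<lambda>y. d (x, y))) \<and>
     (\<forall>y\<in>K. \<forall>e>0. \<forall>\<^sub>F z in at y within K. \<forall>x\<in>K. \<bar>d (x, z) - d (x, y)\<bar> < e)}"

lemma affine_kernels_equicontinuous:
  assumes "d \<in> affine_kernels K" "y \<in> K" "0 < e"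
  shows "\<forall>\<^sub>F z in at y within K. \<forall>x\<in>K. \<bar>d (x, z) - d (x, y)\<bar> < e"
  using assms unfolding affine_kernels_def by blast

lemma affine_kernels_add:
  assumes "d \<in> affine_kernels K" "d' \<in> affine_kernels K"
  shows "(\<lambda>z. d z + d' z) \<in> affine_kernels K"
  unfolding affine_kernels_def mem_Collect_eq
proof (intro conjI ballI allI impI)
  show "(\<lambda>z. d z + d' z) \<in> bounded_on (K \<times> K)"
    using assms by (intro bounded_on_add) (auto simp: affine_kernels_def)
  show "d (x, x) + d' (x, x) = 0" if "x \<in> K" for x
    using assms that by (simp add: affine_kernels_def)
  show "affine_map_on K (\<lambda>y. d (x, y) + d' (x, y))" if "x \<in> K" for x
    using assms that by (auto simp: affine_kernels_def affine_map_on_def algebra_simps)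
  fix y and e :: real assume y: "y \<in> K" and e: "0 < e"
  have "\<forall>\<^sub>F z in at y within K. \<forall>x\<in>K. \<bar>d (x, z) - d (x, y)\<bar> < e / 2"
    "\<forall>\<^sub>F z in at y within K. \<forall>x\<in>K. \<bar>d' (x, z) - d' (x, y)\<bar> < e / 2"
    using assms y e by (simp_all add: affine_kernels_equicontinuous del: less_divide_eq_numeral1)
  then show "\<forall>\<^sub>F z in at y within K. \<forall>x\<in>K. \<bar>d (x, z) + d' (x, z) - (d (x, y) + d' (x, y))\<bar> < e"
  proof eventually_elim
    case (elim z)
    show ?case
    proof
      fix x assume "x \<in> K"
      then have "\<bar>d (x, z) - d (x, y)\<bar> < e / 2" "\<bar>d' (x, z) - d' (x, y)\<bar> < e / 2" using elim by auto
      then show "\<bar>d (x, z) + d' (x, z) - (d (x, y) + d' (x, y))\<bar> < e" by linarith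
    qed
  qed
qed

lemma affine_kernels_scale:
  assumes "d \<in> affine_kernels K"
  shows "(\<lambda>z. c * d z) \<in> affine_kernels K"
  unfolding affine_kernels_def mem_Collect_eq
proof (intro conjI ballI allI impI)
  show "(\<lambda>z. c * d z) \<in> bounded_on (K \<times> K)"
    using assms by (intro bounded_on_mult bounded_on_const) (auto simp: affine_kernels_def)
  show "c * d (x, x) = 0" if "x \<in> K" for x
    using assms that by (simp add: affine_kernels_def)
  show "affine_map_on K (\<lambda>y. c * d (x, y))" if "x \<in> K" for x
    using assms that by (auto simp: affine_kernels_def affine_map_on_def algebra_simps)
  fix y and e :: real assume y: "y \<in> K" and e: "0 < e"
  have "\<forall>\<^sub>F z in at y within K. \<forall>x\<in>K. \<bar>d (x, z) - d (x, y)\<bar> < e / (\<bar>c\<bar> + 1)"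
    by (rule affine_kernels_equicontinuous[OF assms y]) (use e in simp)
  then show "\<forall>\<^sub>F z in at y within K. \<forall>x\<in>K. \<bar>c * d (x, z) - c * d (x, y)\<bar> < e"
  proof eventually_elim
    case (elim z)
    show ?case
    proof
      fix x assume "x \<in> K"
      then have "\<bar>d (x, z) - d (x, y)\<bar> * (\<bar>c\<bar> + 1) < e" using elim by (simp add: pos_less_divide_eq)
      moreover have "\<bar>c * d (x, z) - c * d (x, y)\<bar> = \<bar>c\<bar> * \<bar>d (x, z) - d (x, y)\<bar>"
        by (simp add: abs_mult flip: right_diff_distrib)
      ultimately show "\<bar>c * d (x, z) - c * d (x, y)\<bar> < e"
        by (simp add: algebra_simps)
    qed
  qed
qed

lemma affine_kernels_zero: "(\<lambda>_. 0) \<in> affine_kernels K"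
  by (auto simp: affine_kernels_def affine_map_on_def bounded_on_const)

lemma affine_kernelsI:
  assumes K: "compact K" and g: "g \<in> bounded_on K"
    and a: "continuous_on K a" "affine_map_on K a"
  shows "(\<lambda>(x, y). g x * (a y - a x)) \<in> affine_kernels K"
  unfolding affine_kernels_def mem_Collect_eq
proof (intro conjI ballI allI impI)
  let ?d = "\<lambda>(x, y). g x * (a y - a x)"
  obtain b where b: "0 \<le> b" "\<And>x. x \<in> K \<Longrightarrow> \<bar>g x\<bar> \<le> b" using g by (rule bounded_onE) blast
  obtain c where c: "0 \<le> c" "\<And>x. x \<in> K \<Longrightarrow> \<bar>a x\<bar> \<le> c"
    using bounded_continuous[OF K a(1)] by (rule bounded_onE) blast
  have "\<bar>g x * (a y - a x)\<bar> \<le> b * (c + c)" if "x \<in> K" "y \<in> K" for x y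
    unfolding abs_mult using b(1) b(2)[OF that(1)] c(2)[OF that(1)] c(2)[OF that(2)]
    by (intro mult_mono) auto
  then show "(\<lambda>(x, y). g x * (a y - a x)) \<in> bounded_on (K \<times> K)"
    by (intro bounded_onI[of _ _ "b * (c + c)"]) auto
  show "?d (x, x) = 0" for x by simp
  show "affine_map_on K (\<lambda>y. ?d (x, y))" for x
    unfolding affine_map_on_def
  proof (intro ballI allI impI)
    fix y z and u v :: real assume yz: "y \<in> K" "z \<in> K" "0 \<le> u" "0 \<le> v" "u + v = 1"
    have comb: "a (u *\<^sub>R y + v *\<^sub>R z) = u * a y + v * a z"
      using a(2) yz unfolding affine_map_on_def by simp
    have "g x * (a (u *\<^sub>R y + v *\<^sub>R z) - a x) = g x * (u * a y + v * a z - (u + v) * a x)"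
      by (simp add: comb yz(5))
    also have "\<dots> = u * (g x * (a y - a x)) + v * (g x * (a z - a x))" by (simp add: algebra_simps)
    finally show "?d (x, u *\<^sub>R y + v *\<^sub>R z) =
        u *\<^sub>R ?d (x, y) + v *\<^sub>R ?d (x, z)"
      by simp
  qed
  fix y and e :: real assume y: "y \<in> K" and e: "0 < e"
  have "(a \<longlongrightarrow> a y) (at y within K)" using a(1) y by (simp add: continuous_on_def)
  then have "\<forall>\<^sub>F z in at y within K. dist (a z) (a y) < e / (b + 1)"
    using e b(1) by (intro tendstoD) auto
  then show "\<forall>\<^sub>F z in at y within K. \<forall>x\<in>K. \<bar>?d (x, z) - ?d (x, y)\<bar> < e"
  proof eventually_elim
    case (elim z)
    show ?case
    proof
      fix x assume x: "x \<in> K"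
      have "\<bar>g x\<bar> * \<bar>a z - a y\<bar> \<le> b * \<bar>a z - a y\<bar>" using b(2)[OF x] by (intro mult_right_mono) auto
      also have "\<dots> \<le> (b + 1) * \<bar>a z - a y\<bar>" by (simp add: algebra_simps)
      also have "\<dots> < e" using elim b(1) by (simp add: dist_real_def pos_less_divide_eq mult.commute)
      finally have "\<bar>g x * (a z - a y)\<bar> < e" by (simp add: abs_mult)
      moreover have "g x * (a z - a x) - g x * (a y - a x) = g x * (a z - a y)" by (simp add: algebra_simps)
      ultimately show "\<bar>?d (x, z) - ?d (x, y)\<bar> < e"
        by simp
    qed
  qed
qed

lemma regular_borel_measuresD:
  assumes "M \<in> regular_borel_measures K"
  shows "finite_measure M" "sets M = sets (restrict_space borel K)" "space M = K"
  using assms sets_eq_imp_space_eq[of M "restrict_space borel K"]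
  by (auto simp: regular_borel_measures_def space_restrict_space)

text \<open>The function is \<open>c(y) = sup_x (- g(x) - d(x, y))\<close>: a supremum of affine functions, continuous by
  equicontinuity, and above \<open>- g\<close> because \<open>d\<close> vanishes on the diagonal. The last clause says that it
  is the least upper bound.\<close>
lemma convex_envelope:
  fixes K :: "'a::locally_convex_space set"
  assumes "convex K" "g \<in> bounded_on K" "d \<in> affine_kernels K"
  obtains c where "continuous_on K c" "convex_on K c"
    "\<And>y. y \<in> K \<Longrightarrow> - g y \<le> c y"
    "\<And>y r. y \<in> K \<Longrightarrow> (\<And>x. x \<in> K \<Longrightarrow> - g x - d (x, y) \<le> r) \<Longrightarrow> c y \<le> r"
proof -
  define c where "c y = (SUP x\<in>K. - g x - d (x, y))" for y
  obtain b where b: "\<And>x. x \<in> K \<Longrightarrow> \<bar>g x\<bar> \<le> b" using assms(2) by (auto simp: bounded_on_def)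
  have "d \<in> bounded_on (K \<times> K)" using assms(3) by (simp add: affine_kernels_def)
  then obtain b' where b': "\<And>x y. x \<in> K \<Longrightarrow> y \<in> K \<Longrightarrow> \<bar>d (x, y)\<bar> \<le> b'"
    by (auto simp: bounded_on_def)
  have upper: "- g x - d (x, y) \<le> c y" if "x \<in> K" "y \<in> K" for x y
    unfolding c_def
  proof (rule cSUP_upper[OF that(1)])
    show "bdd_above ((\<lambda>x. - g x - d (x, y)) ` K)"
    proof (rule bdd_aboveI2)
      fix x assume "x \<in> K"
      then show "- g x - d (x, y) \<le> b + b'" using b[of x] b'[of x y] that(2) by linarith
    qed
  qed
  have least: "c y \<le> r" if "y \<in> K" "\<And>x. x \<in> K \<Longrightarrow> - g x - d (x, y) \<le> r" for y r
    unfolding c_def using that by (intro cSUP_least) auto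
  have affine: "d (x, u *\<^sub>R y + v *\<^sub>R z) = u * d (x, y) + v * d (x, z)"
    if "x \<in> K" "y \<in> K" "z \<in> K" "0 \<le> u" "0 \<le> v" "u + v = 1" for x y z u v
    using assms(3) that by (auto simp: affine_kernels_def affine_map_on_def)
  have "convex_on K c"
    unfolding convex_on_def
  proof (intro conjI ballI allI impI \<open>convex K\<close>)
    fix y z and u v :: real assume *: "y \<in> K" "z \<in> K" "0 \<le> u" "0 \<le> v" "u + v = 1"
    show "c (u *\<^sub>R y + v *\<^sub>R z) \<le> u * c y + v * c z"
    proof (rule least)
      show "u *\<^sub>R y + v *\<^sub>R z \<in> K" using \<open>convex K\<close> * by (simp add: convexD)
      fix x assume x: "x \<in> K"
      have "- g x - d (x, u *\<^sub>R y + v *\<^sub>R z) = - ((u + v) * g x) - (u * d (x, y) + v * d (x, z))"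
        using affine[OF x *] *(5) by simp
      also have "\<dots> = u * (- g x - d (x, y)) + v * (- g x - d (x, z))" by (simp add: algebra_simps)
      also have "\<dots> \<le> u * c y + v * c z" using * x by (intro add_mono mult_left_mono upper)
      finally show "- g x - d (x, u *\<^sub>R y + v *\<^sub>R z) \<le> u * c y + v * c z" .
    qed
  qed
  moreover have "continuous_on K c"
    unfolding continuous_on_def
  proof (intro ballI tendstoI)
    fix y and e :: real assume y: "y \<in> K" and e: "0 < e"
    have "\<forall>\<^sub>F z in at y within K. \<forall>x\<in>K. \<bar>d (x, z) - d (x, y)\<bar> < e / 2"
      by (rule affine_kernels_equicontinuous[OF assms(3) y]) (use e in simp)
    moreover have "\<forall>\<^sub>F z in at y within K. z \<in> K" by (simp add: eventually_at_filter)
    ultimately show "\<forall>\<^sub>F z in at y within K. dist (c z) (c y) < e"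
    proof eventually_elim
      case (elim z)
      have "c z \<le> c y + e / 2"
      proof (rule least[OF elim(2)])
        fix x assume x: "x \<in> K"
        have "\<bar>d (x, z) - d (x, y)\<bar> < e / 2" using elim(1) x by blast
        then show "- g x - d (x, z) \<le> c y + e / 2" using upper[OF x y] by linarith
      qed
      moreover have "c y \<le> c z + e / 2"
      proof (rule least[OF y])
        fix x assume x: "x \<in> K"
        have "\<bar>d (x, z) - d (x, y)\<bar> < e / 2" using elim(1) x by blast
        then show "- g x - d (x, y) \<le> c z + e / 2" using upper[OF x elim(2)] by linarith
      qed
      ultimately show ?case using e by (simp add: dist_real_def abs_less_iff)
    qed
  qed
  moreover have "- g y \<le> c y" if "y \<in> K" for y
    using upper[OF that that] assms(3) that by (simp add: affine_kernels_def)
  ultimately show ?thesis using least that by blast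
qed

locale choquet_pair =
  fixes K :: "'a::locally_convex_space set" and \<mu> \<nu> :: "'a measure"
  assumes compact_K: "compact K" and convex_K: "convex K"
    and mu: "\<mu> \<in> regular_borel_measures K" and nu: "\<nu> \<in> regular_borel_measures K"
    and le: "choquet_le K \<mu> \<nu>"
begin

lemma finite_mu: "finite_measure \<mu>" and finite_nu: "finite_measure \<nu>"
  and space_mu: "space \<mu> = K" and space_nu: "space \<nu> = K"
  using regular_borel_measuresD[OF mu] regular_borel_measuresD[OF nu] by auto

definition mu_functions :: "('a \<Rightarrow> real) set" where
  "mu_functions = {g \<in> borel_measurable \<mu>. g \<in> bounded_on K}"

lemma integrable_mu_functions: "g \<in> mu_functions \<Longrightarrow> integrable \<mu> g"
proof -
  assume g: "g \<in> mu_functions"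
  then obtain b where "\<And>x. x \<in> K \<Longrightarrow> \<bar>g x\<bar> \<le> b" by (auto simp: mu_functions_def bounded_on_def)
  then show "integrable \<mu> g"
    using g by (intro finite_measure.integrable_const_bound[OF finite_mu, of _ b]) (auto simp: mu_functions_def space_mu)
qed

lemma continuous_mu_functions: "continuous_on K f \<Longrightarrow> f \<in> mu_functions"
  using integrable_continuous_on(1)[OF compact_K regular_borel_measuresD(1,2)[OF mu]]
  by (simp add: mu_functions_def bounded_continuous[OF compact_K])

lemma integrable_nu: "continuous_on K f \<Longrightarrow> integrable \<nu> (f :: 'a \<Rightarrow> real)"
  by (rule integrable_continuous_on[OF compact_K regular_borel_measuresD(1,2)[OF nu]])

lemma mu_functions_add: "f \<in> mu_functions \<Longrightarrow> g \<in> mu_functions \<Longrightarrow> (\<lambda>x. f x + g x) \<in> mu_functions"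
  and mu_functions_mult: "f \<in> mu_functions \<Longrightarrow> g \<in> mu_functions \<Longrightarrow> (\<lambda>x. f x * g x) \<in> mu_functions"
  and mu_functions_const: "(\<lambda>_. c) \<in> mu_functions"
  by (auto simp: mu_functions_def bounded_on_add bounded_on_mult bounded_on_const)

text \<open>The one place where the Choquet order enters: it compares the integrals of the convex function
  lying between \<open>- g\<close> and \<open>f\<close>.\<close>
lemma integral_nonneg_of_majorant:
  assumes g: "g \<in> mu_functions" and f: "continuous_on K f" and d: "d \<in> affine_kernels K"
    and nonneg: "\<And>x y. x \<in> K \<Longrightarrow> y \<in> K \<Longrightarrow> 0 \<le> g x + f y + d (x, y)"
  shows "0 \<le> (\<integral>x. g x \<partial>\<mu>) + (\<integral>x. f x \<partial>\<nu>)"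
proof -
  have "g \<in> bounded_on K" using g by (simp add: mu_functions_def)
  then obtain c where c: "continuous_on K c" "convex_on K c"
    "\<And>y. y \<in> K \<Longrightarrow> - g y \<le> c y"
    "\<And>y r. y \<in> K \<Longrightarrow> (\<And>x. x \<in> K \<Longrightarrow> - g x - d (x, y) \<le> r) \<Longrightarrow> c y \<le> r"
    by (rule convex_envelope[OF convex_K _ d]) blast
  have "- (\<integral>x. g x \<partial>\<mu>) = (\<integral>x. - g x \<partial>\<mu>)" by simp
  also have "\<dots> \<le> (\<integral>x. c x \<partial>\<mu>)"
    using integrable_mu_functions[OF g] integrable_mu_functions[OF continuous_mu_functions[OF c(1)]] c(3)
    by (intro integral_mono) (auto simp: space_mu)
  also have "\<dots> \<le> (\<integral>x. c x \<partial>\<nu>)" using le c(1,2) by (simp add: choquet_le_def)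
  also have "\<dots> \<le> (\<integral>x. f x \<partial>\<nu>)"
  proof (rule integral_mono[OF integrable_nu[OF c(1)] integrable_nu[OF f]])
    fix y assume "y \<in> space \<nu>"
    then have y: "y \<in> K" by (simp add: space_nu)
    show "c y \<le> f y"
    proof (rule c(4)[OF y])
      fix x assume "x \<in> K"
      then show "- g x - d (x, y) \<le> f y" using nonneg[of x y] y by linarith
    qed
  qed
  finally show ?thesis by simp
qed

text \<open>The infimum of these values is the sublinear functional to which Hahn--Banach is applied.\<close>
definition majorant_values :: "('a \<times> 'a \<Rightarrow> real) \<Rightarrow> real set" where
  "majorant_values h = {(\<integral>x. g x \<partial>\<mu>) + (\<integral>x. f x \<partial>\<nu>) | g f d. g \<in> mu_functions \<and> continuous_on K f \<and>
     d \<in> affine_kernels K \<and> (\<forall>x\<in>K. \<forall>y\<in>K. h (x, y) \<le> g x + f y + d (x, y))}"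

abbreviation "majorant_inf h \<equiv> Inf (majorant_values h)"

lemma majorant_valuesI:
  assumes "g \<in> mu_functions" "continuous_on K f" "d \<in> affine_kernels K"
    and "\<And>x y. x \<in> K \<Longrightarrow> y \<in> K \<Longrightarrow> h (x, y) \<le> g x + f y + d (x, y)"
    and "r = (\<integral>x. g x \<partial>\<mu>) + (\<integral>x. f x \<partial>\<nu>)"
  shows "r \<in> majorant_values h"
  using assms unfolding majorant_values_def by blast

lemma majorant_valuesE:
  assumes "r \<in> majorant_values h"
  obtains g f d where "g \<in> mu_functions" "continuous_on K f" "d \<in> affine_kernels K"
    and "\<And>x y. x \<in> K \<Longrightarrow> y \<in> K \<Longrightarrow> h (x, y) \<le> g x + f y + d (x, y)"
    and "r = (\<integral>x. g x \<partial>\<mu>) + (\<integral>x. f x \<partial>\<nu>)"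
  using assms unfolding majorant_values_def by blast

lemma majorant_values_lower:
  assumes h: "\<And>x y. x \<in> K \<Longrightarrow> y \<in> K \<Longrightarrow> - b \<le> h (x, y)" and r: "r \<in> majorant_values h"
  shows "- b * measure \<mu> K \<le> r"
  using r
proof (rule majorant_valuesE)
  interpret finite_measure \<mu> by (rule finite_mu)
  fix g f d assume *: "g \<in> mu_functions" "continuous_on K f" "d \<in> affine_kernels K"
    "\<And>x y. x \<in> K \<Longrightarrow> y \<in> K \<Longrightarrow> h (x, y) \<le> g x + f y + d (x, y)"
    "r = (\<integral>x. g x \<partial>\<mu>) + (\<integral>x. f x \<partial>\<nu>)"
  have "0 \<le> (\<integral>x. g x + b \<partial>\<mu>) + (\<integral>x. f x \<partial>\<nu>)"
  proof (rule integral_nonneg_of_majorant[OF _ *(2,3)])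
    show "(\<lambda>x. g x + b) \<in> mu_functions" by (intro mu_functions_add *(1) mu_functions_const)
    show "0 \<le> g x + b + f y + d (x, y)" if "x \<in> K" "y \<in> K" for x y
      using h[OF that] *(4)[OF that] by linarith
  qed
  also have "(\<integral>x. g x + b \<partial>\<mu>) = (\<integral>x. g x \<partial>\<mu>) + b * measure \<mu> K"
    using integrable_mu_functions[OF *(1)] by (simp add: space_mu)
  finally show ?thesis by (simp add: *(5))
qed

lemma majorant_values_nonempty:
  assumes "h \<in> bounded_on (K \<times> K)" shows "majorant_values h \<noteq> {}"
proof -
  obtain b where "\<And>x y. x \<in> K \<Longrightarrow> y \<in> K \<Longrightarrow> \<bar>h (x, y)\<bar> \<le> b" using assms by (auto simp: bounded_on_def)
  then have "(\<integral>x. b \<partial>\<mu>) + (\<integral>x. 0 \<partial>\<nu>) \<in> majorant_values h"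
    by (intro majorant_valuesI[OF mu_functions_const[of b] continuous_on_const[of K 0] affine_kernels_zero]) (auto simp: abs_le_iff)
  then show ?thesis by blast
qed

lemma majorant_values_bdd:
  assumes "h \<in> bounded_on (K \<times> K)" shows "bdd_below (majorant_values h)"
proof -
  obtain b where "\<And>x y. x \<in> K \<Longrightarrow> y \<in> K \<Longrightarrow> \<bar>h (x, y)\<bar> \<le> b" using assms by (auto simp: bounded_on_def)
  then have "- b \<le> h (x, y)" if "x \<in> K" "y \<in> K" for x y using that by (fastforce simp: abs_le_iff)
  then show ?thesis by (intro bdd_belowI[of _ "- b * measure \<mu> K"] majorant_values_lower)
qed

lemma sublinear_majorant: "sublinear_on (bounded_on (K \<times> K)) (\<lambda>h. majorant_inf h)"
proof (rule sublinear_onI[OF function_space_bounded])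
  fix h h' assume h: "h \<in> bounded_on (K \<times> K)" and h': "h' \<in> bounded_on (K \<times> K)"
  show "majorant_inf (\<lambda>z. h z + h' z) \<le> majorant_inf h + majorant_inf h'"
  proof (rule field_le_epsilon)
    fix e :: real assume "0 < e"
    then obtain r r' where r: "r \<in> majorant_values h" "r < majorant_inf h + e / 2"
      and r': "r' \<in> majorant_values h'" "r' < majorant_inf h' + e / 2"
      using cInf_less_iff[OF majorant_values_nonempty[OF h] majorant_values_bdd[OF h], of "majorant_inf h + e / 2"]
        cInf_less_iff[OF majorant_values_nonempty[OF h'] majorant_values_bdd[OF h'], of "majorant_inf h' + e / 2"]
      by auto
    have "r + r' \<in> majorant_values (\<lambda>z. h z + h' z)"
      using r(1)
    proof (rule majorant_valuesE)
      fix g f d assume *: "g \<in> mu_functions" "continuous_on K f" "d \<in> affine_kernels K"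
        "\<And>x y. x \<in> K \<Longrightarrow> y \<in> K \<Longrightarrow> h (x, y) \<le> g x + f y + d (x, y)"
        "r = (\<integral>x. g x \<partial>\<mu>) + (\<integral>x. f x \<partial>\<nu>)"
      show ?thesis
        using r'(1)
      proof (rule majorant_valuesE)
        fix g' f' d' assume **: "g' \<in> mu_functions" "continuous_on K f'" "d' \<in> affine_kernels K"
          "\<And>x y. x \<in> K \<Longrightarrow> y \<in> K \<Longrightarrow> h' (x, y) \<le> g' x + f' y + d' (x, y)"
          "r' = (\<integral>x. g' x \<partial>\<mu>) + (\<integral>x. f' x \<partial>\<nu>)"
        show ?thesis
        proof (rule majorant_valuesI)
          show "(\<lambda>x. g x + g' x) \<in> mu_functions" using * ** by (intro mu_functions_add)
          show "continuous_on K (\<lambda>x. f x + f' x)" using * ** by (intro continuous_intros)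
          show "(\<lambda>z. d z + d' z) \<in> affine_kernels K" using * ** by (intro affine_kernels_add)
          show "h (x, y) + h' (x, y) \<le> (g x + g' x) + (f y + f' y) + (d (x, y) + d' (x, y))"
            if "x \<in> K" "y \<in> K" for x y using *(4)[OF that] **(4)[OF that] by linarith
          show "r + r' = (\<integral>x. g x + g' x \<partial>\<mu>) + (\<integral>x. f x + f' x \<partial>\<nu>)"
            using * ** by (simp add: integrable_mu_functions integrable_nu)
        qed
      qed
    qed
    then have "majorant_inf (\<lambda>z. h z + h' z) \<le> r + r'"
      by (intro cInf_lower majorant_values_bdd bounded_on_add h h')
    then show "majorant_inf (\<lambda>z. h z + h' z) \<le> majorant_inf h + majorant_inf h' + e"
      using r(2) r'(2) by simp
  qed
next
  fix h and c :: real assume h: "h \<in> bounded_on (K \<times> K)" and c: "0 < c"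
  have "majorant_inf (\<lambda>z. c * h z) / c \<le> r" if r: "r \<in> majorant_values h" for r
    using r
  proof (rule majorant_valuesE)
    fix g f d assume *: "g \<in> mu_functions" "continuous_on K f" "d \<in> affine_kernels K"
      "\<And>x y. x \<in> K \<Longrightarrow> y \<in> K \<Longrightarrow> h (x, y) \<le> g x + f y + d (x, y)"
      "r = (\<integral>x. g x \<partial>\<mu>) + (\<integral>x. f x \<partial>\<nu>)"
    have "c * r \<in> majorant_values (\<lambda>z. c * h z)"
    proof (rule majorant_valuesI)
      show "(\<lambda>x. c * g x) \<in> mu_functions" using * by (intro mu_functions_mult mu_functions_const)
      show "continuous_on K (\<lambda>x. c * f x)" using * by (intro continuous_intros)
      show "(\<lambda>z. c * d z) \<in> affine_kernels K" using * by (intro affine_kernels_scale)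
      show "c * h (x, y) \<le> c * g x + c * f y + c * d (x, y)" if "x \<in> K" "y \<in> K" for x y
        using mult_left_mono[OF *(4)[OF that], of c] c by (simp add: algebra_simps)
      show "c * r = (\<integral>x. c * g x \<partial>\<mu>) + (\<integral>x. c * f x \<partial>\<nu>)" by (simp add: *(5) algebra_simps)
    qed
    then have "majorant_inf (\<lambda>z. c * h z) \<le> c * r"
      by (intro cInf_lower majorant_values_bdd bounded_on_mult bounded_on_const h)
    then show ?thesis using c by (simp add: field_simps)
  qed
  then have "majorant_inf (\<lambda>z. c * h z) / c \<le> majorant_inf h"
    by (intro cInf_greatest majorant_values_nonempty h)
  then show "majorant_inf (\<lambda>z. c * h z) \<le> c * majorant_inf h"
    using c by (simp add: field_simps)
next
  have "(\<integral>x. 0 \<partial>\<mu>) + (\<integral>x. 0 \<partial>\<nu>) \<in> majorant_values (\<lambda>_. 0)"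
    by (intro majorant_valuesI[OF mu_functions_const[of 0] continuous_on_const[of K 0] affine_kernels_zero]) auto
  then have "majorant_inf (\<lambda>_. 0) \<le> 0"
    using cInf_lower[OF _ majorant_values_bdd[OF bounded_on_const]] by force
  moreover have "0 \<le> r" if "r \<in> majorant_values (\<lambda>_. 0)" for r
    using majorant_values_lower[of 0, OF _ that] by simp
  then have "0 \<le> majorant_inf (\<lambda>_. 0)"
    by (intro cInf_greatest majorant_values_nonempty bounded_on_const)
  ultimately show "majorant_inf (\<lambda>_. 0) = 0" by simp
qed

text \<open>If \<open>h = g(x) + f(y) + d(x, y)\<close>, then both \<open>h\<close> and \<open>- h\<close> have the obvious majorants, and so a
  functional below the sublinear one takes the expected value at \<open>h\<close>.\<close>
theorem coupling_functional:
  obtains \<Lambda> where "linear_functional_on (bounded_on (K \<times> K)) \<Lambda>"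
    and "\<And>h. h \<in> bounded_on (K \<times> K) \<Longrightarrow> (\<And>x y. x \<in> K \<Longrightarrow> y \<in> K \<Longrightarrow> 0 \<le> h (x, y)) \<Longrightarrow> 0 \<le> \<Lambda> h"
    and "\<And>g. g \<in> mu_functions \<Longrightarrow> \<Lambda> (\<lambda>(x, y). g x) = (\<integral>x. g x \<partial>\<mu>)"
    and "\<And>f. continuous_on K f \<Longrightarrow> \<Lambda> (\<lambda>(x, y). f y) = (\<integral>x. f x \<partial>\<nu>)"
    and "\<And>d. d \<in> affine_kernels K \<Longrightarrow> \<Lambda> d = 0"
proof -
  let ?B = "bounded_on (K \<times> K)"
  obtain \<Lambda> where lin: "linear_functional_on ?B \<Lambda>"
    and dom: "\<And>h. h \<in> ?B \<Longrightarrow> \<Lambda> h \<le> majorant_inf h"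
    using sublinear_dominates_linear[OF function_space_bounded sublinear_majorant] by blast
  have neg: "\<Lambda> (\<lambda>z. - h z) = - \<Lambda> h" if "h \<in> ?B" for h
    using lin that unfolding linear_functional_on_def by (metis (no_types, lifting) ext mult_minus1)
  have le: "\<Lambda> h \<le> (\<integral>x. g x \<partial>\<mu>) + (\<integral>x. f x \<partial>\<nu>)"
    if "h \<in> ?B" "g \<in> mu_functions" "continuous_on K f" "d \<in> affine_kernels K"
      "\<And>x y. x \<in> K \<Longrightarrow> y \<in> K \<Longrightarrow> h (x, y) \<le> g x + f y + d (x, y)" for h g f d
    using dom[OF that(1)] cInf_lower[OF majorant_valuesI[OF that(2-5) refl] majorant_values_bdd[OF that(1)]]
    by simp
  have eq: "\<Lambda> h = (\<integral>x. g x \<partial>\<mu>) + (\<integral>x. f x \<partial>\<nu>)"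
    if h: "h \<in> ?B" and g: "g \<in> mu_functions" and f: "continuous_on K f" and d: "d \<in> affine_kernels K"
      and h_eq: "\<And>x y. x \<in> K \<Longrightarrow> y \<in> K \<Longrightarrow> h (x, y) = g x + f y + d (x, y)" for h g f d
  proof (rule order_antisym)
    show "\<Lambda> h \<le> (\<integral>x. g x \<partial>\<mu>) + (\<integral>x. f x \<partial>\<nu>)" using h_eq by (intro le[OF h g f d]) simp
    have "\<Lambda> (\<lambda>z. - h z) \<le> (\<integral>x. -1 * g x \<partial>\<mu>) + (\<integral>x. -1 * f x \<partial>\<nu>)"
    proof (rule le)
      show "(\<lambda>z. - h z) \<in> ?B" by (rule function_spaceD(4)[OF function_space_bounded h])
      show "(\<lambda>x. -1 * g x) \<in> mu_functions" by (intro mu_functions_mult mu_functions_const g)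
      show "continuous_on K (\<lambda>x. -1 * f x)" by (intro continuous_intros f)
      show "(\<lambda>z. -1 * d z) \<in> affine_kernels K" by (rule affine_kernels_scale[OF d])
    qed (use h_eq in simp)
    then show "(\<integral>x. g x \<partial>\<mu>) + (\<integral>x. f x \<partial>\<nu>) \<le> \<Lambda> h" using neg[OF h] by simp
  qed
  have zero: "continuous_on K (\<lambda>_. 0::real)" by simp
  show ?thesis
  proof (rule that[OF lin])
    fix h assume h: "h \<in> ?B" and nonneg: "\<And>x y. x \<in> K \<Longrightarrow> y \<in> K \<Longrightarrow> 0 \<le> h (x, y)"
    have "\<Lambda> (\<lambda>z. - h z) \<le> (\<integral>x. 0 \<partial>\<mu>) + (\<integral>x. 0 \<partial>\<nu>)"
      using nonneg by (intro le[OF function_spaceD(4)[OF function_space_bounded h] mu_functions_const zero affine_kernels_zero]) simp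
    then show "0 \<le> \<Lambda> h" using neg[OF h] by simp
  next
    fix g assume g: "g \<in> mu_functions"
    then have "(\<lambda>(x, y). g x) \<in> ?B" by (auto simp: mu_functions_def bounded_on_def)
    from eq[OF this g zero affine_kernels_zero] show "\<Lambda> (\<lambda>(x, y). g x) = (\<integral>x. g x \<partial>\<mu>)" by simp
  next
    fix f :: "'a \<Rightarrow> real" assume f: "continuous_on K f"
    then have "(\<lambda>(x, y). f y) \<in> ?B"
      using bounded_continuous[OF compact_K f] by (auto simp: bounded_on_def)
    from eq[OF this mu_functions_const[of 0] f affine_kernels_zero] show "\<Lambda> (\<lambda>(x, y). f y) = (\<integral>x. f x \<partial>\<nu>)" by simp
  next
    fix d assume d: "d \<in> affine_kernels K"
    then have "d \<in> ?B" by (simp add: affine_kernels_def)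
    from eq[OF this mu_functions_const[of 0] zero d] show "\<Lambda> d = 0" by simp
  qed
qed

end

section \<open>The conditional operator\<close>

text \<open>The bound by a multiple of \<open>M\<close> makes the additive set function continuous at the empty set, hence
  countably additive, and absolutely continuous.\<close>
lemma (in finite_measure) bounded_additive_density:
  fixes \<phi> :: "'a set \<Rightarrow> real"
  assumes add: "\<And>A B. A \<in> sets M \<Longrightarrow> B \<in> sets M \<Longrightarrow> A \<inter> B = {} \<Longrightarrow> \<phi> (A \<union> B) = \<phi> A + \<phi> B"
    and nonneg: "\<And>A. A \<in> sets M \<Longrightarrow> 0 \<le> \<phi> A"
    and bound: "\<And>A. A \<in> sets M \<Longrightarrow> \<phi> A \<le> C * measure M A"
  obtains D where "integrable M D" "\<And>A. A \<in> sets M \<Longrightarrow> (\<integral>x\<in>A. D x \<partial>M) = \<phi> A"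
proof -
  define N where "N = measure_of (space M) (sets M) (\<lambda>A. ennreal (\<phi> A))"
  have sets_N: "sets N = sets M" by (simp add: N_def)
  have empty: "\<phi> {} = 0" using add[of "{}" "{}"] by simp
  have "positive (sets M) (\<lambda>A. ennreal (\<phi> A))" by (simp add: positive_def empty)
  moreover have "countably_additive (sets M) (\<lambda>A. ennreal (\<phi> A))"
  proof (rule sets.empty_continuous_imp_countably_additive)
    show "positive (sets M) (\<lambda>A. ennreal (\<phi> A))" by fact
    show "additive (sets M) (\<lambda>A. ennreal (\<phi> A))"
      unfolding additive_def using add nonneg by simp
    fix A :: "nat \<Rightarrow> 'a set" assume A: "range A \<subseteq> sets M" "decseq A" "(\<Inter>i. A i) = {}"
    have AM: "A i \<in> sets M" for i using A(1) by blast
    have "(\<lambda>i. measure M (A i)) \<longlonglongrightarrow> 0"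
      using finite_Lim_measure_decseq[OF A(1,2)] A(3) by simp
    then have "(\<lambda>i. C * measure M (A i)) \<longlonglongrightarrow> C * 0" by (intro tendsto_intros)
    then have "(\<lambda>i. \<phi> (A i)) \<longlonglongrightarrow> 0"
      by (intro tendsto_sandwich[OF _ _ tendsto_const, of 0 "\<lambda>i. \<phi> (A i)" sequentially "\<lambda>i. C * measure M (A i)"])
        (simp_all add: nonneg bound AM)
    then show "(\<lambda>i. ennreal (\<phi> (A i))) \<longlonglongrightarrow> 0" using tendsto_ennrealI by fastforce
  qed simp
  ultimately have em: "emeasure N A = ennreal (\<phi> A)" if "A \<in> sets M" for A
    unfolding N_def by (intro emeasure_measure_of_sigma sets.sigma_algebra_axioms that)
  have "finite_measure N"
    by (rule finite_measureI) (simp add: em sets_eq_imp_space_eq[OF sets_N])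
  moreover have "absolutely_continuous M N"
    unfolding absolutely_continuous_def
  proof
    fix A assume "A \<in> null_sets M"
    then have A: "A \<in> sets M" "measure M A = 0" by (auto simp: measure_eq_0_null_sets)
    then have "\<phi> A = 0" using bound[of A] nonneg[of A] by simp
    then show "A \<in> null_sets N" using A by (simp add: null_sets_def sets_N em)
  qed
  ultimately obtain D where D: "D \<in> borel_measurable M" "AE x in M. RN_deriv M N x = ennreal (D x)" "\<And>x. 0 \<le> D x"
    using real_RN_deriv[of N] sets_N by metis
  have "density M (RN_deriv M N) = N"
    by (rule density_RN_deriv) fact+
  then have DN: "density M (\<lambda>x. ennreal (D x)) = N"
    using density_cong[of "RN_deriv M N" M "\<lambda>x. ennreal (D x)"] D by simp
  have nn: "(\<integral>\<^sup>+x. ennreal (indicator A x *\<^sub>R D x) \<partial>M) = ennreal (\<phi> A)" if A: "A \<in> sets M" for A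
  proof -
    have "ennreal (\<phi> A) = emeasure (density M (\<lambda>x. ennreal (D x))) A" using em[OF A] DN by simp
    also have "\<dots> = (\<integral>\<^sup>+x. ennreal (D x) * indicator A x \<partial>M)" using D A by (intro emeasure_density) auto
    also have "\<dots> = (\<integral>\<^sup>+x. ennreal (indicator A x *\<^sub>R D x) \<partial>M)"
      by (intro nn_integral_cong) (simp add: indicator_def)
    finally show ?thesis by simp
  qed
  show ?thesis
  proof (rule that)
    have "(\<integral>\<^sup>+x. ennreal (D x) \<partial>M) = ennreal (\<phi> (space M))"
      using nn[OF sets.top] by (simp cong: nn_integral_cong)
    then show "integrable M D" using D by (intro integrableI_nonneg) auto
    show "(\<integral>x\<in>A. D x \<partial>M) = \<phi> A" if A: "A \<in> sets M" for A
      unfolding set_lebesgue_integral_def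
      by (rule integral_eq_nn_integral[THEN trans]) (use D A nn[OF A] nonneg[OF A] in auto)
  qed
qed

lemma (in finite_measure) AE_nonneg_of_set_integrals:
  fixes D :: "'a \<Rightarrow> real"
  assumes D: "integrable M D" and nonneg: "\<And>A. A \<in> sets M \<Longrightarrow> 0 \<le> (\<integral>x\<in>A. D x \<partial>M)"
  shows "AE x in M. 0 \<le> D x"
proof -
  have Dm: "D \<in> borel_measurable M" using D by auto
  define A where "A = {x\<in>space M. D x < 0}"
  have A: "A \<in> sets M" using Dm unfolding A_def by measurable
  have "(\<integral>x. - (indicator A x *\<^sub>R D x) \<partial>M) \<le> 0"
    using nonneg[OF A] by (simp add: set_lebesgue_integral_def)
  moreover have int: "integrable M (\<lambda>x. - (indicator A x *\<^sub>R D x))"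
    using integrable_mult_indicator[OF A D] by simp
  moreover have pos: "0 \<le> - (indicator A x *\<^sub>R D x)" for x by (simp add: A_def indicator_def)
  ultimately have "(\<integral>x. - (indicator A x *\<^sub>R D x) \<partial>M) = 0"
    by (intro order_antisym Bochner_Integration.integral_nonneg)
  then have "AE x in M. - (indicator A x *\<^sub>R D x) = 0"
    using integral_nonneg_eq_0_iff_AE[OF int] pos by simp
  then show ?thesis using AE_space
    by eventually_elim (auto simp: A_def indicator_def not_less split: if_splits)
qed

context choquet_pair
begin

text \<open>A version of the conditional expectation of \<open>f(y)\<close> given \<open>x\<close> under the coupling. The null set of
  each identity depends on the functions in it.\<close>
definition cond_operator :: "(('a \<Rightarrow> real) \<Rightarrow> 'a \<Rightarrow> real) \<Rightarrow> bool" where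
  "cond_operator T \<longleftrightarrow>
     (\<forall>f. continuous_on K f \<longrightarrow> integrable \<mu> (T f) \<and> (\<integral>x. T f x \<partial>\<mu>) = (\<integral>x. f x \<partial>\<nu>)) \<and>
     (\<forall>f g. continuous_on K f \<longrightarrow> continuous_on K g \<longrightarrow> (AE x in \<mu>. T (\<lambda>y. f y + g y) x = T f x + T g x)) \<and>
     (\<forall>f c. continuous_on K f \<longrightarrow> (AE x in \<mu>. T (\<lambda>y. c * f y) x = c * T f x)) \<and>
     (\<forall>f. continuous_on K f \<longrightarrow> (\<forall>x\<in>K. 0 \<le> f x) \<longrightarrow> (AE x in \<mu>. 0 \<le> T f x)) \<and>
     (\<forall>a. continuous_on K a \<longrightarrow> affine_map_on K a \<longrightarrow> (AE x in \<mu>. T a x = a x))"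

text \<open>Each property of \<open>T\<close> is read off from the integrals over measurable sets \<open>E\<close>, which are the
  values of \<open>\<Lambda>\<close> at \<open>1_E(x) f(y)\<close>. For affine \<open>a\<close> this function differs from \<open>1_E(x) a(x)\<close> by an
  affine kernel.\<close>
lemma cond_operator_exists: "\<exists>T. cond_operator T"
proof -
  interpret mu: finite_measure \<mu> by (rule finite_mu)
  obtain \<Lambda> where lin: "linear_functional_on (bounded_on (K \<times> K)) \<Lambda>"
    and pos: "\<And>h. h \<in> bounded_on (K \<times> K) \<Longrightarrow> (\<And>x y. x \<in> K \<Longrightarrow> y \<in> K \<Longrightarrow> 0 \<le> h (x, y)) \<Longrightarrow> 0 \<le> \<Lambda> h"
    and first: "\<And>g. g \<in> mu_functions \<Longrightarrow> \<Lambda> (\<lambda>(x, y). g x) = (\<integral>x. g x \<partial>\<mu>)"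
    and second: "\<And>f. continuous_on K f \<Longrightarrow> \<Lambda> (\<lambda>(x, y). f y) = (\<integral>x. f x \<partial>\<nu>)"
    and kernel: "\<And>d. d \<in> affine_kernels K \<Longrightarrow> \<Lambda> d = 0"
    by (rule coupling_functional) blast
  let ?B = "bounded_on (K \<times> K)"
  define tens :: "('a \<Rightarrow> real) \<Rightarrow> ('a \<Rightarrow> real) \<Rightarrow> 'a \<times> 'a \<Rightarrow> real" where "tens g f = (\<lambda>(x, y). g x * f y)" for g f
  have tens_B: "tens g f \<in> ?B" if "g \<in> mu_functions" "continuous_on K f" for g f
  proof -
    have "g \<in> bounded_on K" "f \<in> bounded_on K"
      using that bounded_continuous[OF compact_K] by (auto simp: mu_functions_def)
    then have "(\<lambda>z. g (fst z)) \<in> ?B" "(\<lambda>z. f (snd z)) \<in> ?B" by (auto simp: bounded_on_def)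
    from bounded_on_mult[OF this] show ?thesis by (simp add: tens_def case_prod_unfold)
  qed
  have \<Lambda>_add: "\<Lambda> (\<lambda>z. h z + k z) = \<Lambda> h + \<Lambda> k" if "h \<in> ?B" "k \<in> ?B" for h k
    using lin that by (simp add: linear_functional_on_def)
  have \<Lambda>_scale: "\<Lambda> (\<lambda>z. c * h z) = c * \<Lambda> h" if "h \<in> ?B" for h c
    using lin that by (simp add: linear_functional_on_def)
  have ind: "indicator E \<in> mu_functions" if "E \<in> sets \<mu>" for E
    using that by (auto simp: mu_functions_def indicator_def intro!: bounded_onI[of _ _ 1])
  have fst_tens: "\<Lambda> (tens g (\<lambda>_. c)) = c * (\<integral>x. g x \<partial>\<mu>)" if "g \<in> mu_functions" for g c
    using first[OF mu_functions_mult[OF that mu_functions_const[of c]]] by (simp add: tens_def)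
  have dens: "\<exists>D. integrable \<mu> D \<and> (\<forall>E\<in>sets \<mu>. (\<integral>x\<in>E. D x \<partial>\<mu>) = \<Lambda> (tens (indicator E) f))"
    if f: "continuous_on K f" for f
  proof -
    obtain b where b: "0 \<le> b" "\<And>x. x \<in> K \<Longrightarrow> \<bar>f x\<bar> \<le> b"
      using bounded_continuous[OF compact_K f] by (rule bounded_onE) blast
    \<comment> \<open>adding \<open>b\<close> makes the set function nonnegative\<close>
    have fb: "continuous_on K (\<lambda>x. f x + b)" by (intro continuous_intros f)
    define \<phi> where "\<phi> E = \<Lambda> (tens (indicator E) (\<lambda>x. f x + b))" for E
    have split: "\<phi> E = \<Lambda> (tens (indicator E) f) + b * measure \<mu> E" if E: "E \<in> sets \<mu>" for E
    proof -
      have "\<phi> E = \<Lambda> (\<lambda>z. tens (indicator E) f z + tens (indicator E) (\<lambda>_. b) z)"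
        by (simp add: \<phi>_def tens_def case_prod_unfold algebra_simps)
      also have "\<dots> = \<Lambda> (tens (indicator E) f) + \<Lambda> (tens (indicator E) (\<lambda>_. b))"
        by (intro \<Lambda>_add tens_B ind E f continuous_on_const)
      also have "\<Lambda> (tens (indicator E) (\<lambda>_. b)) = b * measure \<mu> E"
        using fst_tens[OF ind[OF E]] E sets.sets_into_space[OF E] by (simp add: Int_absorb2)
      finally show ?thesis .
    qed
    obtain D where D: "integrable \<mu> D" "\<And>E. E \<in> sets \<mu> \<Longrightarrow> (\<integral>x\<in>E. D x \<partial>\<mu>) = \<phi> E"
    proof (rule mu.bounded_additive_density[of \<phi> "2 * b"])
      fix A B assume AB: "A \<in> sets \<mu>" "B \<in> sets \<mu>" "A \<inter> B = {}"
      have "\<phi> (A \<union> B) = \<Lambda> (\<lambda>z. tens (indicator A) (\<lambda>x. f x + b) z + tens (indicator B) (\<lambda>x. f x + b) z)"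
        using AB(3) unfolding \<phi>_def by (intro arg_cong[of _ _ \<Lambda>] ext) (auto simp: tens_def indicator_def)
      also have "\<dots> = \<phi> A + \<phi> B" unfolding \<phi>_def by (intro \<Lambda>_add tens_B ind AB fb)
      finally show "\<phi> (A \<union> B) = \<phi> A + \<phi> B" .
    next
      fix A assume A: "A \<in> sets \<mu>"
      show "0 \<le> \<phi> A"
        unfolding \<phi>_def
      proof (rule pos[OF tens_B[OF ind[OF A] fb]])
        fix x y assume "y \<in> K"
        then show "0 \<le> tens (indicator A) (\<lambda>x. f x + b) (x, y)"
          using b(2)[of y] by (auto simp: tens_def indicator_def abs_le_iff)
      qed
      have "0 \<le> \<Lambda> (\<lambda>z. tens (indicator A) (\<lambda>_. 2 * b) z + - 1 * tens (indicator A) (\<lambda>x. f x + b) z)"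
      proof (rule pos)
        show "(\<lambda>z. tens (indicator A) (\<lambda>_. 2 * b) z + - 1 * tens (indicator A) (\<lambda>x. f x + b) z) \<in> ?B"
          by (intro bounded_on_add bounded_on_mult bounded_on_const tens_B ind A fb continuous_on_const)
        fix x y assume "y \<in> K"
        then show "0 \<le> tens (indicator A) (\<lambda>_. 2 * b) (x, y) + - 1 * tens (indicator A) (\<lambda>x. f x + b) (x, y)"
          using b(2)[of y] by (auto simp: tens_def indicator_def abs_le_iff)
      qed
      also have "\<dots> = \<Lambda> (tens (indicator A) (\<lambda>_. 2 * b)) + \<Lambda> (\<lambda>z. - 1 * tens (indicator A) (\<lambda>x. f x + b) z)"
        by (intro \<Lambda>_add bounded_on_mult bounded_on_const tens_B ind A fb continuous_on_const)
      also have "\<Lambda> (\<lambda>z. - 1 * tens (indicator A) (\<lambda>x. f x + b) z) = -1 * \<phi> A"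
        unfolding \<phi>_def by (intro \<Lambda>_scale tens_B ind A fb)
      also have "\<Lambda> (tens (indicator A) (\<lambda>_. 2 * b)) = 2 * b * measure \<mu> A"
        using fst_tens[OF ind[OF A]] A sets.sets_into_space[OF A] by (simp add: Int_absorb2)
      finally show "\<phi> A \<le> 2 * b * measure \<mu> A" by simp
    qed blast
    have "(\<integral>x\<in>E. (D x - b) \<partial>\<mu>) = \<Lambda> (tens (indicator E) f)" if E: "E \<in> sets \<mu>" for E
    proof -
      have "(\<integral>x\<in>E. (D x - b) \<partial>\<mu>) = (\<integral>x\<in>E. D x \<partial>\<mu>) - (\<integral>x\<in>E. b \<partial>\<mu>)"
        using integrable_mult_indicator[OF E D(1)] integrable_mult_indicator[OF E mu.integrable_const[of b]]
        by (intro set_integral_diff) (simp_all add: set_integrable_def)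
      also have "(\<integral>x\<in>E. b \<partial>\<mu>) = b * measure \<mu> E"
        using E sets.sets_into_space[OF E] by (simp add: set_lebesgue_integral_def Int_absorb2)
      finally show ?thesis using D(2)[OF E] split[OF E] by simp
    qed
    moreover have "integrable \<mu> (\<lambda>x. D x - b)" using D(1) by simp
    ultimately show ?thesis by (intro exI[of _ "\<lambda>x. D x - b"]) simp
  qed
  define T where "T f = (SOME D. integrable \<mu> D \<and> (\<forall>E\<in>sets \<mu>. (\<integral>x\<in>E. D x \<partial>\<mu>) = \<Lambda> (tens (indicator E) f)))" for f
  have T_int: "integrable \<mu> (T f)"
    and T_set: "\<And>E. E \<in> sets \<mu> \<Longrightarrow> (\<integral>x\<in>E. T f x \<partial>\<mu>) = \<Lambda> (tens (indicator E) f)"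
    if "continuous_on K f" for f
    using someI_ex[OF dens[OF that]] unfolding T_def by blast+
  have set_int: "set_integrable \<mu> E D" if "integrable \<mu> D" "E \<in> sets \<mu>" for E and D :: "'a \<Rightarrow> real"
    using integrable_mult_indicator[OF that(2,1)] by (simp add: set_integrable_def)
  have "cond_operator T"
    unfolding cond_operator_def
  proof (intro conjI allI impI)
    fix f :: "'a \<Rightarrow> real" assume f: "continuous_on K f"
    show "integrable \<mu> (T f)" by (rule T_int[OF f])
    have "(\<integral>x. T f x \<partial>\<mu>) = (\<integral>x\<in>space \<mu>. T f x \<partial>\<mu>)"
      unfolding set_lebesgue_integral_def by (intro Bochner_Integration.integral_cong) auto
    also have "\<dots> = \<Lambda> (tens (indicator (space \<mu>)) f)" by (rule T_set[OF f]) simp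
    also have "\<dots> = \<Lambda> (\<lambda>(x, y). f y)"
    proof -
      \<comment> \<open>\<open>\<Lambda>\<close> depends only on the values on \<open>K \<times> K\<close>, where the two functions agree\<close>
      let ?h = "\<lambda>z. tens (indicator (space \<mu>)) f z + - 1 * (case z of (x, y) \<Rightarrow> f y)"
      have B2: "(\<lambda>(x, y). f y) \<in> ?B"
        using bounded_continuous[OF compact_K f] by (auto simp: bounded_on_def)
      have B1: "tens (indicator (space \<mu>)) f \<in> ?B" by (intro tens_B ind f) simp
      have hB: "?h \<in> ?B" by (intro bounded_on_add bounded_on_mult bounded_on_const B1 B2)
      have h0: "?h (x, y) = 0" if "x \<in> K" for x y using that by (simp add: tens_def space_mu)
      have "0 \<le> \<Lambda> ?h" using h0 by (intro pos[OF hB]) simp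
      moreover have "0 \<le> \<Lambda> (\<lambda>z. - 1 * ?h z)" 
        using h0 by (intro pos bounded_on_mult[OF bounded_on_const hB]) simp
      ultimately have "\<Lambda> ?h = 0" using \<Lambda>_scale[OF hB, of "- 1"] by simp
      moreover have "\<Lambda> ?h = \<Lambda> (tens (indicator (space \<mu>)) f) + - 1 * \<Lambda> (\<lambda>(x, y). f y)"
        using \<Lambda>_add[OF B1 bounded_on_mult[OF bounded_on_const B2], of "- 1"] \<Lambda>_scale[OF B2, of "- 1"] by simp
      ultimately show ?thesis by simp
    qed
    also have "\<dots> = (\<integral>x. f x \<partial>\<nu>)" by (rule second[OF f])
    finally show "(\<integral>x. T f x \<partial>\<mu>) = (\<integral>x. f x \<partial>\<nu>)" .
  next
    fix f g :: "'a \<Rightarrow> real" assume f: "continuous_on K f" and g: "continuous_on K g"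
    have fg: "continuous_on K (\<lambda>y. f y + g y)" by (intro continuous_intros f g)
    show "AE x in \<mu>. T (\<lambda>y. f y + g y) x = T f x + T g x"
    proof (rule density_unique_real)
      fix E assume E: "E \<in> sets \<mu>"
      have "(\<integral>x\<in>E. T (\<lambda>y. f y + g y) x \<partial>\<mu>) = \<Lambda> (\<lambda>z. tens (indicator E) f z + tens (indicator E) g z)"
        unfolding T_set[OF fg E] by (intro arg_cong[of _ _ \<Lambda>] ext) (auto simp: tens_def algebra_simps)
      also have "\<dots> = \<Lambda> (tens (indicator E) f) + \<Lambda> (tens (indicator E) g)" by (intro \<Lambda>_add tens_B ind E f g)
      also have "\<dots> = (\<integral>x\<in>E. T f x \<partial>\<mu>) + (\<integral>x\<in>E. T g x \<partial>\<mu>)" by (simp add: T_set f g E)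
      also have "\<dots> = (\<integral>x\<in>E. T f x + T g x \<partial>\<mu>)" by (intro set_integral_add(2)[symmetric] set_int T_int f g E)
      finally show "(\<integral>x\<in>E. T (\<lambda>y. f y + g y) x \<partial>\<mu>) = (\<integral>x\<in>E. T f x + T g x \<partial>\<mu>)" .
    qed (use T_int[OF f] T_int[OF g] T_int[OF fg] in auto)
  next
    fix f :: "'a \<Rightarrow> real" and c assume f: "continuous_on K f"
    have cf: "continuous_on K (\<lambda>y. c * f y)" by (intro continuous_intros f)
    show "AE x in \<mu>. T (\<lambda>y. c * f y) x = c * T f x"
    proof (rule density_unique_real)
      fix E assume E: "E \<in> sets \<mu>"
      have "(\<integral>x\<in>E. T (\<lambda>y. c * f y) x \<partial>\<mu>) = \<Lambda> (\<lambda>z. c * tens (indicator E) f z)"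
        unfolding T_set[OF cf E] by (intro arg_cong[of _ _ \<Lambda>] ext) (auto simp: tens_def algebra_simps)
      also have "\<dots> = c * \<Lambda> (tens (indicator E) f)" by (intro \<Lambda>_scale tens_B ind E f)
      also have "\<dots> = (\<integral>x\<in>E. c * T f x \<partial>\<mu>)" by (simp add: T_set f E)
      finally show "(\<integral>x\<in>E. T (\<lambda>y. c * f y) x \<partial>\<mu>) = (\<integral>x\<in>E. c * T f x \<partial>\<mu>)" .
    qed (use T_int[OF f] T_int[OF cf] in auto)
  next
    fix f :: "'a \<Rightarrow> real" assume f: "continuous_on K f" and nonneg: "\<forall>x\<in>K. 0 \<le> f x"
    show "AE x in \<mu>. 0 \<le> T f x"
    proof (rule mu.AE_nonneg_of_set_integrals[OF T_int[OF f]])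
      fix E assume E: "E \<in> sets \<mu>"
      show "0 \<le> (\<integral>x\<in>E. T f x \<partial>\<mu>)"
        unfolding T_set[OF f E] using nonneg
        by (intro pos tens_B ind E f) (simp add: tens_def indicator_def)
    qed
  next
    fix a :: "'a \<Rightarrow> real" assume a: "continuous_on K a" "affine_map_on K a"
    note a_mu = continuous_mu_functions[OF a(1)]
    show "AE x in \<mu>. T a x = a x"
    proof (rule density_unique_real[OF T_int[OF a(1)] integrable_mu_functions[OF a_mu]])
      fix E assume E: "E \<in> sets \<mu>"
      let ?d = "\<lambda>(x, y). indicator E x * (a y - a x)"
      have d: "?d \<in> affine_kernels K"
        using ind[OF E] by (intro affine_kernelsI[OF compact_K _ a]) (simp add: mu_functions_def)
      have ga: "(\<lambda>x. indicator E x * a x) \<in> mu_functions" by (rule mu_functions_mult[OF ind[OF E] a_mu])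
      have "(\<lambda>(x, y). indicator E x * a x) \<in> ?B" 
        using ga by (auto simp: mu_functions_def bounded_on_def)
      moreover have "?d \<in> ?B" using d by (simp add: affine_kernels_def)
      ultimately have "\<Lambda> (\<lambda>z. (\<lambda>(x, y). indicator E x * a x) z + ?d z) = \<Lambda> (\<lambda>(x, y). indicator E x * a x) + \<Lambda> ?d"
        by (rule \<Lambda>_add)
      also have "(\<lambda>z. (\<lambda>(x, y). indicator E x * a x) z + ?d z) = tens (indicator E) a"
        by (auto simp: tens_def algebra_simps)
      finally have "\<Lambda> (tens (indicator E) a) = (\<integral>x. indicator E x * a x \<partial>\<mu>)"
        using first[OF ga] kernel[OF d] by simp
      then show "(\<integral>x\<in>E. T a x \<partial>\<mu>) = (\<integral>x\<in>E. a x \<partial>\<mu>)"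
        unfolding T_set[OF a(1) E] by (simp add: set_lebesgue_integral_def)
    qed
  qed
  then show ?thesis by blast
qed

end

section \<open>States at the points and their measures\<close>

lemma borel_measurable_completion_AE:
  fixes f g :: "'a \<Rightarrow> 'b::t2_space"
  assumes g: "g \<in> borel_measurable M" and eq: "AE x in M. f x = g x"
  shows "f \<in> borel_measurable (completion M)"
proof (rule measurableI)
  fix A :: "'b set" assume A: "A \<in> sets borel"
  obtain N where N: "N \<in> null_sets M" "{x\<in>space M. f x \<noteq> g x} \<subseteq> N"
    using eq by (rule AE_E) (auto simp: null_sets_def)
  have g': "g -` A \<inter> space M \<in> sets M" using g A by (rule measurable_sets)
  have sub: "S \<in> sets (completion M)" if "S \<subseteq> N" for S
    using null_sets_completion_subset[OF that null_sets_completionI[OF N(1)]] by blast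
  have "f -` A \<inter> space M = (g -` A \<inter> space M - N) \<union> (f -` A \<inter> space M \<inter> N)"
    using N(2) by auto
  moreover have "g -` A \<inter> space M - N \<in> sets (completion M)" using g' N(1) by auto
  moreover have "f -` A \<inter> space M \<inter> N \<in> sets (completion M)" by (rule sub) auto
  ultimately show "f -` A \<inter> space (completion M) \<in> sets (completion M)"
    unfolding space_completion by (metis sets.Un)
qed simp

text \<open>The upper limit of \<open>u\<close> along \<open>F\<close>, as a real number. It has the expected meaning for proper \<open>F\<close>
  and functions \<open>u\<close> that are eventually bounded.\<close>
definition eventual_upper :: "('b \<Rightarrow> real) \<Rightarrow> 'b filter \<Rightarrow> real" where
  "eventual_upper u F = Inf {c. \<forall>\<^sub>F y in F. u y \<le> c}"

lemma eventual_upper_le: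
  assumes "F \<noteq> bot" "\<forall>\<^sub>F y in F. b \<le> u y" "\<forall>\<^sub>F y in F. u y \<le> c"
  shows "eventual_upper u F \<le> c"
  unfolding eventual_upper_def
proof (rule cInf_lower)
  have "b \<le> d" if "\<forall>\<^sub>F y in F. u y \<le> d" for d
  proof -
    have "\<forall>\<^sub>F y in F. b \<le> d" using assms(2) that by eventually_elim simp
    then show ?thesis using assms(1) by simp
  qed
  then show "bdd_below {c. \<forall>\<^sub>F y in F. u y \<le> c}" by (intro bdd_belowI[of _ b]) auto
qed (use assms(3) in simp)

lemma eventual_upper_approx:
  assumes "F \<noteq> bot" "\<forall>\<^sub>F y in F. b \<le> u y" "\<forall>\<^sub>F y in F. u y \<le> b'" "eventual_upper u F < c"
  shows "\<forall>\<^sub>F y in F. u y \<le> c"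
proof -
  have "\<exists>d\<in>{c. \<forall>\<^sub>F y in F. u y \<le> c}. d < c"
  proof (rule ccontr)
    assume "\<not> ?thesis"
    then have "c \<le> eventual_upper u F"
      unfolding eventual_upper_def using assms(3) by (intro cInf_greatest) (auto simp: not_less)
    with assms(4) show False by simp
  qed
  then obtain d where "\<forall>\<^sub>F y in F. u y \<le> d" "d < c" by auto
  then show ?thesis by (auto elim: eventually_mono)
qed

context choquet_pair
begin

lemma cond_operatorD:
  assumes "cond_operator T"
  shows "continuous_on K f \<Longrightarrow> integrable \<mu> (T f)"
    and "continuous_on K f \<Longrightarrow> (\<integral>x. T f x \<partial>\<mu>) = (\<integral>x. f x \<partial>\<nu>)"
    and "continuous_on K f \<Longrightarrow> continuous_on K g \<Longrightarrow> AE x in \<mu>. T (\<lambda>y. f y + g y) x = T f x + T g x"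
    and "continuous_on K f \<Longrightarrow> AE x in \<mu>. T (\<lambda>y. c * f y) x = c * T f x"
    and "continuous_on K f \<Longrightarrow> (\<And>x. x \<in> K \<Longrightarrow> 0 \<le> f x) \<Longrightarrow> AE x in \<mu>. 0 \<le> T f x"
    and "continuous_on K a \<Longrightarrow> affine_map_on K a \<Longrightarrow> AE x in \<mu>. T a x = a x"
  using assms unfolding cond_operator_def by blast+

lemma cond_operator_const:
  assumes "cond_operator T" shows "AE x in \<mu>. T (\<lambda>_. c) x = c"
proof (rule cond_operatorD(6)[OF assms])
  show "affine_map_on K (\<lambda>_. c)" unfolding affine_map_on_def by (simp flip: distrib_right)
qed simp

lemma cond_operator_mono:
  assumes T: "cond_operator T" and f: "continuous_on K f" and g: "continuous_on K g"
    and le: "\<And>x. x \<in> K \<Longrightarrow> f x \<le> g x"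
  shows "AE x in \<mu>. T f x \<le> T g x"
proof -
  have c: "continuous_on K (\<lambda>y. - 1 * f y)" by (intro continuous_intros f)
  have "continuous_on K (\<lambda>y. g y + - 1 * f y)" by (intro continuous_intros f g)
  then have "AE x in \<mu>. 0 \<le> T (\<lambda>y. g y + - 1 * f y) x"
    using le by (intro cond_operatorD(5)[OF T]) simp_all
  with cond_operatorD(3)[OF T g c] cond_operatorD(4)[OF T f, of "- 1"]
  show ?thesis by eventually_elim simp
qed

lemma cond_operator_bound:
  assumes T: "cond_operator T" and f: "continuous_on K f" and b: "\<And>x. x \<in> K \<Longrightarrow> \<bar>f x\<bar> \<le> b"
  shows "AE x in \<mu>. - b \<le> T f x \<and> T f x \<le> b"
proof -
  have "AE x in \<mu>. T f x \<le> T (\<lambda>_. b) x" "AE x in \<mu>. T (\<lambda>_. - b) x \<le> T f x"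
    using b by (intro cond_operator_mono[OF T] f continuous_on_const; force simp: abs_le_iff)+
  with cond_operator_const[OF T, of b] cond_operator_const[OF T, of "- b"]
  show ?thesis by eventually_elim simp
qed

lemma function_space_continuous: "function_space {f :: 'a \<Rightarrow> real. continuous_on K f}"
  by (auto simp: function_space_def intro!: continuous_intros)

definition state_on :: "(('a \<Rightarrow> real) \<Rightarrow> real) \<Rightarrow> bool" where
  "state_on l \<longleftrightarrow> linear_functional_on {f. continuous_on K f} l \<and>
     (\<forall>f. continuous_on K f \<longrightarrow> (\<forall>x\<in>K. 0 \<le> f x) \<longrightarrow> 0 \<le> l f) \<and> l (\<lambda>_. 1) = 1"

text \<open>The functional \<open>p x\<close> is sublinear at every point because all sets of full measure belong to
  \<open>F x\<close>, so that the identities satisfied by \<open>T\<close> almost everywhere hold eventually. For the upper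
  bound \<open>l x f \<le> T f x\<close> one applies the density property of the filters to the countably many sets
  \<open>T f \<le> r\<close> with rational \<open>r\<close>.\<close>
lemma pointwise_states_nonnull:
  assumes T: "cond_operator T" and nz: "emeasure \<mu> (space \<mu>) \<noteq> 0"
  obtains l where "\<And>x. state_on (l x)" "\<And>f. continuous_on K f \<Longrightarrow> AE x in \<mu>. l x f = T f x"
proof -
  interpret mu: finite_measure \<mu> by (rule finite_mu)
  let ?C = "{f :: 'a \<Rightarrow> real. continuous_on K f}"
  obtain F :: "'a \<Rightarrow> 'a filter" where F: "\<And>x. F x \<noteq> bot" "\<And>P x. AE y in \<mu>. P y \<Longrightarrow> eventually P (F x)"
    "\<And>E. E \<in> sets \<mu> \<Longrightarrow> AE x in \<mu>. x \<in> E \<longrightarrow> (\<forall>\<^sub>F y in F x. y \<in> E)"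
    by (rule mu.lifting_filters[OF nz]) blast
  define p where "p x f = eventual_upper (T f) (F x)" for x f
  have bounds: "\<exists>b. (\<forall>\<^sub>F y in F x. - b \<le> T f y) \<and> (\<forall>\<^sub>F y in F x. T f y \<le> b)" if f: "continuous_on K f" for x f
  proof -
    obtain b where "\<And>x. x \<in> K \<Longrightarrow> \<bar>f x\<bar> \<le> b" using bounded_continuous[OF compact_K f] by (auto simp: bounded_on_def)
    from F(2)[OF cond_operator_bound[OF T f this]] show ?thesis
      by (intro exI[of _ b]) (simp add: eventually_conj_iff)
  qed
  have p_le: "p x f \<le> c" if f: "continuous_on K f" and "\<forall>\<^sub>F y in F x. T f y \<le> c" for x f c
    using bounds[OF f, of x] that(2) eventual_upper_le[OF F(1)] unfolding p_def by blast
  have p_approx: "\<forall>\<^sub>F y in F x. T f y \<le> p x f + e" if f: "continuous_on K f" and "0 < e" for x f e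
    using bounds[OF f, of x] eventual_upper_approx[OF F(1), of _ "T f" x _ "p x f + e"] that(2) unfolding p_def by force
  have sub: "sublinear_on ?C (p x)" for x
  proof (rule sublinear_onI[OF function_space_continuous])
    fix f g assume f: "f \<in> ?C" and g: "g \<in> ?C"
    then have fg: "continuous_on K (\<lambda>y. f y + g y)" by (auto intro: continuous_intros)
    show "p x (\<lambda>y. f y + g y) \<le> p x f + p x g"
    proof (rule field_le_epsilon)
      fix e :: real assume "0 < e"
      then have e: "0 < e / 2" by simp
      have "\<forall>\<^sub>F y in F x. T f y \<le> p x f + e / 2" "\<forall>\<^sub>F y in F x. T g y \<le> p x g + e / 2"
        using f g e by (auto intro: p_approx simp del: less_divide_eq_numeral1)
      moreover have "\<forall>\<^sub>F y in F x. T (\<lambda>y. f y + g y) y = T f y + T g y"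
        using f g by (intro F(2) cond_operatorD(3)[OF T]) auto
      ultimately have "\<forall>\<^sub>F y in F x. T (\<lambda>y. f y + g y) y \<le> p x f + p x g + e"
        by eventually_elim simp
      then show "p x (\<lambda>y. f y + g y) \<le> p x f + p x g + e" by (rule p_le[OF fg])
    qed
  next
    fix f and c :: real assume f: "f \<in> ?C" and c: "0 < c"
    then have cf: "continuous_on K (\<lambda>y. c * f y)" by (auto intro: continuous_intros)
    show "p x (\<lambda>y. c * f y) \<le> c * p x f"
    proof (rule field_le_epsilon)
      fix e :: real assume e: "0 < e"
      have "\<forall>\<^sub>F y in F x. T f y \<le> p x f + e / c" using f e c by (intro p_approx) auto
      moreover have "\<forall>\<^sub>F y in F x. T (\<lambda>y. c * f y) y = c * T f y"
        using f by (intro F(2) cond_operatorD(4)[OF T]) auto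
      ultimately have "\<forall>\<^sub>F y in F x. T (\<lambda>y. c * f y) y \<le> c * p x f + e"
      proof eventually_elim
        case (elim y)
        then have "c * T f y \<le> c * (p x f + e / c)" using c by (intro mult_left_mono) auto
        then show ?case using elim(2) c by (simp add: distrib_left)
      qed
      then show "p x (\<lambda>y. c * f y) \<le> c * p x f + e" by (rule p_le[OF cf])
    qed
  next
    have T0: "\<forall>\<^sub>F y in F x. T (\<lambda>_. 0) y = 0" by (intro F(2) cond_operator_const[OF T])
    have "p x (\<lambda>_. 0) \<le> 0" by (rule p_le) (use T0 in \<open>auto elim: eventually_mono\<close>)
    moreover have "0 \<le> p x (\<lambda>_. 0)"
    proof (rule field_le_epsilon)
      fix e :: real assume "0 < e"
      then have "\<forall>\<^sub>F y in F x. T (\<lambda>_. 0) y \<le> p x (\<lambda>_. 0) + e" by (intro p_approx) simp_all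
      with T0 have "\<forall>\<^sub>F y in F x. 0 \<le> p x (\<lambda>_. 0) + e" by eventually_elim simp
      then show "0 \<le> p x (\<lambda>_. 0) + e" using F(1)[of x] by simp
    qed
    ultimately show "p x (\<lambda>_. 0) = 0" by simp
  qed
  have "\<exists>l. linear_functional_on ?C l \<and> (\<forall>f\<in>?C. l f \<le> p x f)" for x
    using sublinear_dominates_linear[OF function_space_continuous sub[of x]] by metis
  then obtain l where lin: "\<And>x. linear_functional_on ?C (l x)" and dom: "\<And>x f. continuous_on K f \<Longrightarrow> l x f \<le> p x f"
    by (metis mem_Collect_eq)
  have neg: "l x (\<lambda>y. - 1 * f y) = - l x f" if "continuous_on K f" for x f
    using lin[of x] that unfolding linear_functional_on_def by (metis mem_Collect_eq mult_minus1)
  show ?thesis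
  proof (rule that)
    fix x
    show "state_on (l x)"
      unfolding state_on_def
    proof (intro conjI allI impI lin)
      fix f :: "'a \<Rightarrow> real" assume f: "continuous_on K f" and nonneg: "\<forall>x\<in>K. 0 \<le> f x"
      have mf: "continuous_on K (\<lambda>y. - 1 * f y)" by (intro continuous_intros f)
      have "AE y in \<mu>. T (\<lambda>y. - 1 * f y) y \<le> T (\<lambda>_. 0) y"
        using nonneg by (intro cond_operator_mono[OF T mf]) auto
      with cond_operator_const[OF T, of 0] have "AE y in \<mu>. T (\<lambda>y. - 1 * f y) y \<le> 0" by eventually_elim simp
      from F(2)[OF this] have "p x (\<lambda>y. - 1 * f y) \<le> 0" by (rule p_le[OF mf])
      then show "0 \<le> l x f" using dom[OF mf, of x] neg[OF f, of x] by simp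
    next
      have "\<forall>\<^sub>F y in F x. T (\<lambda>_. c) y \<le> c" for c
        using F(2)[OF cond_operator_const[OF T, of c], of x] by (auto elim: eventually_mono)
      then have *: "l x (\<lambda>_. c) \<le> c" for c by (intro order_trans[OF dom p_le]) simp_all
      show "l x (\<lambda>_. 1) = 1" using *[of 1] *[of "- 1"] neg[of "\<lambda>_. 1" x] by simp
    qed
  next
    fix f :: "'a \<Rightarrow> real" assume f: "continuous_on K f"
    have upper: "AE x in \<mu>. l x f \<le> T f x" if f: "continuous_on K f" for f
    proof -
      have Tm: "T f \<in> borel_measurable \<mu>" using cond_operatorD(1)[OF T f] by auto
      have "AE x in \<mu>. \<forall>r\<in>\<rat>. x \<in> {y\<in>space \<mu>. T f y \<le> r} \<longrightarrow> (\<forall>\<^sub>F y in F x. y \<in> {y\<in>space \<mu>. T f y \<le> r})"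
        unfolding AE_ball_countable[OF countable_rat]
      proof
        fix r :: real
        have "{y\<in>space \<mu>. T f y \<le> r} \<in> sets \<mu>" using Tm by measurable
        then show "AE x in \<mu>. x \<in> {y\<in>space \<mu>. T f y \<le> r} \<longrightarrow> (\<forall>\<^sub>F y in F x. y \<in> {y\<in>space \<mu>. T f y \<le> r})"
          by (rule F(3))
      qed
      then show ?thesis
        using AE_space
      proof eventually_elim
        case (elim x)
        show ?case
        proof (rule field_le_epsilon)
          fix e :: real assume "0 < e"
          then obtain r where r: "r \<in> \<rat>" "T f x < r" "r < T f x + e" using Rats_dense_in_real[of "T f x" "T f x + e"] by auto
          then have "\<forall>\<^sub>F y in F x. y \<in> {y\<in>space \<mu>. T f y \<le> r}" using elim by auto
          then have "\<forall>\<^sub>F y in F x. T f y \<le> r" by (auto elim: eventually_mono)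
          then have "l x f \<le> r" using p_le[OF f] dom[OF f] by (meson order_trans)
          then show "l x f \<le> T f x + e" using r by simp
        qed
      qed
    qed
    have mf: "continuous_on K (\<lambda>y. - 1 * f y)" by (intro continuous_intros f)
    show "AE x in \<mu>. l x f = T f x"
      using upper[OF f] upper[OF mf] cond_operatorD(4)[OF T f, of "- 1"]
    proof eventually_elim
      case (elim x)
      then show ?case using neg[OF f, of x] by simp
    qed
  qed
qed

text \<open>For \<open>\<mu> = 0\<close> no proper filter contains all sets of full measure, but any choice of states will
  do, for instance evaluation at the points.\<close>
lemma pointwise_states:
  assumes T: "cond_operator T"
  obtains l where "\<And>x. x \<in> K \<Longrightarrow> state_on (l x)" "\<And>f. continuous_on K f \<Longrightarrow> AE x in \<mu>. l x f = T f x"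
proof (cases "emeasure \<mu> (space \<mu>) = 0")
  case True
  then have "ae_filter \<mu> = bot" by (simp only: ae_filter_eq_bot_iff)
  then have "AE x in \<mu>. P x" for P by (metis eventually_bot)
  moreover have "state_on (\<lambda>f. f x)" if "x \<in> K" for x
    using that by (auto simp: state_on_def linear_functional_on_def)
  ultimately show ?thesis by (intro that[of "\<lambda>x f. f x"])
next
  case False
  then show ?thesis using pointwise_states_nonnull[OF T] that by metis
qed

lemma state_measure:
  assumes "state_on l"
  obtains M where "M \<in> regular_borel_probs K" "\<And>f. continuous_on K f \<Longrightarrow> (\<integral>x. f x \<partial>M) = l f"
proof -
  have l: "linear_functional_on {f. continuous_on K f} l" "l (\<lambda>_. 1) = 1"
    "\<And>f. continuous_on K f \<Longrightarrow> (\<And>x. x \<in> K \<Longrightarrow> 0 \<le> f x) \<Longrightarrow> 0 \<le> l f"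
    using assms by (auto simp: state_on_def)
  obtain M where M: "M \<in> regular_borel_measures K" "\<And>f. continuous_on K f \<Longrightarrow> (\<integral>x. f x \<partial>M) = l f"
    by (rule riesz_representation[OF compact_K l(1,3)]) blast+
  interpret finite_measure M by (rule regular_borel_measuresD[OF M(1)])
  have "measure M (space M) = 1" using M(2)[of "\<lambda>_. 1"] l(2) by simp
  then have "prob_space M" by (intro prob_spaceI) (simp add: emeasure_eq_measure)
  then show ?thesis using M that by (auto simp: regular_borel_probs_def)
qed

end

text \<open>What remains is to pass from real to complex functions by treating real and imaginary parts
  separately.\<close>
theorem theorem4p1:
  fixes K :: "'a::locally_convex_space set" and \<mu> \<nu> :: "'a measure"
  assumes "compact K" and "convex K"
    and "\<mu> \<in> regular_borel_measures K" and "\<nu> \<in> regular_borel_measures K"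
    and "choquet_le K \<mu> \<nu>"
  shows "\<exists>L :: 'a \<Rightarrow> 'a measure.
    (\<forall>x\<in>K. L x \<in> regular_borel_probs K) \<and>
    (\<forall>a\<in>cont_affine K. AE x in \<mu>. (\<integral>y. a y \<partial>L x) = a x) \<and>
    (\<forall>f :: 'a \<Rightarrow> complex. continuous_on K f \<longrightarrow>
       (\<lambda>x. \<integral>y. f y \<partial>L x) \<in> borel_measurable (completion \<mu>)) \<and>
    (\<forall>f :: 'a \<Rightarrow> complex. continuous_on K f \<longrightarrow>
       (\<integral>x. f x \<partial>\<nu>) = (\<integral>x. (\<integral>y. f y \<partial>L x) \<partial>completion \<mu>))"
proof -
  interpret choquet_pair K \<mu> \<nu> using assms by unfold_locales
  obtain T where T: "cond_operator T" using cond_operator_exists by blast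
  obtain l where l: "\<And>x. x \<in> K \<Longrightarrow> state_on (l x)" and lT: "\<And>f. continuous_on K f \<Longrightarrow> AE x in \<mu>. l x f = T f x"
    by (rule pointwise_states[OF T]) blast
  have "\<exists>M. M \<in> regular_borel_probs K \<and> (\<forall>f :: 'a \<Rightarrow> real. continuous_on K f \<longrightarrow> (\<integral>y. f y \<partial>M) = l x f)" if "x \<in> K" for x
    using state_measure[OF l[OF that]] by metis
  then obtain L where L: "\<And>x. x \<in> K \<Longrightarrow> L x \<in> regular_borel_probs K"
    and Ll: "\<And>x f. x \<in> K \<Longrightarrow> continuous_on K f \<Longrightarrow> (\<integral>y. f y \<partial>L x) = l x f" for f :: "'a \<Rightarrow> real"
    by metis
  have reim: "continuous_on K (\<lambda>y. Re (f y))" "continuous_on K (\<lambda>y. Im (f y))" if "continuous_on K f" for f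
    using that by (auto intro: continuous_intros)
  define S where "S f x = Complex (T (\<lambda>y. Re (f y)) x) (T (\<lambda>y. Im (f y)) x)" for f :: "'a \<Rightarrow> complex" and x
  have LS: "AE x in \<mu>. (\<integral>y. f y \<partial>L x) = S f x" if f: "continuous_on K f" for f
    using lT[OF reim(1)[OF f]] lT[OF reim(2)[OF f]] AE_space
  proof eventually_elim
    case (elim x)
    then have x: "x \<in> K" by (simp add: space_mu)
    have M: "L x \<in> regular_borel_measures K" using L[OF x] by (simp add: regular_borel_probs_def)
    have "integrable (L x) f"
      by (rule integrable_continuous_on(2)[OF compact_K regular_borel_measuresD(1,2)[OF M] f])
    then have "Re (\<integral>y. f y \<partial>L x) = (\<integral>y. Re (f y) \<partial>L x)" "Im (\<integral>y. f y \<partial>L x) = (\<integral>y. Im (f y) \<partial>L x)" by simp_all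
    then show ?case
      using elim Ll[OF x reim(1)[OF f]] Ll[OF x reim(2)[OF f]] by (simp add: S_def complex_eq_iff)
  qed
  have S_int: "integrable \<mu> (S f)" "(\<integral>x. S f x \<partial>\<mu>) = (\<integral>x. f x \<partial>\<nu>)" if f: "continuous_on K f" for f
  proof -
    note TD = cond_operatorD(1,2)[OF T reim(1)[OF f]] cond_operatorD(1,2)[OF T reim(2)[OF f]]
    have "S f = (\<lambda>x. of_real (T (\<lambda>y. Re (f y)) x) + \<i> * of_real (T (\<lambda>y. Im (f y)) x))"
      by (auto simp: S_def complex_eq_iff)
    then show *: "integrable \<mu> (S f)" using TD(1,3) by (auto intro!: integrable_mult_right integrable_of_real)
    have \<nu>f: "integrable \<nu> f"
      by (rule integrable_continuous_on(2)[OF compact_K regular_borel_measuresD(1,2)[OF nu] f])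
    show "(\<integral>x. S f x \<partial>\<mu>) = (\<integral>x. f x \<partial>\<nu>)"
    proof (rule complex_eqI)
      show "Re (\<integral>x. S f x \<partial>\<mu>) = Re (\<integral>x. f x \<partial>\<nu>)"
      proof -
        have "(\<integral>x. Re (S f x) \<partial>\<mu>) = (\<integral>x. T (\<lambda>y. Re (f y)) x \<partial>\<mu>)" by (simp add: S_def)
        then show ?thesis using TD(2) integral_Re[OF *] integral_Re[OF \<nu>f] by linarith
      qed
      show "Im (\<integral>x. S f x \<partial>\<mu>) = Im (\<integral>x. f x \<partial>\<nu>)"
      proof -
        have "(\<integral>x. Im (S f x) \<partial>\<mu>) = (\<integral>x. T (\<lambda>y. Im (f y)) x \<partial>\<mu>)" by (simp add: S_def)
        then show ?thesis using TD(4) integral_Im[OF *] integral_Im[OF \<nu>f] by linarith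
      qed
    qed
  qed
  show ?thesis
  proof (intro exI[of _ L] conjI ballI allI impI L)
    fix a assume "a \<in> cont_affine K"
    then have a: "continuous_on K a" "affine_map_on K a" by (auto simp: cont_affine_def)
    then have "affine_map_on K (\<lambda>y. Re (a y))" "affine_map_on K (\<lambda>y. Im (a y))" by (auto simp: affine_map_on_def)
    from cond_operatorD(6)[OF T reim(1)[OF a(1)] this(1)] cond_operatorD(6)[OF T reim(2)[OF a(1)] this(2)] LS[OF a(1)]
    show "AE x in \<mu>. (\<integral>y. a y \<partial>L x) = a x"
      by eventually_elim (simp add: S_def complex_eq_iff)
  next
    fix f :: "'a \<Rightarrow> complex" assume f: "continuous_on K f"
    have Sm: "S f \<in> borel_measurable \<mu>" using S_int(1)[OF f] by auto
    show *: "(\<lambda>x. \<integral>y. f y \<partial>L x) \<in> borel_measurable (completion \<mu>)"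
      by (rule borel_measurable_completion_AE[OF Sm LS[OF f]])
    have "(\<integral>x. (\<integral>y. f y \<partial>L x) \<partial>completion \<mu>) = (\<integral>x. S f x \<partial>completion \<mu>)"
      by (intro integral_cong_AE * measurable_completion Sm AE_completion LS f)
    also have "\<dots> = (\<integral>x. S f x \<partial>\<mu>)" by (rule integral_completion[OF Sm])
    also have "\<dots> = (\<integral>x. f x \<partial>\<nu>)" by (rule S_int(2)[OF f])
    finally show "(\<integral>x. f x \<partial>\<nu>) = (\<integral>x. (\<integral>y. f y \<partial>L x) \<partial>completion \<mu>)" by simp
  qed
qed

end
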